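(* Let $k\in\mathbb{Z}_{\ge0}^{S}$ and $a\in\mathcal{O}_{C}$. If the pair $(k,a)$ is separated, then the lattice $\Theta_{k,a}$ is separated, i.e. $\bigcap_{n\ge 0}\varpi^n\Theta_{k,a}=0$.
   Context: $p$ is a prime; $F$ is a finite extension of $\mathbb{Q}_{p}$ with ring of integers $\mathcal{O}_{F}$, fixed uniformizer $\varpi$, residue field $\kappa_F$ of cardinality $q$. $C$ is a finite extension of $\mathbb{Q}_{p}$ such that $S=\mathrm{Hom}_{\mathbb{Q}_p\text{-alg}}(F,C)$ has $[F:\mathbb{Q}_{p}]$ elements and $C$ contains a fixed square root of $\sigma(\varpi)$ for each $\sigma\in S$. In statements about $\mathcal{O}_C$-modules, $\varpi^{n}$ ($n\in\mathbb{Z}$) means $\sigma(\varpi)^{n}$ for a fixed $\sigma\in S$. $G=GL_{2}(F)$, $K=GL_{2}(\mathcal{O}_{F})$, $Z$ the center, $\alpha=\mathrm{diag}(1,\varpi)$, $\chi(g)=\varpi^{-v_{F}(\det g)}$ with $v_F(\varpi)=1$. For $k\in\mathbb{Z}_{\ge0}^{S}$, $V_{k}=\bigotimes_{\sigma\in S}V^{\sigma}_{k_\sigma}$ with $V^{\sigma}_{k_\sigma}$ the homogeneous polynomials of degree $k_\sigma$ in $x_\sigma,y_\sigma$ over $C$, where $g=\begin{pmatrix}a&b\\c&d\end{pmatrix}$ acts by $x_\sigma^{k_\sigma-i}y_\sigma^{i}\mapsto \sigma(\chi(g))^{k_\sigma/2}(\sigma(a)x_\sigma+\sigma(c)y_\sigma)^{k_\sigma-i}(\sigma(b)x_\sigma+\sigma(d)y_\sigma)^{i}$,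 diagonally on the tensor product (representation $\rho_k$); $V_k^0$ is the $\mathcal{O}_C$-span of tensor products of monomials. $U_k$ multiplies $\bigotimes_\sigma x_\sigma^{k_\sigma-i_\sigma}y_\sigma^{i_\sigma}$ by $\prod_\sigma\sigma(\varpi)^{k_\sigma-i_\sigma}$; $\psi:G\to\mathrm{End}_C(V_k)$ is the unique function supported on $KZ\alpha^{-1}KZ$ with $\psi(\kappa_1\alpha^{-1}\kappa_2)=\rho_k(\kappa_1)U_k\rho_k(\kappa_2)$ ($\kappa_i\in KZ$). $\mathrm{ind}_{KZ}^{G}W$ ($W=V_k$ or $V_k^0$) is the module of $f:G\to W$ with $f(\kappa g)=\rho_k(\kappa)f(g)$ for $\kappa\in KZ$, supported on finitely many cosets $KZg$, $G$ acting by right translation; $[g,v]$ is supported on $KZg^{-1}$ with value $v$ at $g^{-1}$. $T([g,v])=\sum_{xKZ\in G/KZ}[gx,\psi(x^{-1})v]$; it preserves $\mathrm{ind}_{KZ}^GV_k^0$. $\Pi_{k,a}=\mathrm{ind}_{KZ}^{G}V_{k}/(T-a)\mathrm{ind}_{KZ}^{G}V_{k}$, and $\Theta_{k,a}$ is the image of $\mathrm{ind}_{KZ}^{G}V_{k}^{0}$ in it. Supports: let $I_0=\{0\}$ and for $n\ge1$, $I_{n}=\{\sum_{i=0}^{n-1}\varpi^{i}[\mu_{i}]:\mu_i\in\kappa_F\}$ ($[\cdot]$ the Teichmüller lift); put $g_{n,\mu}^{0}=\begin{pmatrix}\varpi^{n}&\mu\\0&1\end{pmatrix}$, $g_{n,\mu}^{1}=\begin{pmatrix}1&0\\\varpi\mu&\varpi^{n+1}\end{pmatrix}$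 ($n\ge0,\mu\in I_n$). Every $f\in\mathrm{ind}_{KZ}^GV_k$ is uniquely a finite sum $\sum_{n,\mu}([g^0_{n,\mu},v^0_{n,\mu}]+[g^1_{n,\mu},v^1_{n,\mu}])$. Write $f\in B_N$ if $v^0_{n,\mu}=0$ for $n>N$ and $v^1_{n,\mu}=0$ for $n>N-1$; write $f\in B^0$ if all $v^1_{n,\mu}=0$. $B_N+\varpi^n\mathrm{ind}_{KZ}^GV_k^0$ denotes the set of sums. The pair $(k,a)$ is called separated if for all sufficiently large $N\in\mathbb{Z}_{>0}$ there is $\epsilon\in\mathbb{Z}_{\ge0}$ depending only on $N,k,a$ such that for all $n\in\mathbb{Z}_{\ge0}$ and all $f\in\mathrm{ind}_{KZ}^GV_k$ with $f\in B^0$: $(T-a)(f)\in B_N+\varpi^n\mathrm{ind}_{KZ}^GV_k^0$ implies $f\in B_{N-1}+\varpi^{n-\epsilon}\mathrm{ind}_{KZ}^GV_k^0$. *)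

theory Defs
  imports
    "HOL-Analysis.Analysis"
    "HOL-Library.Poly_Mapping"
    "HOL-Computational_Algebra.Fraction_Field"
    "Berlekamp_Zassenhaus.Finite_Field"
begin

section \<open>The \<open>p\<close>-adic numbers\<close>

text \<open>The prime is \<open>p = CARD('p)\<close>. The type \<open>'p padic_int\<close> is the inverse limit of the rings
  \<open>\<int>/p\<^sup>n\<close>, each residue being represented in \<open>{0..<p\<^sup>n}\<close>; \<open>'p padic\<close> is its field of fractions.\<close>

typedef ('p::prime_card) padic_int =
  "{x :: nat \<Rightarrow> int. \<forall>n. x n \<in> {0..<int CARD('p) ^ n} \<and> x (Suc n) mod int CARD('p) ^ n = x n}"
proof
  have "int CARD('p) > 0"
    using prime_card[where 'a = 'p] prime_gt_0_nat by simp
  then show "(\<lambda>_. 0) \<in> {x :: nat \<Rightarrow> int. \<forall>n. x n \<in> {0..<int CARD('p) ^ n}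
      \<and> x (Suc n) mod int CARD('p) ^ n = x n}"
    by simp
qed

setup_lifting type_definition_padic_int

lemma card_prime_pos: "int CARD('p::prime_card) > 0"
  using prime_card[where 'a = 'p] prime_gt_0_nat by simp

lemma padic_int_compat:
  fixes f :: "nat \<Rightarrow> int"
  assumes "\<And>n. f (Suc n) mod int CARD('p::prime_card) ^ n = f n mod int CARD('p) ^ n"
  shows "f n mod int CARD('p) ^ n \<in> {0..<int CARD('p) ^ n}
    \<and> f (Suc n) mod int CARD('p) ^ Suc n mod int CARD('p) ^ n = f n mod int CARD('p) ^ n"
proof -
  have "int CARD('p) ^ n dvd int CARD('p) ^ Suc n"
    by simp
  then show ?thesis
    using assms card_prime_pos[where 'p = 'p] by (simp add: mod_mod_cancel)
qed

instantiation padic_int :: (prime_card) comm_ring_1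
begin

lift_definition zero_padic_int :: "'a padic_int" is "\<lambda>n. 0 mod int CARD('a) ^ n"
  using padic_int_compat[where 'p = 'a and f = "\<lambda>_. 0"] by simp

lift_definition one_padic_int :: "'a padic_int" is "\<lambda>n. 1 mod int CARD('a) ^ n"
  using padic_int_compat[where 'p = 'a and f = "\<lambda>_. 1"] by simp

lift_definition plus_padic_int :: "'a padic_int \<Rightarrow> 'a padic_int \<Rightarrow> 'a padic_int"
  is "\<lambda>x y n. (x n + y n) mod int CARD('a) ^ n"
  subgoal for x y
    by (intro allI padic_int_compat) (metis mod_add_eq)
  done

lift_definition uminus_padic_int :: "'a padic_int \<Rightarrow> 'a padic_int"
  is "\<lambda>x n. (- x n) mod int CARD('a) ^ n"
  subgoal for x
    by (intro allI padic_int_compat) (metis mod_minus_eq)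
  done

lift_definition minus_padic_int :: "'a padic_int \<Rightarrow> 'a padic_int \<Rightarrow> 'a padic_int"
  is "\<lambda>x y n. (x n - y n) mod int CARD('a) ^ n"
  subgoal for x y
    by (intro allI padic_int_compat) (metis mod_diff_eq)
  done

lift_definition times_padic_int :: "'a padic_int \<Rightarrow> 'a padic_int \<Rightarrow> 'a padic_int"
  is "\<lambda>x y n. (x n * y n) mod int CARD('a) ^ n"
  subgoal for x y
    by (intro allI padic_int_compat) (metis mod_mult_eq)
  done

instance
proof
  fix a b c :: "'a padic_int"
  show "a * b * c = a * (b * c)"
    by transfer (simp add: fun_eq_iff mod_simps algebra_simps)
  show "a * b = b * a"
    by transfer (simp add: mult.commute)
  show "1 * a = a"
    by transfer (simp add: fun_eq_iff mod_simps)
  show "a + b + c = a + (b + c)"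
    by transfer (simp add: fun_eq_iff mod_simps algebra_simps)
  show "a + b = b + a"
    by transfer (simp add: add.commute)
  show "0 + a = a"
    by transfer (simp add: fun_eq_iff)
  show "- a + a = 0"
    by transfer (simp add: fun_eq_iff mod_simps)
  show "a - b = a + - b"
    by transfer (simp add: fun_eq_iff mod_simps)
  show "(a + b) * c = a * c + b * c"
    by transfer (simp add: fun_eq_iff mod_simps algebra_simps)
  show "(0::'a padic_int) \<noteq> 1"
  proof
    assume "(0::'a padic_int) = 1"
    then have "0 mod int CARD('a) ^ 1 = 1 mod int CARD('a) ^ 1"
      by transfer metis
    moreover have "CARD('a) > 1"
      using prime_card[where 'a = 'a] prime_gt_1_nat by simp
    ultimately show False
      by simp
  qed
qed

end

instance padic_int :: (prime_card) idom
proof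
  fix a b :: "'a padic_int"
  let ?p = "int CARD('a)"
  assume "a \<noteq> 0" "b \<noteq> 0"
  have red: "Rep_padic_int x (n + m) mod ?p ^ n = Rep_padic_int x n"
    for x :: "'a padic_int" and n m
  proof (induction m)
    case 0
    show ?case
      using Rep_padic_int[of x] by simp
  next
    case (Suc m)
    have "Rep_padic_int x (Suc (n + m)) mod ?p ^ (n + m) mod ?p ^ n
        = Rep_padic_int x (Suc (n + m)) mod ?p ^ n"
      by (rule mod_mod_cancel) (simp add: le_imp_power_dvd)
    moreover have "Rep_padic_int x (Suc (n + m)) mod ?p ^ (n + m) = Rep_padic_int x (n + m)"
      using Rep_padic_int[of x] by simp
    ultimately show ?case
      using Suc by simp
  qed
  have pr: "prime ?p"
    using prime_card[where 'a = 'a] by simp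
  obtain m n where m: "Rep_padic_int a m \<noteq> 0" and n: "Rep_padic_int b n \<noteq> 0"
    using \<open>a \<noteq> 0\<close> \<open>b \<noteq> 0\<close> by (metis Rep_padic_int_inject ext mod_0 zero_padic_int.rep_eq)
  let ?x = "Rep_padic_int a (m + n)" and ?y = "Rep_padic_int b (m + n)"
  have x: "\<not> ?p ^ m dvd ?x"
    using red[of a m n] m by (metis dvd_imp_mod_0)
  have y: "\<not> ?p ^ n dvd ?y"
    using red[of b n m] n by (metis add.commute dvd_imp_mod_0)
  have ne: "?x \<noteq> 0" "?y \<noteq> 0"
    using x y by auto
  have "\<not> ?p ^ (m + n) dvd ?x * ?y"
  proof
    assume "?p ^ (m + n) dvd ?x * ?y"
    then have "m + n \<le> multiplicity ?p (?x * ?y)"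
      using ne not_prime_unit[of ?p] pr by (intro multiplicity_geI) auto
    also have "\<dots> = multiplicity ?p ?x + multiplicity ?p ?y"
      using ne pr by (simp add: prime_elem_multiplicity_mult_distrib)
    finally have "m \<le> multiplicity ?p ?x \<or> n \<le> multiplicity ?p ?y"
      by linarith
    then show False
      using x y multiplicity_dvd' by blast
  qed
  then have "Rep_padic_int (a * b) (m + n) \<noteq> Rep_padic_int 0 (m + n)"
    by (simp add: times_padic_int.rep_eq zero_padic_int.rep_eq dvd_eq_mod_eq_0)
  then show "a * b \<noteq> 0"
    by auto
qed

type_synonym 'p padic = "'p padic_int fract"

section \<open>Finite extensions of the \<open>p\<close>-adic numbers\<close>

text \<open>An extension is given by its structure map \<open>\<iota>\<close>.\<close>

definition finite_extension :: "('p::prime_card padic \<Rightarrow> 'f::field) \<Rightarrow> bool" where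
  "finite_extension \<iota> \<longleftrightarrow>
    field_hom \<iota> \<and> (\<exists>B. finite B \<and> module.span (\<lambda>c x. \<iota> c * x) B = UNIV)"

definition extension_degree :: "('p::prime_card padic \<Rightarrow> 'f::field) \<Rightarrow> nat" where
  "extension_degree \<iota> = vector_space.dim (\<lambda>c x. \<iota> c * x) UNIV"

text \<open>The integral closure of the \<open>p\<close>-adic integers.\<close>

definition integers :: "('p::prime_card padic \<Rightarrow> 'f::field) \<Rightarrow> 'f set" where
  "integers \<iota> = {x. \<exists>P :: 'p padic_int poly.
     lead_coeff P = 1 \<and> poly (map_poly (\<lambda>z. \<iota> (Fract z 1)) P) x = 0}"

definition integer_units :: "('p::prime_card padic \<Rightarrow> 'f::field) \<Rightarrow> 'f set" where
  "integer_units \<iota> = {x \<in> integers \<iota>. \<exists>y \<in> integers \<iota>. x * y = 1}"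

text \<open>A uniformizer generates the maximal ideal, which consists of the non-units.\<close>

definition uniformizer :: "('p::prime_card padic \<Rightarrow> 'f::field) \<Rightarrow> 'f \<Rightarrow> bool" where
  "uniformizer \<iota> w \<longleftrightarrow> integers \<iota> - integer_units \<iota> = (\<lambda>y. w * y) ` integers \<iota>"

definition algebra_homs ::
    "('p::prime_card padic \<Rightarrow> 'f::field) \<Rightarrow> ('p padic \<Rightarrow> 'c::field) \<Rightarrow> ('f \<Rightarrow> 'c) set" where
  "algebra_homs \<iota> \<iota>' = {\<sigma>. field_hom \<sigma> \<and> (\<forall>x. \<sigma> (\<iota> x) = \<iota>' x)}"

section \<open>Polynomials\<close>

text \<open>Polynomials over \<open>'c\<close> in the variables \<open>x\<^sub>s\<close>, \<open>y\<^sub>s\<close>, where \<open>s :: 's\<close>. The tensor product of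
  the spaces of homogeneous polynomials in \<open>x\<^sub>s\<close>, \<open>y\<^sub>s\<close> of degree \<open>k s\<close> is realised as the space of
  multihomogeneous polynomials of multidegree \<open>k\<close>, a pure tensor being the product of its factors.\<close>

datatype 's xy_var = VX 's | VY 's

type_synonym ('s, 'c) mvpoly = "('s xy_var \<Rightarrow>\<^sub>0 nat) \<Rightarrow>\<^sub>0 'c"

definition mv_const :: "'c::comm_ring_1 \<Rightarrow> ('s, 'c) mvpoly" where
  "mv_const c = Poly_Mapping.single 0 c"

definition mv_var :: "'s xy_var \<Rightarrow> ('s, 'c::comm_ring_1) mvpoly" where
  "mv_var z = Poly_Mapping.single (Poly_Mapping.single z 1) 1"

definition mv_subst ::
    "('s xy_var \<Rightarrow> ('s, 'c::comm_ring_1) mvpoly) \<Rightarrow> ('s, 'c) mvpoly \<Rightarrow> ('s, 'c) mvpoly" where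
  "mv_subst L P = (\<Sum>m\<in>Poly_Mapping.keys P. mv_const (Poly_Mapping.lookup P m) *
     (\<Prod>z\<in>Poly_Mapping.keys m. L z ^ Poly_Mapping.lookup m z))"

section \<open>Compactly induced representations\<close>

type_synonym ('f, 'c) weight = "('f \<Rightarrow> 'c) \<Rightarrow> nat"
type_synonym ('f, 'c) tensor = "('f \<Rightarrow> 'c, 'c) mvpoly"
type_synonym ('f, 'c) ifun = "'f^2^2 \<Rightarrow> ('f, 'c) tensor"

definition mat2 :: "'a \<Rightarrow> 'a \<Rightarrow> 'a \<Rightarrow> 'a \<Rightarrow> 'a::zero^2^2" where
  "mat2 a b c d = vector [vector [a, b], vector [c, d]]"

text \<open>\<open>\<iota>F\<close> and \<open>\<iota>C\<close> are the structure maps of \<open>F\<close> and \<open>C\<close>, \<open>\<pi>\<close> is the uniformizer, \<open>rt \<sigma>\<close> is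
  the fixed square root of \<open>\<sigma> \<pi>\<close>, and \<open>\<sigma>\<^sub>0\<close> is the embedding through which powers of \<open>\<pi>\<close> act on
  modules over the integers of \<open>C\<close>.\<close>

locale gl2_setup =
  fixes \<iota>F :: "'p::prime_card padic \<Rightarrow> 'f::field"
    and \<iota>C :: "'p padic \<Rightarrow> 'c::field"
    and \<pi> :: 'f
    and rt :: "('f \<Rightarrow> 'c) \<Rightarrow> 'c"
    and \<sigma>\<^sub>0 :: "'f \<Rightarrow> 'c"
  assumes finite_F: "finite_extension \<iota>F"
    and finite_C: "finite_extension \<iota>C"
    and uniformizer: "uniformizer \<iota>F \<pi>"
    and card_homs: "card (algebra_homs \<iota>F \<iota>C) = extension_degree \<iota>F"
    and square_roots: "\<And>\<sigma>. \<sigma> \<in> algebra_homs \<iota>F \<iota>C \<Longrightarrow> rt \<sigma> ^ 2 = \<sigma> \<pi>"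
    and \<sigma>\<^sub>0: "\<sigma>\<^sub>0 \<in> algebra_homs \<iota>F \<iota>C"
begin

abbreviation "OF \<equiv> integers \<iota>F"
abbreviation "OC \<equiv> integers \<iota>C"
abbreviation "S \<equiv> algebra_homs \<iota>F \<iota>C"

definition val :: "'f \<Rightarrow> int" where
  "val x = (THE n. \<exists>u\<in>integer_units \<iota>F. x = u * \<pi> powi n)"

text \<open>Elements of the residue field are the cosets of the maximal ideal. The Teichmueller lift of
  \<open>\<mu>\<close> is its unique representative \<open>t\<close> with \<open>t\<^sup>q = t\<close>.\<close>

definition residue_field :: "'f set set" where
  "residue_field = (\<lambda>x. (\<lambda>y. x + \<pi> * y) ` OF) ` OF"

definition teich :: "'f set \<Rightarrow> 'f" where
  "teich \<mu> = (THE t. t \<in> \<mu> \<and> t ^ card residue_field = t)"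

definition I :: "nat \<Rightarrow> 'f set" where
  "I n = {\<Sum>i<n. \<pi> ^ i * teich (\<mu> i) | \<mu>. \<forall>i<n. \<mu> i \<in> residue_field}"

definition G :: "('f^2^2) set" where
  "G = {g. invertible g}"

definition K :: "('f^2^2) set" where
  "K = {g. (\<forall>i j. g $ i $ j \<in> OF) \<and> (\<exists>h. (\<forall>i j. h $ i $ j \<in> OF) \<and> g ** h = mat 1 \<and> h ** g = mat 1)}"

definition Z :: "('f^2^2) set" where
  "Z = {mat z | z. z \<noteq> 0}"

definition KZ :: "('f^2^2) set" where
  "KZ = {\<kappa> ** z | \<kappa> z. \<kappa> \<in> K \<and> z \<in> Z}"

definition alpha :: "'f^2^2" where
  "alpha = mat2 1 0 0 \<pi>"

subsection \<open>The representation on multihomogeneous polynomials\<close>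

definition monom_tensor :: "('f, 'c) weight \<Rightarrow> ('f, 'c) weight \<Rightarrow> ('f, 'c) tensor" where
  "monom_tensor k i = (\<Prod>\<sigma>\<in>S. mv_var (VX \<sigma>) ^ (k \<sigma> - i \<sigma>) * mv_var (VY \<sigma>) ^ i \<sigma>)"

text \<open>The \<open>R\<close>-span of the tensor products of monomials.\<close>

definition V_over :: "'c set \<Rightarrow> ('f, 'c) weight \<Rightarrow> ('f, 'c) tensor set" where
  "V_over R k = {\<Sum>i\<in>PiE S (\<lambda>\<sigma>. {..k \<sigma>}). mv_const (c i) * monom_tensor k i | c. \<forall>i. c i \<in> R}"

definition V :: "('f, 'c) weight \<Rightarrow> ('f, 'c) tensor set" where
  "V k = V_over UNIV k"

definition V0 :: "('f, 'c) weight \<Rightarrow> ('f, 'c) tensor set" where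
  "V0 k = V_over OC k"

primrec var_image :: "'f^2^2 \<Rightarrow> ('f \<Rightarrow> 'c) xy_var \<Rightarrow> ('f, 'c) tensor" where
  "var_image g (VX \<sigma>) = mv_const (\<sigma> (g $ 1 $ 1)) * mv_var (VX \<sigma>) + mv_const (\<sigma> (g $ 2 $ 1)) * mv_var (VY \<sigma>)"
| "var_image g (VY \<sigma>) = mv_const (\<sigma> (g $ 1 $ 2)) * mv_var (VX \<sigma>) + mv_const (\<sigma> (g $ 2 $ 2)) * mv_var (VY \<sigma>)"

text \<open>The power of \<open>rt \<sigma>\<close> is \<open>\<sigma>(\<chi>(g))\<close> to the power \<open>k \<sigma> / 2\<close>, with \<open>\<chi>(g) = \<pi> powi (- val (det g))\<close>.\<close>

definition rho :: "('f, 'c) weight \<Rightarrow> 'f^2^2 \<Rightarrow> ('f, 'c) tensor \<Rightarrow> ('f, 'c) tensor" where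
  "rho k g P = mv_const (\<Prod>\<sigma>\<in>S. rt \<sigma> powi (- val (det g) * int (k \<sigma>))) * mv_subst (var_image g) P"

text \<open>On \<open>V k\<close> the exponent of \<open>VX \<sigma>\<close> in the monomial with index \<open>i\<close> is \<open>k \<sigma> - i \<sigma>\<close>.\<close>

definition U :: "('f, 'c) tensor \<Rightarrow> ('f, 'c) tensor" where
  "U P = (\<Sum>m\<in>Poly_Mapping.keys P. Poly_Mapping.single m
     (Poly_Mapping.lookup P m * (\<Prod>\<sigma>\<in>S. \<sigma> \<pi> ^ Poly_Mapping.lookup m (VX \<sigma>))))"

text \<open>For \<open>v\<close> in \<open>V k\<close> the value does not depend on the factorisation of \<open>g\<close>.\<close>

definition psi :: "('f, 'c) weight \<Rightarrow> 'f^2^2 \<Rightarrow> ('f, 'c) tensor \<Rightarrow> ('f, 'c) tensor" where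
  "psi k g v =
    (if \<exists>\<kappa>\<in>KZ. \<exists>\<kappa>'\<in>KZ. g = \<kappa> ** matrix_inv alpha ** \<kappa>'
     then THE w. \<exists>\<kappa>\<in>KZ. \<exists>\<kappa>'\<in>KZ. g = \<kappa> ** matrix_inv alpha ** \<kappa>' \<and> w = rho k \<kappa> (U (rho k \<kappa>' v))
     else 0)"

subsection \<open>Induction and the Hecke operator\<close>

text \<open>Functions on \<open>G\<close> are functions on all matrices that vanish outside \<open>G\<close>.\<close>

definition ind :: "('f, 'c) weight \<Rightarrow> ('f, 'c) tensor set \<Rightarrow> ('f, 'c) ifun set" where
  "ind k W = {f. (\<forall>g. g \<notin> G \<longrightarrow> f g = 0) \<and> (\<forall>g\<in>G. f g \<in> W) \<and>
     (\<forall>\<kappa>\<in>KZ. \<forall>g\<in>G. f (\<kappa> ** g) = rho k \<kappa> (f g)) \<and>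
     (\<exists>A. finite A \<and> A \<subseteq> G \<and> (\<forall>g\<in>G. f g \<noteq> 0 \<longrightarrow> (\<exists>h\<in>A. \<exists>\<kappa>\<in>KZ. g = \<kappa> ** h)))}"

definition bracket :: "('f, 'c) weight \<Rightarrow> 'f^2^2 \<Rightarrow> ('f, 'c) tensor \<Rightarrow> ('f, 'c) ifun" where
  "bracket k g v h = (if h ** g \<in> KZ then rho k (h ** g) v else 0)"

definition cosets :: "('f^2^2) set set" where
  "cosets = (\<lambda>g. (\<lambda>\<kappa>. g ** \<kappa>) ` KZ) ` G"

definition rep :: "('f^2^2) set \<Rightarrow> 'f^2^2" where
  "rep A = (SOME g. g \<in> A)"

text \<open>\<open>hecke_bracket k g v\<close> is the image of \<open>[g, v]\<close> under the Hecke operator, and \<open>hecke\<close> is the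
  linear extension: \<open>f\<close> is the sum of \<open>[g, f(g\<^sup>-\<^sup>1)]\<close> over the cosets \<open>gKZ\<close>. Only the finitely many
  nonzero terms of the sums over cosets are kept.\<close>

definition hecke_bracket :: "('f, 'c) weight \<Rightarrow> 'f^2^2 \<Rightarrow> ('f, 'c) tensor \<Rightarrow> ('f, 'c) ifun" where
  "hecke_bracket k g v h =
    (\<Sum>A | A \<in> cosets \<and> psi k (matrix_inv (rep A)) v \<noteq> 0.
       bracket k (g ** rep A) (psi k (matrix_inv (rep A)) v) h)"

definition hecke :: "('f, 'c) weight \<Rightarrow> ('f, 'c) ifun \<Rightarrow> ('f, 'c) ifun" where
  "hecke k f h =
    (\<Sum>A | A \<in> cosets \<and> f (matrix_inv (rep A)) \<noteq> 0.
       hecke_bracket k (rep A) (f (matrix_inv (rep A))) h)"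

definition hecke_minus :: "('f, 'c) weight \<Rightarrow> 'c \<Rightarrow> ('f, 'c) ifun \<Rightarrow> ('f, 'c) ifun" where
  "hecke_minus k a f h = hecke k f h - mv_const a * f h"

subsection \<open>The quotient and the lattice\<close>

text \<open>Elements of the quotient of \<open>ind k (V k)\<close> by the range of \<open>T - a\<close> are the cosets
  \<open>proj k a f\<close>, as sets.\<close>

definition hecke_range :: "('f, 'c) weight \<Rightarrow> 'c \<Rightarrow> ('f, 'c) ifun set" where
  "hecke_range k a = hecke_minus k a ` ind k (V k)"

definition proj :: "('f, 'c) weight \<Rightarrow> 'c \<Rightarrow> ('f, 'c) ifun \<Rightarrow> ('f, 'c) ifun set" where
  "proj k a f = (\<lambda>r h. f h + r h) ` hecke_range k a"

definition Pi_zero :: "('f, 'c) weight \<Rightarrow> 'c \<Rightarrow> ('f, 'c) ifun set" where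
  "Pi_zero k a = proj k a (\<lambda>_. 0)"

definition Pi_scale :: "('f, 'c) weight \<Rightarrow> 'c \<Rightarrow> 'c \<Rightarrow> ('f, 'c) ifun set \<Rightarrow> ('f, 'c) ifun set" where
  "Pi_scale k a c Q = (\<Union>f\<in>Q. proj k a (\<lambda>h. mv_const c * f h))"

definition Theta :: "('f, 'c) weight \<Rightarrow> 'c \<Rightarrow> ('f, 'c) ifun set set" where
  "Theta k a = proj k a ` ind k (V0 k)"

subsection \<open>Supports and separated pairs\<close>

definition g0 :: "nat \<Rightarrow> 'f \<Rightarrow> 'f^2^2" where
  "g0 n \<mu> = mat2 (\<pi> ^ n) \<mu> 0 1"

definition g1 :: "nat \<Rightarrow> 'f \<Rightarrow> 'f^2^2" where
  "g1 n \<mu> = mat2 1 0 (\<pi> * \<mu>) (\<pi> ^ (n + 1))"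

definition decomposition :: "('f, 'c) weight \<Rightarrow> ('f, 'c) ifun \<Rightarrow>
     (nat \<Rightarrow> 'f \<Rightarrow> ('f, 'c) tensor) \<Rightarrow> (nat \<Rightarrow> 'f \<Rightarrow> ('f, 'c) tensor) \<Rightarrow> bool" where
  "decomposition k f v0 v1 \<longleftrightarrow>
    (\<forall>n. \<forall>\<mu>\<in>I n. v0 n \<mu> \<in> V k \<and> v1 n \<mu> \<in> V k) \<and>
    (let D = {(n, \<mu>). \<mu> \<in> I n \<and> (v0 n \<mu> \<noteq> 0 \<or> v1 n \<mu> \<noteq> 0)} in
      finite D \<and>
      (\<forall>h. f h = (\<Sum>(n, \<mu>)\<in>D. bracket k (g0 n \<mu>) (v0 n \<mu>) h + bracket k (g1 n \<mu>) (v1 n \<mu>) h)))"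

text \<open>The condition \<open>n + 1 > N\<close> expresses \<open>n > N - 1\<close> without truncated subtraction.\<close>

definition B :: "('f, 'c) weight \<Rightarrow> nat \<Rightarrow> ('f, 'c) ifun set" where
  "B k N = {f \<in> ind k (V k). \<exists>v0 v1. decomposition k f v0 v1 \<and>
     (\<forall>n. \<forall>\<mu>\<in>I n. (n > N \<longrightarrow> v0 n \<mu> = 0) \<and> (n + 1 > N \<longrightarrow> v1 n \<mu> = 0))}"

definition B0 :: "('f, 'c) weight \<Rightarrow> ('f, 'c) ifun set" where
  "B0 k = {f \<in> ind k (V k). \<exists>v0 v1. decomposition k f v0 v1 \<and> (\<forall>n. \<forall>\<mu>\<in>I n. v1 n \<mu> = 0)}"

definition B_plus :: "('f, 'c) weight \<Rightarrow> nat \<Rightarrow> int \<Rightarrow> ('f, 'c) ifun set" where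
  "B_plus k N n = {\<lambda>h. b h + mv_const (\<sigma>\<^sub>0 \<pi> powi n) * e h | b e. b \<in> B k N \<and> e \<in> ind k (V0 k)}"

definition separated_pair :: "('f, 'c) weight \<Rightarrow> 'c \<Rightarrow> bool" where
  "separated_pair k a \<longleftrightarrow>
    (\<exists>N\<^sub>0. \<forall>N\<ge>N\<^sub>0. N > 0 \<longrightarrow>
      (\<exists>\<epsilon>::nat. \<forall>n::nat. \<forall>f\<in>B0 k.
        hecke_minus k a f \<in> B_plus k N (int n) \<longrightarrow> f \<in> B_plus k (N - 1) (int n - int \<epsilon>)))"

end

end

theory Submission
  imports Defs "Jordan_Normal_Form.Char_Poly"
begin

text \<open>A function in \<open>ind k (V k)\<close> is determined by its values \<open>f(g\<^sup>-\<^sup>1)\<close> at the vertices \<open>gKZ\<close> of the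
  tree \<open>G/KZ\<close>, and \<open>T\<close> is a weighted sum over the neighbours of a vertex. Suppose that the class of \<open>f\<close>
  is divisible by all powers of \<open>\<pi>\<close> in the lattice, say \<open>f = \<pi>\<^sup>n l\<^sub>n + (T - a) h\<^sub>n\<close> with integral \<open>l\<^sub>n\<close>.
  Then \<open>(T - a) h\<^sub>n\<close> lies in \<open>B\<^sub>N + \<pi>\<^sup>n ind V\<^sup>0\<close> with \<open>N\<close> independent of \<open>n\<close>. Restricting \<open>h\<^sub>n\<close> to one half of
  the tree changes \<open>(T - a) h\<^sub>n\<close> only at the central edge or on the other half, where it becomes zero, so the
  separation property controls \<open>h\<^sub>n\<close> on this half; translation by the matrix with rows \<open>(0, 1)\<close>, \<open>(\<pi>, 0)\<close>
  exchanges the halves and controls \<open>h\<^sub>n\<close> on the other one. Hence \<open>f\<close> is congruent to an element of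
  \<open>(T - a) B\<^sub>N\<^sub>+\<^sub>1\<close> modulo \<open>\<pi>\<^sup>n\<^sup>-\<^sup>E\<close> for all \<open>n\<close>. As \<open>B\<^sub>N\<^sub>+\<^sub>1\<close> has finite dimension, \<open>(T - a) B\<^sub>N\<^sub>+\<^sub>1\<close> is closed
  and contains \<open>f\<close>.

  On the arithmetic side, the integers are a finitely generated module over the \<open>p\<close>-adic integers. This
  yields completeness, finiteness of the residue field and hence the Teichmueller lifts, so that the
  sets \<open>I n\<close> represent the residues modulo \<open>\<pi>\<^sup>n\<close>.\<close>

section \<open>The ring of \<open>p\<close>-adic integers\<close>

text \<open>The obstacle is that the functions \<open>h_n\<close> are arbitrary: neither their
  supports nor their denominators are bounded in \<open>n\<close>, so no limit of them is available.
  Separation supplies the missing uniformity, but only for functions living on one half of the tree.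
  Cutting at the central edge is harmless outside a ball of positive radius, because there a vertex
  and all its neighbours lie in the same half. The flip of the central edge moves the centre of the
  ball to a neighbour, so radius \<open>N\<close> turns into \<open>N + 1\<close>; this is the
  origin of \<open>N + 1\<close> and of a second separation constant. \<open>E\<close> is the sum of
  the two constants and is paid for by starting from exponent \<open>n + E\<close>. The integral
  part of \<open>h_n\<close> goes into the error term, since \<open>T - a\<close> preserves
  integrality for integral \<open>a\<close>. What remains are approximations of \<open>f\<close>
  from one fixed finite-dimensional space. Their coefficients may still have unbounded denominators,
  so closedness is proved by elimination and not by a limit of coefficients.\<close>

lemma Rep_padic_int_range:
  "0 \<le> Rep_padic_int (x :: 'p::prime_card padic_int) n" "Rep_padic_int x n < int CARD('p) ^ n"
  using Rep_padic_int[of x] by auto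

lemma Rep_padic_int_mod_self:
  "Rep_padic_int (x :: 'p::prime_card padic_int) n mod int CARD('p) ^ n = Rep_padic_int x n"
  using Rep_padic_int_range[of x n] by simp

lemma Rep_padic_int_mod_power:
  "Rep_padic_int (x :: 'p::prime_card padic_int) (n + m) mod int CARD('p) ^ n = Rep_padic_int x n"
proof (induction m)
  case 0
  show ?case by (simp add: Rep_padic_int_mod_self)
next
  case (Suc m)
  have "Rep_padic_int x (Suc (n + m)) mod int CARD('p) ^ (n + m) mod int CARD('p) ^ n
      = Rep_padic_int x (Suc (n + m)) mod int CARD('p) ^ n"
    by (rule mod_mod_cancel) (simp add: le_imp_power_dvd)
  moreover have "Rep_padic_int x (Suc (n + m)) mod int CARD('p) ^ (n + m) = Rep_padic_int x (n + m)"
    using Rep_padic_int[of x] by simp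
  ultimately show ?case
    using Suc by simp
qed

lemma Rep_padic_int_of_nat:
  "Rep_padic_int (of_nat m :: 'p::prime_card padic_int) n = int m mod int CARD('p) ^ n"
  by (induction m)
    (simp_all add: zero_padic_int.rep_eq one_padic_int.rep_eq plus_padic_int.rep_eq mod_simps)

lemma padic_int_eqI:
  "(\<And>n. Rep_padic_int x n = Rep_padic_int y n) \<Longrightarrow> x = y"
  by (metis Rep_padic_int_inject ext)

text \<open>Division by p^n costs n digits, so residue \<open>k\<close> of the quotient is read off
  from residue \<open>n + k\<close> of \<open>x\<close>.\<close>

lemma padic_int_power_dvd:
  fixes x :: "'p::prime_card padic_int"
  assumes "Rep_padic_int x n = 0"
  obtains y where "x = of_nat CARD('p) ^ n * y"
proof -
  let ?p = "int CARD('p)"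
  have p0: "?p > 0" by (rule card_prime_pos)
  define f where "f k = Rep_padic_int x (n + k) div ?p ^ n" for k
  have dv: "?p ^ n dvd Rep_padic_int x (n + k)" for k
    using Rep_padic_int_mod_power[of x n k] assms by (simp add: dvd_eq_mod_eq_0)
  have f: "?p ^ n * f k = Rep_padic_int x (n + k)" for k
    using dv[of k] by (simp add: f_def)
  have ok: "f k \<in> {0..<?p ^ k} \<and> f (Suc k) mod ?p ^ k = f k" for k
  proof -
    have "?p ^ n * f k < ?p ^ n * ?p ^ k"
      using Rep_padic_int_range(2)[of x "n + k"] by (simp add: f power_add)
    then have 1: "f k < ?p ^ k" using p0 by simp
    have 2: "f k \<ge> 0" unfolding f_def using Rep_padic_int_range(1)[of x "n + k"] p0
      by (simp add: pos_imp_zdiv_nonneg_iff)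
    have "?p ^ n * (f (Suc k) mod ?p ^ k) = (?p ^ n * f (Suc k)) mod (?p ^ n * ?p ^ k)"
      by (rule mult_mod_right)
    also have "\<dots> = Rep_padic_int x (n + k + 1) mod ?p ^ (n + k)"
      by (simp add: f power_add)
    also have "\<dots> = ?p ^ n * f k"
      by (simp only: Rep_padic_int_mod_power f)
    finally have "f (Suc k) mod ?p ^ k = f k" using p0 by simp
    then show ?thesis using 1 2 by simp
  qed
  define y :: "'p padic_int" where "y = Abs_padic_int f"
  have Ry: "Rep_padic_int y = f"
    unfolding y_def by (rule Abs_padic_int_inverse) (use ok in auto)
  have "x = of_nat CARD('p) ^ n * y"
  proof (rule padic_int_eqI)
    fix k
    have "Rep_padic_int (of_nat CARD('p) ^ n * y) k = (?p ^ n * f k) mod ?p ^ k"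
      using Rep_padic_int_of_nat[of "CARD('p) ^ n" k, where 'p = 'p]
      by (simp add: times_padic_int.rep_eq Ry mod_simps)
    also have "\<dots> = Rep_padic_int x k"
      using Rep_padic_int_mod_power[of x k n] by (simp add: f add.commute)
    finally show "Rep_padic_int x k = Rep_padic_int (of_nat CARD('p) ^ n * y) k" by simp
  qed
  then show thesis by (rule that)
qed

lemma padic_int_p_dvd_iff:
  fixes x :: "'p::prime_card padic_int"
  shows "of_nat CARD('p) dvd x \<longleftrightarrow> Rep_padic_int x 1 = 0"
proof
  assume "of_nat CARD('p) dvd x"
  then show "Rep_padic_int x 1 = 0"
    by (auto simp: dvd_def times_padic_int.rep_eq Rep_padic_int_of_nat)
next
  assume "Rep_padic_int x 1 = 0"
  then obtain y where "x = of_nat CARD('p) ^ 1 * y" by (rule padic_int_power_dvd)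
  then show "of_nat CARD('p) dvd x" by simp
qed

text \<open>A nonzero residue modulo p makes \<open>x\<close> invertible modulo every p^n; inverses
  modulo p^n are unique, which makes the chosen ones compatible.\<close>

lemma padic_int_unit:
  fixes x :: "'p::prime_card padic_int"
  assumes "\<not> of_nat CARD('p) dvd x"
  obtains y where "x * y = 1"
proof -
  let ?p = "int CARD('p)"
  have p0: "?p > 0" by (rule card_prime_pos)
  have pr: "prime ?p" using prime_card[where 'a = 'p] by simp
  have nz: "Rep_padic_int x 1 \<noteq> 0" using assms padic_int_p_dvd_iff by auto
  have cop: "coprime (Rep_padic_int x n) (?p ^ n)" for n
  proof (cases n)
    case (Suc m)
    have "\<not> ?p dvd Rep_padic_int x (1 + m)"
      using Rep_padic_int_mod_power[of x 1 m] nz by (simp add: dvd_eq_mod_eq_0)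
    then show ?thesis
      using pr Suc by (simp add: coprime_commute prime_imp_coprime)
  qed simp
  have "\<exists>y. (Rep_padic_int x n * y) mod ?p ^ n = 1 mod ?p ^ n" for n
    using cop[of n] cong_solve_coprime_int[of "Rep_padic_int x n" "?p ^ n"] unfolding cong_def by blast
  then obtain g where g: "\<And>n. (Rep_padic_int x n * g n) mod ?p ^ n = 1 mod ?p ^ n" by metis
  have "g (Suc n) mod ?p ^ n = g n mod ?p ^ n" for n
  proof -
    have "(Rep_padic_int x (Suc n) * g (Suc n)) mod ?p ^ n = 1 mod ?p ^ n"
      using arg_cong[OF g[of "Suc n"], of "\<lambda>z. z mod ?p ^ n"] by (simp add: mod_mod_cancel)
    moreover have "Rep_padic_int x (Suc n) mod ?p ^ n = Rep_padic_int x n"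
      using Rep_padic_int_mod_power[of x n 1] by simp
    ultimately have "[Rep_padic_int x n * g (Suc n) = Rep_padic_int x n * g n] (mod ?p ^ n)"
      using g[of n] unfolding cong_def by (metis mod_mult_left_eq)
    then show ?thesis
      using cong_mult_lcancel[OF cop[of n]] unfolding cong_def by blast
  qed
  then have ok: "g n mod ?p ^ n \<in> {0..<?p ^ n} \<and> g (Suc n) mod ?p ^ Suc n mod ?p ^ n = g n mod ?p ^ n" for n
    by (rule padic_int_compat)
  define y :: "'p padic_int" where "y = Abs_padic_int (\<lambda>n. g n mod ?p ^ n)"
  have Ry: "Rep_padic_int y = (\<lambda>n. g n mod ?p ^ n)"
    unfolding y_def by (rule Abs_padic_int_inverse) (use ok in auto)
  have "x * y = 1"
    by (rule padic_int_eqI) (simp add: times_padic_int.rep_eq one_padic_int.rep_eq Ry mod_simps g)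
  then show thesis by (rule that)
qed

lemma padic_int_of_p_nonzero: "of_nat CARD('p) \<noteq> (0 :: 'p::prime_card padic_int)"
proof
  assume "of_nat CARD('p) = (0 :: 'p padic_int)"
  then have "Rep_padic_int (of_nat CARD('p) :: 'p padic_int) 2 = 0"
    by (simp add: zero_padic_int.rep_eq)
  moreover have "int CARD('p) mod int CARD('p) ^ 2 = int CARD('p)"
    using prime_card[where 'a = 'p] prime_gt_1_nat[of "CARD('p)"]
    by (simp add: power2_eq_square)
  ultimately show False
    by (simp add: Rep_padic_int_of_nat)
qed

text \<open>Induction on a level at which \<open>x\<close> is visibly nonzero: cancelling one factor
  p lowers that level by one, and at level 0 every residue vanishes.\<close>

lemma padic_int_factorization:
  fixes x :: "'p::prime_card padic_int"
  assumes "x \<noteq> 0"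
  obtains t u where "x = of_nat CARD('p) ^ t * u" "\<not> of_nat CARD('p) dvd u"
proof -
  have "\<exists>m. Rep_padic_int x m \<noteq> 0"
    using assms padic_int_eqI[of x 0] by (force simp: zero_padic_int.rep_eq)
  then obtain m where "Rep_padic_int x m \<noteq> 0" ..
  then have "\<exists>t u. x = of_nat CARD('p) ^ t * u \<and> \<not> of_nat CARD('p) dvd u"
  proof (induction m arbitrary: x)
    case 0
    then show ?case using Rep_padic_int_range[of x 0] by simp
  next
    case (Suc m)
    show ?case
    proof (cases "of_nat CARD('p) dvd x")
      case True
      then obtain y where y: "x = of_nat CARD('p) * y" by auto
      have "Rep_padic_int y m \<noteq> 0"
      proof
        assume "Rep_padic_int y m = 0"
        then obtain z where "y = of_nat CARD('p) ^ m * z" by (rule padic_int_power_dvd)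
        then have "x = of_nat (CARD('p) ^ Suc m) * z" using y by simp
        then have "Rep_padic_int x (Suc m) = 0"
          by (simp only: times_padic_int.rep_eq Rep_padic_int_of_nat) simp
        then show False using Suc.prems by simp
      qed
      from Suc.IH[OF this] obtain t u where "y = of_nat CARD('p) ^ t * u" "\<not> of_nat CARD('p) dvd u" by blast
      then show ?thesis using y by (intro exI[of _ "Suc t"] exI[of _ u]) simp
    next
      case False
      then show ?thesis by (intro exI[of _ 0] exI[of _ x]) simp
    qed
  qed
  then show thesis using that by blast
qed

text \<open>Source of all clearing of denominators: any nonzero denominator may be replaced by a
  power of p.\<close>

lemma padic_int_dvd_power_p:
  fixes x :: "'p::prime_card padic_int"
  assumes "x \<noteq> 0"
  obtains t y where "x * y = of_nat CARD('p) ^ t"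
proof -
  obtain t u where tu: "x = of_nat CARD('p) ^ t * u" "\<not> of_nat CARD('p) dvd u"
    using padic_int_factorization[OF assms] .
  obtain v where "u * v = 1" using padic_int_unit[OF tu(2)] .
  then have "x * v = of_nat CARD('p) ^ t" by (simp add: tu mult.assoc)
  then show thesis by (rule that)
qed

lemma padic_int_infinitely_divisible:
  fixes x :: "'p::prime_card padic_int"
  assumes "\<And>n. of_nat CARD('p) ^ n dvd x"
  shows "x = 0"
proof (rule padic_int_eqI)
  fix n
  obtain y where "x = of_nat (CARD('p) ^ n) * y" using assms[of n] by (auto elim: dvdE)
  then show "Rep_padic_int x n = Rep_padic_int 0 n"
    by (simp only: times_padic_int.rep_eq Rep_padic_int_of_nat zero_padic_int.rep_eq) simp
qed

text \<open>Completeness in the form used below: modulo p^n the sum is the \<open>n\<close>-th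
  partial sum, all later terms being divisible by p^n.\<close>

lemma padic_int_series:
  fixes d :: "nat \<Rightarrow> 'p::prime_card padic_int"
  obtains s where "\<And>n. of_nat CARD('p) ^ n dvd s - (\<Sum>i<n. of_nat CARD('p) ^ i * d i)"
proof -
  let ?p = "int CARD('p)"
  define S where "S n = (\<Sum>i<n. of_nat CARD('p) ^ i * d i)" for n
  define f where "f n = Rep_padic_int (S n) n" for n
  have "f (Suc n) mod ?p ^ n = f n mod ?p ^ n" for n
  proof -
    have "f (Suc n) mod ?p ^ n = Rep_padic_int (S (Suc n)) n"
      unfolding f_def using Rep_padic_int_mod_power[of "S (Suc n)" n 1] by simp
    also have "S (Suc n) = S n + of_nat (CARD('p) ^ n) * d n" by (simp add: S_def)
    also have "Rep_padic_int \<dots> n = f n"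
      by (simp only: plus_padic_int.rep_eq times_padic_int.rep_eq Rep_padic_int_of_nat f_def)
        (simp add: Rep_padic_int_mod_self)
    finally show ?thesis by (simp add: f_def Rep_padic_int_mod_self)
  qed
  then have ok: "f n mod ?p ^ n \<in> {0..<?p ^ n} \<and> f (Suc n) mod ?p ^ Suc n mod ?p ^ n = f n mod ?p ^ n" for n
    by (rule padic_int_compat)
  define s :: "'p padic_int" where "s = Abs_padic_int (\<lambda>n. f n mod ?p ^ n)"
  have Rs: "Rep_padic_int s = (\<lambda>n. f n mod ?p ^ n)"
    unfolding s_def by (rule Abs_padic_int_inverse) (use ok in auto)
  have "of_nat CARD('p) ^ n dvd s - S n" for n
  proof -
    have "Rep_padic_int (s - S n) n = 0"
      by (simp add: minus_padic_int.rep_eq Rs f_def Rep_padic_int_mod_self)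
    then show ?thesis by (metis padic_int_power_dvd dvd_triv_left)
  qed
  then show thesis using that unfolding S_def by blast
qed

lemma padic_int_residue:
  fixes x :: "'p::prime_card padic_int"
  obtains c y where "c < CARD('p)" "x = of_nat c + of_nat CARD('p) * y"
proof -
  let ?c = "nat (Rep_padic_int x 1)"
  have "Rep_padic_int (x - of_nat ?c) 1 = 0"
    using Rep_padic_int_range[of x 1]
    by (simp add: minus_padic_int.rep_eq Rep_padic_int_of_nat del: of_nat_nat)
  then obtain y where "x - of_nat ?c = of_nat CARD('p) * y"
    by (metis padic_int_p_dvd_iff dvdE)
  then have "x = of_nat ?c + of_nat CARD('p) * y" by (simp add: algebra_simps)
  moreover have "?c < CARD('p)" using Rep_padic_int_range[of x 1] by simp
  ultimately show thesis by (rule that[rotated])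
qed

section \<open>Integers in a finite extension\<close>

text \<open>One extension at a time, so that the theory applies both to F and to C.\<close>

locale padic_extension =
  fixes \<iota> :: "'p::prime_card padic \<Rightarrow> 'e::field"
  assumes finite_ext: "finite_extension \<iota>"
begin

sublocale field_hom \<iota>
  using finite_ext unfolding finite_extension_def by blast

definition zp :: "'p padic_int \<Rightarrow> 'e" where
  "zp z = \<iota> (Fract z 1)"

sublocale zp: inj_comm_ring_hom zp
proof
  fix x y :: "'p padic_int"
  show "zp (x + y) = zp x + zp y"
    unfolding zp_def by (simp flip: hom_add)
  show "zp (x * y) = zp x * zp y"
    unfolding zp_def by (simp flip: hom_mult)
  show "zp 0 = 0" "zp 1 = 1"
    unfolding zp_def by (simp_all flip: Zero_fract_def One_fract_def)
  show "x = 0" if "zp x = 0"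
    using that unfolding zp_def by (simp add: Zero_fract_def eq_fract)
qed

section \<open>Spans over the p-adic integers and the ring of integral elements\<close>

abbreviation OE where "OE \<equiv> integers \<iota>"

lemma integers_iff: "x \<in> OE \<longleftrightarrow> (\<exists>P. lead_coeff P = 1 \<and> poly (map_poly zp P) x = 0)"
  unfolding integers_def zp_def by simp

text \<open>A family instead of a set of generators, since the monomials
  \<open>x ^ i * y ^ j\<close> used for sums and products may coincide.\<close>

definition zspan :: "('j \<Rightarrow> 'e) \<Rightarrow> 'j set \<Rightarrow> 'e set" where
  "zspan b J = {\<Sum>j\<in>J. zp (c j) * b j | c. True}"

lemma zspan_base: "finite J \<Longrightarrow> j \<in> J \<Longrightarrow> b j \<in> zspan b J"
  unfolding zspan_def
  by (rule CollectI, rule exI[of _ "\<lambda>i. if i = j then 1 else 0"])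
    (simp add: if_distrib[of zp] if_distrib[of "\<lambda>x. x * _"] cong: if_cong)

lemma zspan_add: "x \<in> zspan b J \<Longrightarrow> y \<in> zspan b J \<Longrightarrow> x + y \<in> zspan b J"
  unfolding zspan_def
  by clarify (rule_tac x = "\<lambda>i. c i + ca i" in exI, simp add: hom_distribs sum.distrib algebra_simps)

lemma zspan_scale: "x \<in> zspan b J \<Longrightarrow> zp c * x \<in> zspan b J"
  unfolding zspan_def
  by clarify (rule_tac x = "\<lambda>i. c * ca i" in exI, simp add: hom_distribs sum_distrib_left algebra_simps)

lemma zspan_sum: "(\<And>i. i \<in> I \<Longrightarrow> f i \<in> zspan b J) \<Longrightarrow> (\<Sum>i\<in>I. f i) \<in> zspan b J"
proof (induction I rule: infinite_finite_induct)
  case empty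
  show ?case unfolding zspan_def by (rule CollectI, rule exI[of _ "\<lambda>_. 0"]) simp
next
  case (infinite A)
  show ?case unfolding zspan_def using infinite by (intro CollectI exI[of _ "\<lambda>_. 0"]) simp
qed (simp add: zspan_add)

lemma zspan_mult:
  assumes "\<And>j. j \<in> J \<Longrightarrow> x * b j \<in> zspan b J" "y \<in> zspan b J"
  shows "x * y \<in> zspan b J"
proof -
  obtain c where "y = (\<Sum>j\<in>J. zp (c j) * b j)" using assms(2) unfolding zspan_def by blast
  then have "x * y = (\<Sum>j\<in>J. zp (c j) * (x * b j))" by (simp add: sum_distrib_left algebra_simps)
  then show ?thesis using assms(1) by (auto intro!: zspan_sum zspan_scale)
qed

text \<open>Determinant trick: the coordinates of multiplication by \<open>x\<close> form a matrix
  over the p-adic integers with eigenvector \<open>b\<close>, so \<open>x\<close> is a root of its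
  monic characteristic polynomial.\<close>

lemma integral_if_stable_nat:
  fixes b :: "nat \<Rightarrow> 'e"
  assumes "\<And>i. i < n \<Longrightarrow> x * b i \<in> zspan b {..<n}" "i0 < n" "b i0 \<noteq> 0"
  shows "x \<in> OE"
proof -
  have "\<forall>i. \<exists>c. i < n \<longrightarrow> x * b i = (\<Sum>j<n. zp (c j) * b j)"
    using assms(1) unfolding zspan_def by blast
  then obtain A where A: "\<And>i. i < n \<Longrightarrow> x * b i = (\<Sum>j<n. zp (A i j) * b j)" by metis
  define M where "M = Matrix.mat n n (\<lambda>(i, j). A i j)"
  have M: "M \<in> carrier_mat n n" by (simp add: M_def)
  define v where "v = Matrix.vec n b"
  have zM: "map_mat zp M \<in> carrier_mat n n" using M by simp
  have "map_mat zp M *\<^sub>v v = x \<cdot>\<^sub>v v"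
    by (rule eq_vecI) (simp_all add: M_def v_def scalar_prod_def A atLeast0LessThan)
  moreover have "v \<noteq> 0\<^sub>v n" using assms(2,3) by (metis v_def index_vec index_zero_vec(1))
  ultimately have "eigenvalue (map_mat zp M) x"
    unfolding eigenvalue_def eigenvector_def using M by (intro exI[of _ v]) (auto simp: v_def)
  then have "poly (char_poly (map_mat zp M)) x = 0"
    using eigenvalue_root_char_poly[OF zM] by simp
  then have "poly (map_poly zp (char_poly M)) x = 0"
    using zp.char_poly_hom[OF M] by simp
  moreover have "lead_coeff (char_poly M) = 1"
    using degree_monic_char_poly[OF M] by simp
  ultimately show ?thesis unfolding integers_iff by blast
qed

lemma integral_if_stable:
  fixes b :: "'j \<Rightarrow> 'e"
  assumes "finite J" "\<And>i. i \<in> J \<Longrightarrow> x * b i \<in> zspan b J" "i0 \<in> J" "b i0 \<noteq> 0"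
  shows "x \<in> OE"
proof -
  obtain h where h: "bij_betw h {0..<card J} J" using ex_bij_betw_nat_finite[OF assms(1)] by blast
  have sp: "zspan b J \<subseteq> zspan (b \<circ> h) {..<card J}"
  proof
    fix y assume "y \<in> zspan b J"
    then obtain c where c: "y = (\<Sum>j\<in>J. zp (c j) * b j)" unfolding zspan_def by blast
    have "y = (\<Sum>i\<in>{0..<card J}. zp (c (h i)) * b (h i))"
      unfolding c by (rule sum.reindex_bij_betw[OF h, symmetric])
    then show "y \<in> zspan (b \<circ> h) {..<card J}"
      unfolding zspan_def by (auto simp: atLeast0LessThan intro: exI[of _ "c \<circ> h"])
  qed
  obtain i where i: "i < card J" "h i = i0"
    using h assms(3) unfolding bij_betw_def by force
  show ?thesis
  proof (rule integral_if_stable_nat[of "card J" x "b \<circ> h" i])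
    fix j assume "j < card J"
    then have "h j \<in> J" using h unfolding bij_betw_def by auto
    then show "x * (b \<circ> h) j \<in> zspan (b \<circ> h) {..<card J}" using assms(2) sp by auto
  qed (use i assms in auto)
qed

lemma zp_integral: "zp z \<in> OE"
  unfolding integers_iff by (rule exI[of _ "[:- z, 1:]"]) (simp add: hom_distribs)

lemma integers_0: "0 \<in> OE" and integers_1: "1 \<in> OE" and integers_of_nat: "of_nat n \<in> OE"
  using zp_integral[of 0] zp_integral[of 1] zp_integral[of "of_nat n"] by (simp_all add: hom_distribs)

text \<open>\<open>m > 0\<close> holds since the constant polynomial 1 has no root; it makes the
  family of powers below \<open>m\<close> nonempty.\<close>

lemma integral_power_expansion:
  assumes "x \<in> OE"
  obtains m c where "m > 0" "x ^ m = (\<Sum>i<m. zp (c i) * x ^ i)"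
proof -
  obtain P where P: "lead_coeff P = 1" "poly (map_poly zp P) x = 0"
    using assms integers_iff by blast
  let ?m = "degree P"
  have "(\<Sum>i\<le>?m. zp (poly.coeff P i) * x ^ i) = 0"
    using P(2) by (simp add: poly_altdef)
  then have "x ^ ?m + (\<Sum>i<?m. zp (poly.coeff P i) * x ^ i) = 0"
    using P(1) by (simp add: lessThan_Suc_atMost[symmetric] algebra_simps)
  then have "x ^ ?m = (\<Sum>i<?m. zp (- poly.coeff P i) * x ^ i)"
    by (simp add: hom_distribs sum_negf eq_neg_iff_add_eq_0)
  moreover have "?m > 0"
  proof (rule ccontr)
    assume "\<not> ?m > 0"
    then have "(\<Sum>i<?m. zp (- poly.coeff P i) * x ^ i) = 0" "x ^ ?m = 1" by auto
    then show False using calculation by simp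
  qed
  ultimately show thesis by (rule that[rotated])
qed

text \<open>The products \<open>x ^ i * y ^ j\<close> below the degrees of two integral equations
  form a family stable under multiplication by \<open>x\<close> and by \<open>y\<close>, hence by
  their sum and product.\<close>

lemma integers_add_mult:
  assumes "x \<in> OE" "y \<in> OE"
  shows "x + y \<in> OE" "x * y \<in> OE"
proof -
  obtain m c where m: "m > 0" "x ^ m = (\<Sum>i<m. zp (c i) * x ^ i)"
    using integral_power_expansion[OF assms(1)] .
  obtain n d where n: "n > 0" "y ^ n = (\<Sum>i<n. zp (d i) * y ^ i)"
    using integral_power_expansion[OF assms(2)] .
  define J where "J = {..<m} \<times> {..<n}"
  define b where "b = (\<lambda>(i, j). x ^ i * y ^ j)"
  have fin: "finite J" by (simp add: J_def)
  have base: "x ^ i * y ^ j \<in> zspan b J" if "i < m" "j < n" for i j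
    using zspan_base[OF fin, of "(i, j)" b] that by (simp add: J_def b_def)
  have X: "x * b k \<in> zspan b J" if k: "k \<in> J" for k
  proof -
    obtain i j where ij: "k = (i, j)" "i < m" "j < n" using k by (auto simp: J_def)
    show ?thesis
    proof (cases "Suc i < m")
      case True
      then show ?thesis using base[of "Suc i" j] ij by (simp add: b_def algebra_simps)
    next
      case False
      then have "Suc i = m" using ij by simp
      then have "x * b k = x ^ m * y ^ j" unfolding ij b_def by (auto simp: algebra_simps)
      also have "\<dots> = (\<Sum>i<m. zp (c i) * (x ^ i * y ^ j))"
        unfolding m(2) by (simp add: sum_distrib_right mult.assoc)
      also have "\<dots> \<in> zspan b J" using ij base by (auto intro!: zspan_sum zspan_scale)
      finally show ?thesis .
    qed
  qed
  have Y: "y * b k \<in> zspan b J" if k: "k \<in> J" for k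
  proof -
    obtain i j where ij: "k = (i, j)" "i < m" "j < n" using k by (auto simp: J_def)
    show ?thesis
    proof (cases "Suc j < n")
      case True
      then show ?thesis using base[of i "Suc j"] ij by (simp add: b_def algebra_simps)
    next
      case False
      then have "Suc j = n" using ij by simp
      then have "y * b k = x ^ i * y ^ n" unfolding ij b_def by (auto simp: algebra_simps)
      also have "\<dots> = (\<Sum>j<n. zp (d j) * (x ^ i * y ^ j))"
        unfolding n(2) by (simp add: sum_distrib_left mult.left_commute)
      also have "\<dots> \<in> zspan b J" using ij base by (auto intro!: zspan_sum zspan_scale)
      finally show ?thesis .
    qed
  qed
  have 0: "(0, 0) \<in> J" "b (0, 0) \<noteq> 0" using m(1) n(1) by (auto simp: J_def b_def)
  show "x + y \<in> OE"
    by (rule integral_if_stable[where b = b, OF fin _ 0]) (simp add: distrib_right X Y zspan_add)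
  show "x * y \<in> OE"
    by (rule integral_if_stable[where b = b, OF fin _ 0]) (simp add: mult.assoc zspan_mult[OF X Y])
qed

lemma integers_uminus: "x \<in> OE \<Longrightarrow> - x \<in> OE"
  using integers_add_mult(2)[OF zp_integral[of "-1"], of x] by (simp add: hom_distribs)

lemma integers_diff: "x \<in> OE \<Longrightarrow> y \<in> OE \<Longrightarrow> x - y \<in> OE"
  using integers_add_mult(1)[of x "- y"] integers_uminus by simp

lemma integers_power: "x \<in> OE \<Longrightarrow> x ^ n \<in> OE"
  by (induction n) (auto simp: integers_1 integers_add_mult)

lemma integers_sum: "(\<And>i. i \<in> I \<Longrightarrow> f i \<in> OE) \<Longrightarrow> sum f I \<in> OE"
  by (induction I rule: infinite_finite_induct) (auto simp: integers_0 integers_add_mult)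

lemma integers_prod: "(\<And>i. i \<in> I \<Longrightarrow> f i \<in> OE) \<Longrightarrow> prod f I \<in> OE"
  by (induction I rule: infinite_finite_induct) (auto simp: integers_1 integers_add_mult)

lemmas integers_closed =
  integers_0 integers_1 integers_of_nat integers_add_mult integers_uminus integers_diff
  integers_power integers_sum integers_prod

end

no_notation vec_index (infixl \<open>$\<close> 100)
no_notation index_mat (infixl \<open>$$\<close> 100)
hide_const (open) Matrix.mat Matrix.vec Matrix.row Matrix.col Determinant.det Matrix.zero_vec Matrix.diag_mat
hide_type (open) Matrix.mat Matrix.vec

section \<open>Denominators, divisibility, finite generation and completeness\<close>

context padic_extension
begin

definition pe :: 'e where "pe = zp (of_nat CARD('p))"

lemma of_nat_card [simp]: "of_nat CARD('p) = pe"
  by (simp add: pe_def hom_distribs)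

lemma zp_p: "zp (of_nat CARD('p)) = pe"
  by (simp add: hom_distribs)

lemma p_nonzero: "pe \<noteq> 0"
  using padic_int_of_p_nonzero[where 'p = 'p] zp.hom_0_iff[of "of_nat CARD('p)"] by (simp add: zp_p)

text \<open>Multiplying an integral equation of degree m for the inverse by p^m exhibits 1 as a
  multiple of p in the p-adic integers.\<close>

lemma inverse_p_not_integral: "inverse pe \<notin> OE"
proof
  assume "inverse pe \<in> OE"
  then obtain m c where m: "m > 0" "inverse pe ^ m = (\<Sum>i<m. zp (c i) * inverse pe ^ i)"
    by (rule integral_power_expansion)
  have "1 = pe ^ m * inverse pe ^ m" using p_nonzero by (simp flip: power_mult_distrib)
  also have "\<dots> = (\<Sum>i<m. zp (c i) * (pe ^ m * inverse pe ^ i))"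
    unfolding m(2) by (simp add: sum_distrib_left mult.left_commute)
  also have "\<dots> = (\<Sum>i<m. zp (c i * of_nat CARD('p) ^ (m - i)))"
  proof (rule sum.cong)
    fix i assume "i \<in> {..<m}"
    then have "pe ^ m = pe ^ (m - i) * pe ^ i" by (simp flip: power_add)
    then have "pe ^ m * inverse pe ^ i = pe ^ (m - i)"
      using p_nonzero by (simp add: mult.assoc flip: power_mult_distrib)
    then show "zp (c i) * (pe ^ m * inverse pe ^ i) = zp (c i * of_nat CARD('p) ^ (m - i))"
      by (simp add: hom_distribs)
  qed simp
  also have "\<dots> = zp (\<Sum>i<m. c i * of_nat CARD('p) ^ (m - i))" by (simp add: hom_distribs)
  finally have "zp 1 = zp (\<Sum>i<m. c i * of_nat CARD('p) ^ (m - i))" by simp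
  then have "(1 :: 'p padic_int) = (\<Sum>i<m. c i * of_nat CARD('p) ^ (m - i))"
    using zp.injectivity by blast
  moreover have "of_nat CARD('p) dvd (\<Sum>i<m. c i * of_nat CARD('p) ^ (m - i))"
    by (rule dvd_sum) (auto intro!: dvd_mult dvd_power)
  ultimately have "of_nat CARD('p) dvd (1 :: 'p padic_int)" by simp
  then have "Rep_padic_int (1 :: 'p padic_int) 1 = 0" by (simp add: padic_int_p_dvd_iff)
  then show False
    using prime_card[where 'a = 'p] prime_gt_1_nat[of "CARD('p)"] by (simp add: one_padic_int.rep_eq)
qed

lemma padic_denominator: "\<exists>t z. pe ^ t * \<iota> c = zp z"
proof (cases c)
  case (Fract a b)
  obtain t y where y: "b * y = of_nat CARD('p) ^ t" using padic_int_dvd_power_p[OF Fract(2)] .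
  have "\<iota> c * zp b = zp a"
    unfolding Fract zp_def using Fract(2) by (simp flip: hom_mult add: eq_fract)
  then have "pe ^ t * \<iota> c = zp (a * y)"
    using arg_cong[OF y, of zp] by (simp add: hom_distribs zp_p) (metis mult.assoc mult.commute)
  then show ?thesis by blast
qed

lemma padic_common_denominator:
  assumes "finite A"
  shows "\<exists>t. \<forall>c\<in>A. \<exists>z. pe ^ t * \<iota> c = zp z"
  using assms
proof induction
  case (insert c A)
  then obtain t where t: "\<forall>c\<in>A. \<exists>z. pe ^ t * \<iota> c = zp z" by blast
  obtain s w where s: "pe ^ s * \<iota> c = zp w" using padic_denominator by blast
  have "\<exists>z. pe ^ (s + t) * \<iota> d = zp z" if d: "d \<in> insert c A" for d
  proof (cases "d = c")
    case True
    have "pe ^ (s + t) * \<iota> d = zp (of_nat CARD('p) ^ t * w)"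
      unfolding True by (simp add: hom_distribs zp_p power_add mult.assoc mult.left_commute flip: s)
    then show ?thesis by blast
  next
    case False
    then obtain z where z: "pe ^ t * \<iota> d = zp z" using t d by blast
    have "pe ^ (s + t) * \<iota> d = zp (of_nat CARD('p) ^ s * z)"
      by (simp add: hom_distribs zp_p power_add mult.assoc flip: z)
    then show ?thesis by blast
  qed
  then show ?case by blast
qed simp

sublocale vs: vector_space "\<lambda>c x. \<iota> c * x"
  by unfold_locales (simp_all add: hom_distribs algebra_simps)

lemma finite_spanning_set: "\<exists>B. finite B \<and> vs.span B = UNIV"
  using finite_ext unfolding finite_extension_def by blast

text \<open>Multiplication by \<open>x\<close> has p-adic coordinates on a finite spanning set; a
  common denominator p^t makes them integral, and the stability criterion applies to p^t times
  \<open>x\<close>.\<close>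

lemma integral_multiple: "\<exists>t. pe ^ t * x \<in> OE"
proof -
  obtain B where B: "finite B" "vs.span B = UNIV" using finite_spanning_set by blast
  have "\<forall>b. \<exists>u. x * b = (\<Sum>v\<in>B. \<iota> (u v) * v)"
  proof
    fix b
    have "x * b \<in> range (\<lambda>u. \<Sum>v\<in>B. \<iota> (u v) * v)"
      using B(2) unfolding vs.span_finite[OF B(1)] by simp
    then show "\<exists>u. x * b = (\<Sum>v\<in>B. \<iota> (u v) * v)" by (rule imageE) blast
  qed
  then obtain u where u: "\<And>b. x * b = (\<Sum>v\<in>B. \<iota> (u b v) * v)" by metis
  obtain t where t: "\<forall>c\<in>(\<lambda>(b, v). u b v) ` (B \<times> B). \<exists>z. pe ^ t * \<iota> c = zp z"
    using padic_common_denominator[of "(\<lambda>(b, v). u b v) ` (B \<times> B)"] B(1) by blast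
  have "\<forall>b v. \<exists>z. b \<in> B \<and> v \<in> B \<longrightarrow> pe ^ t * \<iota> (u b v) = zp z"
    using t by auto
  then obtain z where z: "\<And>b v. b \<in> B \<Longrightarrow> v \<in> B \<Longrightarrow> pe ^ t * \<iota> (u b v) = zp (z b v)" by metis
  \<comment> \<open>The criterion asks for a nonzero generator; a spanning set inside {0} would not
    reach 1.\<close>
  have "\<exists>b\<in>B. b \<noteq> 0"
  proof (rule ccontr)
    assume "\<not> ?thesis"
    then have "B \<subseteq> {0}" by blast
    then have "vs.span B \<subseteq> {0}" by (rule vs.span_minimal) (rule vs.subspace_single_0)
    then have "(1::'e) \<in> {0}" using B(2) by (simp only: subset_iff UNIV_I simp_thms)
    then show False by simp
  qed
  then obtain b0 where b0: "b0 \<in> B" "b0 \<noteq> 0" by blast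
  have "pe ^ t * x \<in> OE"
  proof (rule integral_if_stable[where b = id and J = B and ?i0.0 = b0])
    fix b assume b: "b \<in> B"
    have "pe ^ t * x * b = (\<Sum>v\<in>B. (pe ^ t * \<iota> (u b v)) * v)"
      by (simp add: u mult.assoc sum_distrib_left)
    also have "\<dots> = (\<Sum>v\<in>B. zp (z b v) * id v)" using z b by (intro sum.cong) auto
    finally show "pe ^ t * x * id b \<in> zspan id B" unfolding zspan_def by auto
  qed (use B b0 in auto)
  then show ?thesis by blast
qed

text \<open>Divisibility relative to the integers, as ordinary divisibility is trivial in a field.
  For nonintegral \<open>a\<close> it is membership in a fractional ideal.\<close>

definition odvd :: "'e \<Rightarrow> 'e \<Rightarrow> bool" where
  "odvd a y \<longleftrightarrow> (\<exists>z\<in>OE. y = a * z)"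

lemma odvd_0: "odvd a 0"
  unfolding odvd_def using integers_0 by force

lemma odvd_refl: "odvd a a"
  unfolding odvd_def using integers_1 by force

lemma odvd_add: "odvd a x \<Longrightarrow> odvd a y \<Longrightarrow> odvd a (x + y)"
  unfolding odvd_def by (metis integers_add_mult(1) distrib_left)

lemma odvd_uminus: "odvd a x \<Longrightarrow> odvd a (- x)"
  unfolding odvd_def by (metis integers_uminus mult_minus_right)

lemma odvd_diff: "odvd a x \<Longrightarrow> odvd a y \<Longrightarrow> odvd a (x - y)"
  using odvd_add[of a x "- y"] odvd_uminus by simp

lemma odvd_mult: "odvd a x \<Longrightarrow> y \<in> OE \<Longrightarrow> odvd a (x * y)"
  unfolding odvd_def by (metis integers_add_mult(2) mult.assoc)

lemma odvd_mult2: "odvd a x \<Longrightarrow> y \<in> OE \<Longrightarrow> odvd a (y * x)"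
  using odvd_mult by (simp add: mult.commute)

lemma odvd_mult_mono: "odvd a x \<Longrightarrow> odvd b y \<Longrightarrow> odvd (a * b) (x * y)"
  unfolding odvd_def by (metis integers_add_mult(2) mult.assoc mult.left_commute)

lemma odvd_power: "odvd a x \<Longrightarrow> odvd (a ^ n) (x ^ n)"
proof (induction n)
  case 0
  show ?case by (simp add: odvd_refl)
next
  case (Suc n)
  then show ?case by (simp add: odvd_mult_mono)
qed

lemma odvd_sum: "(\<And>i. i \<in> I \<Longrightarrow> odvd a (f i)) \<Longrightarrow> odvd a (sum f I)"
  by (induction I rule: infinite_finite_induct) (auto simp: odvd_0 odvd_add)

lemma odvd_trans: "odvd a b \<Longrightarrow> odvd b c \<Longrightarrow> odvd a c"
  unfolding odvd_def by (metis integers_add_mult(2) mult.assoc)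

lemma odvd_power_le: "a \<in> OE \<Longrightarrow> m \<le> n \<Longrightarrow> odvd (a ^ m) (a ^ n)"
  unfolding odvd_def by (rule bexI[of _ "a ^ (n - m)"]) (auto simp: integers_power simp flip: power_add)

lemma odvd_integral: "odvd a x \<Longrightarrow> a \<in> OE \<Longrightarrow> x \<in> OE"
  unfolding odvd_def using integers_add_mult(2) by blast

lemma odvd_self_mult: "y \<in> OE \<Longrightarrow> odvd a (a * y)"
  unfolding odvd_def by blast

text \<open>If \<open>x\<close> were nonzero, some p^t would clear the denominator of its inverse,
  and divisibility of \<open>x\<close> by p^(t+1) would make the inverse of p integral.\<close>

lemma infinitely_p_divisible:
  assumes "\<And>n. odvd (pe ^ n) x"
  shows "x = 0"
proof (rule ccontr)
  assume x: "x \<noteq> 0"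
  obtain t where t: "pe ^ t * inverse x \<in> OE" using integral_multiple by blast
  obtain z where z: "z \<in> OE" "x = pe ^ Suc t * z" using assms[of "Suc t"] unfolding odvd_def by blast
  then have "inverse pe = (pe ^ t * inverse x) * z"
    using x p_nonzero by (auto simp: field_simps)
  then show False using inverse_p_not_integral t z integers_add_mult(2) by metis
qed

text \<open>Descent: independence modulo p allows a relation over the p-adic integers to be divided
  by p. The quotient is again a relation, so every coefficient is infinitely divisible.\<close>

lemma integral_eq_0_if_p_divisible_sum:
  assumes ind: "\<forall>c. odvd pe (\<Sum>x\<in>X. zp (c x) * x) \<longrightarrow> (\<forall>x\<in>X. of_nat CARD('p) dvd c x)"
    and sum0: "(\<Sum>x\<in>X. zp (z x) * x) = 0"
    and x: "x \<in> X"
  shows "z x = 0"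
proof (rule padic_int_infinitely_divisible)
  fix n
  show "of_nat CARD('p) ^ n dvd z x"
    using sum0
  proof (induction n arbitrary: z)
    case (Suc n)
    have "\<forall>x\<in>X. of_nat CARD('p) dvd z x"
      using ind Suc.prems odvd_0 by metis
    then obtain w where w: "\<And>x. x \<in> X \<Longrightarrow> z x = of_nat CARD('p) * w x" unfolding dvd_def by metis
    have "pe * (\<Sum>x\<in>X. zp (w x) * x) = (\<Sum>x\<in>X. zp (z x) * x)"
      by (simp add: sum_distrib_left w hom_distribs mult.assoc)
    then have "(\<Sum>x\<in>X. zp (w x) * x) = 0" using Suc.prems p_nonzero by simp
    then have "of_nat CARD('p) ^ n dvd w x" by (rule Suc.IH)
    then show ?case using w[OF x] by (simp add: mult_dvd_mono)
  qed simp
qed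

lemma independent_mod_p:
  assumes "finite X" and ind: "\<forall>c. odvd pe (\<Sum>x\<in>X. zp (c x) * x) \<longrightarrow> (\<forall>x\<in>X. of_nat CARD('p) dvd c x)"
  shows "vs.independent X"
proof (rule vs.independent_if_scalars_zero[OF assms(1)])
  fix u x assume s: "(\<Sum>x\<in>X. \<iota> (u x) * x) = 0" and x: "x \<in> X"
  obtain t where "\<forall>c\<in>u ` X. \<exists>z. pe ^ t * \<iota> c = zp z"
    using padic_common_denominator[of "u ` X"] assms(1) by blast
  then have "\<forall>x\<in>X. \<exists>z. pe ^ t * \<iota> (u x) = zp z" by blast
  then obtain z where z: "\<And>x. x \<in> X \<Longrightarrow> pe ^ t * \<iota> (u x) = zp (z x)" by metis
  have "(\<Sum>x\<in>X. zp (z x) * x) = pe ^ t * (\<Sum>x\<in>X. \<iota> (u x) * x)"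
    by (simp add: sum_distrib_left mult.assoc[symmetric] z)
  then have "z x = 0" using integral_eq_0_if_p_divisible_sum[OF ind _ x] s by simp
  then have "pe ^ t * \<iota> (u x) = 0" using z[OF x] by simp
  then show "u x = 0" using p_nonzero by simp
qed

text \<open>A maximal family of integers that is linearly independent modulo \<open>p\<close> generates the
  integers modulo \<open>p\<close>; it is finite because it is linearly independent over the \<open>p\<close>-adic numbers.\<close>

lemma generators_mod_p:
  "\<exists>X. finite X \<and> X \<subseteq> OE \<and> (\<forall>y\<in>OE. \<exists>c. odvd pe (y - (\<Sum>x\<in>X. zp (c x) * x)))"
proof -
  define P where "P X \<longleftrightarrow> finite X \<and> X \<subseteq> OE \<and>
    (\<forall>c. odvd pe (\<Sum>x\<in>X. zp (c x) * x) \<longrightarrow> (\<forall>x\<in>X. of_nat CARD('p) dvd c x))" for X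
  obtain B where B: "finite B" "vs.span B = UNIV" using finite_spanning_set by blast
  have bound: "card X < Suc (card B)" if "P X" for X
    using vs.independent_span_bound[OF B(1), of X] independent_mod_p[of X] that B(2)
    unfolding P_def by auto
  have "P {}" unfolding P_def by simp
  then obtain X where X: "P X" and max: "\<And>Y. P Y \<Longrightarrow> card Y \<le> card X"
    using ex_has_greatest_nat[of P "{}" card "Suc (card B)"] bound by (metis less_imp_le)
  have fin: "finite X" "X \<subseteq> OE" using X P_def by auto
  have "\<exists>c. odvd pe (y - (\<Sum>x\<in>X. zp (c x) * x))" if y: "y \<in> OE" for y
  proof (cases "y \<in> X")
    case True
    have "y - (\<Sum>x\<in>X. zp (if x = y then 1 else 0) * x) = 0"
      using True fin by (simp add: if_distrib[of zp] if_distrib[of "\<lambda>x. x * _"] cong: if_cong)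
    then show ?thesis using odvd_0 by (intro exI[of _ "\<lambda>x. if x = y then 1 else 0"]) simp
  next
    case False
    then have "\<not> P (insert y X)" using max[of "insert y X"] fin by auto
    then obtain c where c: "odvd pe (\<Sum>x\<in>insert y X. zp (c x) * x)"
      and nd: "\<not> (\<forall>x\<in>insert y X. of_nat CARD('p) dvd c x)"
      unfolding P_def using y fin by auto
    have c': "odvd pe (zp (c y) * y + (\<Sum>x\<in>X. zp (c x) * x))" using c False fin by simp
    \<comment> \<open>Otherwise the term of \<open>y\<close> could be dropped, and independence of
      \<open>X\<close> modulo p would make the remaining coefficients divisible as well, against
      \<open>nd\<close>.\<close>
    have "\<not> of_nat CARD('p) dvd c y"
    proof
      assume d: "of_nat CARD('p) dvd c y"
      then have "odvd pe (zp (c y) * y)"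
        using y zp_integral integers_add_mult(2)
        by (auto simp: odvd_def hom_distribs mult.assoc elim!: dvdE)
      then have "odvd pe (\<Sum>x\<in>X. zp (c x) * x)"
        using odvd_diff[OF c'] by fastforce
      then show False using X d nd unfolding P_def by auto
    qed
    then obtain v where v: "c y * v = 1" using padic_int_unit by blast
    have "zp v * (zp (c y) * y + (\<Sum>x\<in>X. zp (c x) * x)) = y - (\<Sum>x\<in>X. zp (- v * c x) * x)"
    proof -
      have "zp v * zp (c y) = 1" using arg_cong[OF v, of zp] by (simp add: hom_distribs mult.commute)
      then show ?thesis
        by (simp add: hom_distribs distrib_left sum_negf sum_distrib_left mult.assoc[symmetric])
    qed
    then show ?thesis using odvd_mult2[OF c' zp_integral[of v]] by (intro exI[of _ "\<lambda>x. - v * c x"]) simp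
  qed
  then show ?thesis using fin by blast
qed

lemma odvd_pe_power_zp: "of_nat CARD('p) ^ n dvd z \<Longrightarrow> x \<in> OE \<Longrightarrow> odvd (pe ^ n) (zp z * x)"
  by (elim dvdE)
    (simp add: hom_distribs mult.assoc odvd_self_mult integers_add_mult zp_integral)

text \<open>Nakayama's lemma made explicit: expand \<open>y\<close> modulo p, expand the remainder,
  and so on. The coefficients of each generator form a convergent p-adic series, and the resulting
  combination agrees with \<open>y\<close> modulo every p^n.\<close>

lemma finitely_generated:
  "\<exists>X. finite X \<and> X \<subseteq> OE \<and> (\<forall>y\<in>OE. \<exists>c. y = (\<Sum>x\<in>X. zp (c x) * x))"
proof -
  obtain X where X: "finite X" "X \<subseteq> OE"
    and gen: "\<forall>y\<in>OE. \<exists>c. odvd pe (y - (\<Sum>x\<in>X. zp (c x) * x))" using generators_mod_p by blast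
  have "\<forall>y. \<exists>c r. y \<in> OE \<longrightarrow> r \<in> OE \<and> y = (\<Sum>x\<in>X. zp (c x) * x) + pe * r"
  proof (rule allI)
    fix y
    show "\<exists>c r. y \<in> OE \<longrightarrow> r \<in> OE \<and> y = (\<Sum>x\<in>X. zp (c x) * x) + pe * r"
    proof (cases "y \<in> OE")
      case True
      then obtain c where "odvd pe (y - (\<Sum>x\<in>X. zp (c x) * x))" using gen by auto
      then obtain r where "r \<in> OE" "y - (\<Sum>x\<in>X. zp (c x) * x) = pe * r" unfolding odvd_def by auto
      then show ?thesis by (intro exI[of _ c] exI[of _ r]) (simp add: diff_eq_eq add.commute)
    qed simp
  qed
  then obtain C R where CR: "\<And>y. y \<in> OE \<Longrightarrow> R y \<in> OE \<and> y = (\<Sum>x\<in>X. zp (C y x) * x) + pe * R y" by metis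
  have "\<exists>c. y = (\<Sum>x\<in>X. zp (c x) * x)" if y: "y \<in> OE" for y
  proof -
    define Y where "Y n = (R ^^ n) y" for n
    have YO: "Y n \<in> OE" for n by (induction n) (auto simp: Y_def y CR)
    define d where "d x i = C (Y i) x" for x i
    have step: "Y n = (\<Sum>x\<in>X. zp (d x n) * x) + pe * Y (Suc n)" for n
      using CR[OF YO[of n]] by (simp add: Y_def d_def)
    have ex: "y = (\<Sum>x\<in>X. zp (\<Sum>i<n. of_nat CARD('p) ^ i * d x i) * x) + pe ^ n * Y n" for n
    proof (induction n)
      case (Suc n)
      have "pe ^ n * Y n = (\<Sum>x\<in>X. zp (of_nat CARD('p) ^ n * d x n) * x) + pe ^ Suc n * Y (Suc n)"
        unfolding step[of n] by (simp add: distrib_left sum_distrib_left hom_distribs mult.assoc mult.left_commute)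
      then show ?case using Suc by (simp add: hom_distribs distrib_right sum.distrib)
    qed (simp add: Y_def)
    have "\<forall>x. \<exists>s. \<forall>n. of_nat CARD('p) ^ n dvd s - (\<Sum>i<n. of_nat CARD('p) ^ i * d x i)"
      using padic_int_series by metis
    then obtain s where s: "\<And>x n. of_nat CARD('p) ^ n dvd s x - (\<Sum>i<n. of_nat CARD('p) ^ i * d x i)"
      by metis
    have "odvd (pe ^ n) (y - (\<Sum>x\<in>X. zp (s x) * x))" for n
    proof -
      have "y - (\<Sum>x\<in>X. zp (s x) * x)
        = pe ^ n * Y n - (\<Sum>x\<in>X. zp (s x - (\<Sum>i<n. of_nat CARD('p) ^ i * d x i)) * x)"
        by (subst ex[of n]) (simp add: zp.hom_minus left_diff_distrib sum_subtractf)
      then show ?thesis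
        using odvd_pe_power_zp[OF s] X YO[of n]
        by (auto intro!: odvd_diff odvd_sum odvd_self_mult)
    qed
    then have "y - (\<Sum>x\<in>X. zp (s x) * x) = 0" by (rule infinitely_p_divisible)
    then show ?thesis by auto
  qed
  then show ?thesis using X by blast
qed

text \<open>Differences of consecutive terms are expanded in finitely many generators, so
  convergence reduces to one p-adic series for each generator.\<close>

lemma complete:
  assumes "y 0 \<in> OE" "\<And>n. odvd (pe ^ n) (y (Suc n) - y n)"
  shows "\<exists>l\<in>OE. \<forall>n. odvd (pe ^ n) (l - y n)"
proof -
  obtain X where X: "finite X" "X \<subseteq> OE" and gen: "\<forall>y\<in>OE. \<exists>c. y = (\<Sum>x\<in>X. zp (c x) * x)"
    using finitely_generated by blast
  have "\<forall>n. \<exists>d. y (Suc n) - y n = pe ^ n * (\<Sum>x\<in>X. zp (d x) * x)"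
  proof
    fix n
    obtain z where z: "z \<in> OE" "y (Suc n) - y n = pe ^ n * z" using assms(2)[of n] unfolding odvd_def by auto
    obtain d where "z = (\<Sum>x\<in>X. zp (d x) * x)" using bspec[OF gen z(1)] by auto
    then show "\<exists>d. y (Suc n) - y n = pe ^ n * (\<Sum>x\<in>X. zp (d x) * x)" using z by auto
  qed
  then obtain d where d: "\<And>n. y (Suc n) - y n = pe ^ n * (\<Sum>x\<in>X. zp (d n x) * x)" by metis
  have ex: "y n = y 0 + (\<Sum>x\<in>X. zp (\<Sum>i<n. of_nat CARD('p) ^ i * d i x) * x)" for n
  proof (induction n)
    case (Suc n)
    have "y (Suc n) = y n + (\<Sum>x\<in>X. zp (of_nat CARD('p) ^ n * d n x) * x)"
      using d[of n] by (simp add: hom_distribs sum_distrib_left mult.assoc algebra_simps)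
    then show ?case by (subst (asm) Suc) (simp add: hom_distribs distrib_right sum.distrib)
  qed simp
  have "\<forall>x. \<exists>s. \<forall>n. of_nat CARD('p) ^ n dvd s - (\<Sum>i<n. of_nat CARD('p) ^ i * d i x)"
    using padic_int_series by metis
  then obtain s where s: "\<And>x n. of_nat CARD('p) ^ n dvd s x - (\<Sum>i<n. of_nat CARD('p) ^ i * d i x)"
    by metis
  define l where "l = y 0 + (\<Sum>x\<in>X. zp (s x) * x)"
  have "odvd (pe ^ n) (l - y n)" for n
  proof -
    have "l - y n = (\<Sum>x\<in>X. zp (s x - (\<Sum>i<n. of_nat CARD('p) ^ i * d i x)) * x)"
      unfolding l_def by (subst ex[of n]) (simp add: zp.hom_minus left_diff_distrib sum_subtractf)
    then show ?thesis using odvd_pe_power_zp[OF s] X by (auto intro!: odvd_sum)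
  qed
  moreover have "l \<in> OE"
    unfolding l_def using X assms(1) zp_integral by (auto intro!: integers_closed)
  ultimately show ?thesis by blast
qed

text \<open>The coefficients with respect to finitely many generators can be reduced to numbers
  below p.\<close>

lemma finite_residues_mod_p:
  "\<exists>D. finite D \<and> D \<subseteq> OE \<and> (\<forall>y\<in>OE. \<exists>d\<in>D. odvd pe (y - d))"
proof -
  obtain X where X: "finite X" "X \<subseteq> OE" and gen: "\<forall>y\<in>OE. \<exists>c. y = (\<Sum>x\<in>X. zp (c x) * x)"
    using finitely_generated by blast
  define D where "D = (\<lambda>c. \<Sum>x\<in>X. of_nat (c x) * x) ` PiE X (\<lambda>_. {..<CARD('p)})"
  have "finite D" unfolding D_def using X by (auto intro!: finite_imageI finite_PiE)
  moreover have "D \<subseteq> OE" unfolding D_def using X by (auto intro!: integers_closed)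
  moreover have "\<exists>d\<in>D. odvd pe (y - d)" if y: "y \<in> OE" for y
  proof -
    obtain c where c: "y = (\<Sum>x\<in>X. zp (c x) * x)" using bspec[OF gen y] by auto
    have "\<exists>m r. m < CARD('p) \<and> c x = of_nat m + of_nat CARD('p) * r" for x
      using padic_int_residue[of "c x"] by blast
    then obtain m r where m: "\<And>x. m x < CARD('p)" "\<And>x. c x = of_nat (m x) + of_nat CARD('p) * r x" by metis
    have eq: "y - (\<Sum>x\<in>X. of_nat (m x) * x) = (\<Sum>x\<in>X. zp (of_nat CARD('p) * r x) * x)"
      by (simp add: c m(2) hom_distribs distrib_right sum.distrib)
    have "odvd (pe ^ 1) (\<Sum>x\<in>X. zp (of_nat CARD('p) * r x) * x)"
      using X(2) by (intro odvd_sum odvd_pe_power_zp) auto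
    then have d: "odvd pe (y - (\<Sum>x\<in>X. of_nat (m x) * x))"
      unfolding eq by simp
    have "(\<Sum>x\<in>X. of_nat (m x) * x) = (\<Sum>x\<in>X. of_nat (restrict m X x) * x)"
      by (intro sum.cong) auto
    moreover have "restrict m X \<in> PiE X (\<lambda>_. {..<CARD('p)})" using m(1) by auto
    ultimately have "(\<Sum>x\<in>X. of_nat (m x) * x) \<in> D" unfolding D_def by (rule image_eqI)
    with d show ?thesis ..
  qed
  ultimately show ?thesis by blast
qed

end

section \<open>Uniformizers and Teichmueller representatives\<close>

context gl2_setup
begin

sublocale F: padic_extension \<iota>F
  by unfold_locales (rule finite_F)

sublocale C: padic_extension \<iota>C
  by unfold_locales (rule finite_C)

section \<open>Units, factorization and the valuation of F\<close>

abbreviation "UF \<equiv> integer_units \<iota>F"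

lemma unit_iff: "x \<in> UF \<longleftrightarrow> x \<noteq> 0 \<and> x \<in> OF \<and> inverse x \<in> OF"
  unfolding integer_units_def by (auto intro!: bexI[of _ "inverse x"] simp: inverse_unique)

lemma nonunit_iff: "F.odvd \<pi> x \<longleftrightarrow> x \<in> OF \<and> x \<notin> UF"
  using uniformizer unfolding uniformizer_def F.odvd_def by blast

lemma pi_integral: "\<pi> \<in> OF"
  using nonunit_iff F.odvd_refl by blast

lemma p_nonunit: "F.odvd \<pi> F.pe"
  using F.inverse_p_not_integral unfolding nonunit_iff unit_iff
  by (metis F.of_nat_card F.integers_of_nat)

lemma pi_nonzero: "\<pi> \<noteq> 0"
  using p_nonunit F.p_nonzero unfolding F.odvd_def by auto

lemma unit_1: "1 \<in> UF"
  unfolding unit_iff by (simp add: F.integers_1)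

lemma not_pi_dvd_1: "\<not> F.odvd \<pi> 1"
  using unit_1 nonunit_iff by blast

lemma unit_mult: "x \<in> UF \<Longrightarrow> y \<in> UF \<Longrightarrow> x * y \<in> UF"
  unfolding unit_iff by (simp add: F.integers_add_mult)

lemma unit_inverse: "x \<in> UF \<Longrightarrow> inverse x \<in> UF"
  unfolding unit_iff by simp

lemma unit_uminus: "x \<in> UF \<Longrightarrow> - x \<in> UF"
  unfolding unit_iff by (simp add: F.integers_uminus)

lemma unit_prod: "(\<And>i. i \<in> A \<Longrightarrow> f i \<in> UF) \<Longrightarrow> prod f A \<in> UF"
  by (induction A rule: infinite_finite_induct) (simp_all add: unit_1 unit_mult)

text \<open>Two powers of \<open>\<pi>\<close> agree modulo \<open>p\<close> by the pigeonhole principle, and \<open>1 - \<pi> ^ m\<close> is a unit.\<close>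

lemma pi_power_p: "\<exists>e. F.odvd F.pe (\<pi> ^ e)"
proof -
  obtain D where D: "finite D" "D \<subseteq> OF" "\<forall>y\<in>OF. \<exists>d\<in>D. F.odvd F.pe (y - d)"
    using F.finite_residues_mod_p by blast
  have "\<forall>i. \<exists>d. d \<in> D \<and> F.odvd F.pe (\<pi> ^ i - d)"
    using D(3) F.integers_power[OF pi_integral] by blast
  then obtain d where d: "\<And>i. d i \<in> D" "\<And>i. F.odvd F.pe (\<pi> ^ i - d i)" by metis
  have "\<not> inj d"
  proof
    assume "inj d"
    then have "infinite (range d)" by (rule range_inj_infinite)
    moreover have "range d \<subseteq> D" using d(1) by blast
    ultimately show False using D(1) finite_subset by blast
  qed
  then obtain i j where ij: "i < j" "d i = d j"
    unfolding inj_def by (metis linorder_neqE_nat)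
  have "F.odvd F.pe ((\<pi> ^ i - d i) - (\<pi> ^ j - d j))" using d(2) F.odvd_diff by blast
  then have 1: "F.odvd F.pe (\<pi> ^ i - \<pi> ^ j)" using ij by simp
  define m where "m = j - i"
  have m: "m > 0" "\<pi> ^ j = \<pi> ^ i * \<pi> ^ m" using ij by (auto simp: m_def simp flip: power_add)
  define u where "u = 1 - \<pi> ^ m"
  have uO: "u \<in> OF" unfolding u_def by (intro F.integers_closed pi_integral)
  have "\<not> F.odvd \<pi> u"
  proof
    assume "F.odvd \<pi> u"
    moreover have "F.odvd \<pi> (\<pi> ^ m)"
      using F.odvd_power_le[OF pi_integral, of 1 m] m by simp
    ultimately have "F.odvd \<pi> (u + \<pi> ^ m)" by (rule F.odvd_add)
    then show False using not_pi_dvd_1 by (simp add: u_def)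
  qed
  then have u: "u \<in> UF" using uO nonunit_iff by blast
  have "F.odvd F.pe ((\<pi> ^ i * u) * inverse u)"
  proof (rule F.odvd_mult)
    show "F.odvd F.pe (\<pi> ^ i * u)" using 1 m by (simp add: u_def right_diff_distrib)
    show "inverse u \<in> OF" using u unit_iff by blast
  qed
  then have "F.odvd F.pe (\<pi> ^ i)" using u unfolding unit_iff by (simp add: mult.assoc)
  then show ?thesis ..
qed

lemma infinitely_pi_divisible:
  assumes "\<And>n. F.odvd (\<pi> ^ n) x"
  shows "x = 0"
proof (rule F.infinitely_p_divisible)
  fix n
  obtain e where e: "F.odvd F.pe (\<pi> ^ e)" using pi_power_p by blast
  show "F.odvd (F.pe ^ n) x"
    using F.odvd_trans[OF F.odvd_power[OF e, of n] assms[of "e * n", unfolded power_mult]] .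
qed

text \<open>A largest power of \<pi> can be taken out because only 0 is divisible by all of them; an
  integral quotient not divisible by \<pi> is a unit.\<close>

lemma integral_factorization:
  assumes "x \<in> OF" "x \<noteq> 0"
  obtains u n where "u \<in> UF" "x = u * \<pi> ^ n"
proof -
  obtain m where m: "\<not> F.odvd (\<pi> ^ m) x" using infinitely_pi_divisible assms(2) by blast
  define n where "n = (LEAST m. \<not> F.odvd (\<pi> ^ m) x)"
  have n: "\<not> F.odvd (\<pi> ^ n) x" unfolding n_def using m by (rule LeastI)
  moreover have "F.odvd (\<pi> ^ 0) x" unfolding F.odvd_def using assms(1) by auto
  ultimately obtain k where k: "n = Suc k" by (cases n) auto
  have "F.odvd (\<pi> ^ k) x" using not_less_Least[of k "\<lambda>m. \<not> F.odvd (\<pi> ^ m) x"] k n_def by simp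
  then obtain u where u: "u \<in> OF" "x = \<pi> ^ k * u" unfolding F.odvd_def by blast
  have "\<not> F.odvd \<pi> u"
    using n u unfolding k F.odvd_def by (auto simp: mult.assoc mult.left_commute)
  then have "u \<in> UF" using u(1) nonunit_iff by blast
  then show thesis using u(2) that[of u k] by (simp add: mult.commute)
qed

lemma factorization:
  assumes "x \<noteq> 0"
  obtains u n where "u \<in> UF" "x = u * \<pi> powi n"
proof -
  obtain t where t: "F.pe ^ t * x \<in> OF" using F.integral_multiple by blast
  have nz: "F.pe ^ t * x \<noteq> 0" using assms F.p_nonzero by simp
  obtain u n where u: "u \<in> UF" "F.pe ^ t * x = u * \<pi> ^ n" using integral_factorization[OF t nz] .
  have "F.pe ^ t \<in> OF" using F.integers_power F.integers_of_nat F.of_nat_card by metis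
  then obtain v m where v: "v \<in> UF" "F.pe ^ t = v * \<pi> ^ m"
    using integral_factorization F.p_nonzero by (metis power_not_zero)
  have "x = (u * inverse v) * \<pi> powi (int n - int m)"
    using u(2) v(1) pi_nonzero unfolding v(2) unit_iff
    by (simp add: power_int_diff field_simps)
  then show thesis using that u(1) v(1) unit_mult unit_inverse by blast
qed

text \<open>Makes the exponent of a factorization unique and hence \<open>val\<close> well
  defined.\<close>

lemma unit_pi_powi: "\<pi> powi n \<in> UF \<Longrightarrow> n = 0"
proof (rule ccontr)
  assume u: "\<pi> powi n \<in> UF" and n: "n \<noteq> 0"
  define m where "m = nat \<bar>n\<bar>"
  have m: "m > 0" using n by (simp add: m_def)
  have "\<pi> ^ m \<in> UF"
  proof (cases "n > 0")
    case True
    then show ?thesis using u by (simp add: m_def power_int_def)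
  next
    case False
    then show ?thesis using unit_inverse[OF u] n by (simp add: m_def power_int_def power_inverse)
  qed
  moreover have "F.odvd \<pi> (\<pi> ^ m)" using F.odvd_power_le[OF pi_integral, of 1 m] m by simp
  ultimately show False using nonunit_iff by blast
qed

lemma val_eq:
  assumes "u \<in> UF" "x = u * \<pi> powi n"
  shows "val x = n"
  unfolding val_def
proof (rule the_equality)
  show "\<exists>u\<in>UF. x = u * \<pi> powi n" using assms by blast
next
  fix m assume "\<exists>v\<in>UF. x = v * \<pi> powi m"
  then obtain v where v: "v \<in> UF" "x = v * \<pi> powi m" by blast
  have "\<pi> powi (n - m) = v * inverse u"
    using v(2) assms pi_nonzero unfolding unit_iff by (simp add: power_int_diff field_simps)
  then have "\<pi> powi (n - m) \<in> UF" using unit_mult unit_inverse v(1) assms(1) by metis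
  then show "m = n" using unit_pi_powi by fastforce
qed

lemma val_unit: "u \<in> UF \<Longrightarrow> val u = 0"
  by (rule val_eq[of u]) simp_all

lemma val_mult: "x \<noteq> 0 \<Longrightarrow> y \<noteq> 0 \<Longrightarrow> val (x * y) = val x + val y"
proof -
  assume "x \<noteq> 0" "y \<noteq> 0"
  then obtain u m v n where "u \<in> UF" "x = u * \<pi> powi m" "v \<in> UF" "y = v * \<pi> powi n"
    using factorization by metis
  then show ?thesis
    using val_eq[of u x m] val_eq[of v y n] val_eq[of "u * v" "x * y" "m + n"] unit_mult[of u v] pi_nonzero
    by (simp add: power_int_add mult.assoc mult.left_commute)
qed

lemma val_1: "val 1 = 0" and val_pi: "val \<pi> = 1"
  by (auto intro!: val_eq[of 1] unit_1)

lemma val_inverse: "x \<noteq> 0 \<Longrightarrow> val (inverse x) = - val x"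
  using val_mult[of x "inverse x"] by (simp add: val_1)

lemma val_power: "x \<noteq> 0 \<Longrightarrow> val (x ^ n) = int n * val x"
  by (induction n) (auto simp: val_1 val_mult algebra_simps)

lemma unit_iff_val: "x \<in> UF \<longleftrightarrow> x \<noteq> 0 \<and> val x = 0"
proof
  assume "x \<in> UF"
  then show "x \<noteq> 0 \<and> val x = 0" using val_unit unit_iff by blast
next
  assume x: "x \<noteq> 0 \<and> val x = 0"
  then obtain u n where u: "u \<in> UF" "x = u * \<pi> powi n" using factorization by blast
  then have "n = 0" using val_eq x by metis
  then show "x \<in> UF" using u by simp
qed

text \<open>From here on divisibility by powers of \<pi> is arithmetic of valuations.\<close>

lemma odvd_iff_val: "F.odvd (\<pi> ^ n) x \<longleftrightarrow> x = 0 \<or> val x \<ge> int n"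
proof (cases "x = 0")
  case False
  then obtain u m where u: "u \<in> UF" "x = u * \<pi> powi m" using factorization by blast
  then have m: "val x = m" using val_eq by blast
  show ?thesis
  proof
    assume "F.odvd (\<pi> ^ n) x"
    then obtain z where z: "z \<in> OF" "x = \<pi> ^ n * z" unfolding F.odvd_def by blast
    then have "z \<noteq> 0" using False by auto
    then obtain v k where v: "v \<in> UF" "z = v * \<pi> ^ k" using integral_factorization z by blast
    have "x = v * \<pi> powi (int (n + k))" unfolding z v by (simp add: power_add power_int_add pi_nonzero)
    then have "val x = int (n + k)" using val_eq v(1) by blast
    then show "x = 0 \<or> val x \<ge> int n" by simp
  next
    assume "x = 0 \<or> val x \<ge> int n"
    then have "m \<ge> int n" using False m by simp
    then obtain k where k: "m = int n + int k" using zle_iff_zadd by blast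
    have "x = \<pi> ^ n * (u * \<pi> ^ k)" unfolding u(2) k using pi_nonzero by (simp add: power_int_add)
    moreover have "u * \<pi> ^ k \<in> OF" using u(1) unfolding unit_iff by (intro F.integers_closed pi_integral) simp
    ultimately show "F.odvd (\<pi> ^ n) x" unfolding F.odvd_def by blast
  qed
qed (simp add: F.odvd_0)

lemma integral_iff_val: "x \<in> OF \<longleftrightarrow> x = 0 \<or> val x \<ge> 0"
  using odvd_iff_val[of 0 x] unfolding F.odvd_def by simp

subsection \<open>The residue field\<close>

definition coset :: "'f \<Rightarrow> 'f set" where
  "coset x = (\<lambda>y. x + \<pi> * y) ` OF"

lemma residue_field_eq: "residue_field = coset ` OF"
  unfolding residue_field_def coset_def by simp

lemma mem_coset: "y \<in> coset x \<longleftrightarrow> F.odvd \<pi> (y - x)"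
  unfolding coset_def F.odvd_def by (auto simp: image_iff algebra_simps)

lemma coset_eq_iff: "coset x = coset y \<longleftrightarrow> F.odvd \<pi> (x - y)"
proof
  assume "coset x = coset y"
  moreover have "x \<in> coset x" by (simp add: mem_coset F.odvd_0)
  ultimately show "F.odvd \<pi> (x - y)" by (simp add: mem_coset)
next
  assume d: "F.odvd \<pi> (x - y)"
  show "coset x = coset y"
  proof (rule Set.set_eqI)
    fix z
    show "z \<in> coset x \<longleftrightarrow> z \<in> coset y"
      using F.odvd_add[of \<pi> "z - x" "x - y"] F.odvd_diff[of \<pi> "z - y" "x - y"] d
      by (auto simp: mem_coset)
  qed
qed

lemma finite_residue_field: "finite residue_field"
proof -
  obtain D where D: "finite D" "D \<subseteq> OF" "\<forall>y\<in>OF. \<exists>d\<in>D. F.odvd F.pe (y - d)"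
    using F.finite_residues_mod_p by blast
  have "residue_field \<subseteq> coset ` D"
    unfolding residue_field_eq using D(3) coset_eq_iff F.odvd_trans[OF p_nonunit] by blast
  then show ?thesis using D(1) finite_subset by blast
qed

abbreviation "q \<equiv> card residue_field"

lemma coset_representative:
  obtains r where "\<And>c. c \<in> residue_field \<Longrightarrow> r c \<in> OF \<and> coset (r c) = c"
proof -
  have "\<forall>c\<in>residue_field. \<exists>x. x \<in> OF \<and> coset x = c" unfolding residue_field_eq by auto
  from bchoice[OF this] show thesis using that by blast
qed

lemma card_residue_field_pos: "q > 0"
  using finite_residue_field F.integers_0 by (auto simp: card_gt_0_iff residue_field_eq)

text \<open>Translation by 1 permutes the residue classes. Each \<open>r c + 1 - r (s c)\<close> is
  divisible by \<pi>, and in the sum over all classes the representatives cancel, which leaves the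
  number of classes.\<close>

lemma card_residue_field_nonunit: "F.odvd \<pi> (of_nat q)"
proof -
  obtain r where r: "\<And>c. c \<in> residue_field \<Longrightarrow> r c \<in> OF \<and> coset (r c) = c" using coset_representative by blast
  define s where "s c = coset (r c + 1)" for c
  have sR: "s c \<in> residue_field" if "c \<in> residue_field" for c
    using r[OF that] by (auto simp: s_def residue_field_eq intro: F.integers_closed)
  have "inj_on s residue_field"
  proof (rule inj_onI)
    fix c d assume cd: "c \<in> residue_field" "d \<in> residue_field" "s c = s d"
    then have "F.odvd \<pi> (r c - r d)" by (simp add: s_def coset_eq_iff)
    then show "c = d" using r cd coset_eq_iff by metis
  qed
  then have bij: "bij_betw s residue_field residue_field"
    using sR finite_residue_field by (simp add: bij_betw_def endo_inj_surj image_subsetI)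
  have "F.odvd \<pi> (r c + 1 - r (s c))" if "c \<in> residue_field" for c
    using r[OF sR[OF that]] coset_eq_iff[of "r c + 1" "r (s c)"] by (simp add: s_def)
  then have "F.odvd \<pi> (\<Sum>c\<in>residue_field. r c + 1 - r (s c))" by (rule F.odvd_sum)
  also have "(\<Sum>c\<in>residue_field. r c + 1 - r (s c)) = of_nat q"
    using sum.reindex_bij_betw[OF bij, of r] by (simp add: sum_subtractf sum.distrib)
  finally show ?thesis .
qed

lemma odvd_prod_diff:
  assumes "\<And>i. i \<in> A \<Longrightarrow> f i \<in> OF \<and> g i \<in> OF \<and> F.odvd a (f i - g i)"
  shows "F.odvd a (prod f A - prod g A)"
  using assms
proof (induction A rule: infinite_finite_induct)
  case (insert x A)
  have "prod f (insert x A) - prod g (insert x A)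
    = (f x - g x) * prod f A + g x * (prod f A - prod g A)"
    using insert by (simp add: algebra_simps)
  moreover have "F.odvd a ((f x - g x) * prod f A)"
    using insert.prems by (intro F.odvd_mult F.integers_prod) auto
  moreover have "F.odvd a (g x * (prod f A - prod g A))"
    using insert.IH insert.prems by (intro F.odvd_mult2) auto
  ultimately show ?case by (simp only: F.odvd_add)
qed (simp_all add: F.odvd_0)

lemma odvd_power_diff: "x \<in> OF \<Longrightarrow> y \<in> OF \<Longrightarrow> F.odvd a (x - y) \<Longrightarrow> F.odvd a (x ^ n - y ^ n)"
  using odvd_prod_diff[of "{..<n}" "\<lambda>_. x" "\<lambda>_. y" a] by simp

text \<open>Fermat's argument: multiplication by \<open>u\<close> permutes the nonzero classes, and
  the product of their representatives is a unit that can be cancelled.\<close>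

lemma unit_power_residue:
  assumes "u \<in> UF"
  shows "F.odvd \<pi> (u ^ (q - 1) - 1)"
proof -
  obtain r where r: "\<And>c. c \<in> residue_field \<Longrightarrow> r c \<in> OF \<and> coset (r c) = c" using coset_representative by blast
  define R where "R = residue_field - {coset 0}"
  have z: "coset 0 \<in> residue_field" using F.integers_0 by (simp add: residue_field_eq)
  have fin: "finite R" and card: "card R = q - 1"
    using finite_residue_field z by (simp_all add: R_def)
  have rU: "r c \<in> UF" if "c \<in> R" for c
    using r[of c] that coset_eq_iff[of "r c" 0] nonunit_iff[of "r c"] by (auto simp: R_def)
  define s where "s c = coset (u * r c)" for c
  have uO: "u \<in> OF" "inverse u \<in> OF" "u \<noteq> 0" using assms unit_iff by auto
  have sR: "s c \<in> R" if c: "c \<in> R" for c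
  proof -
    have "u * r c \<in> UF" using unit_mult assms rU[OF c] .
    then show ?thesis
      unfolding s_def R_def residue_field_eq using nonunit_iff[of "u * r c"] unit_iff[of "u * r c"]
      by (auto simp: coset_eq_iff)
  qed
  have "inj_on s R"
  proof (rule inj_onI)
    fix c d assume cd: "c \<in> R" "d \<in> R" "s c = s d"
    then have "F.odvd \<pi> (inverse u * (u * r c - u * r d))"
      using uO by (intro F.odvd_mult2) (simp_all add: s_def coset_eq_iff)
    then have "F.odvd \<pi> (r c - r d)" using uO by (simp add: algebra_simps flip: mult.assoc)
    then show "c = d" using r cd coset_eq_iff unfolding R_def by (metis DiffD1)
  qed
  then have bij: "bij_betw s R R"
    using sR fin by (simp add: bij_betw_def endo_inj_surj image_subsetI)
  have "F.odvd \<pi> (prod (\<lambda>c. u * r c) R - prod (\<lambda>c. r (s c)) R)"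
  proof (rule odvd_prod_diff)
    fix c assume c: "c \<in> R"
    then have "r (s c) \<in> OF \<and> coset (r (s c)) = s c" using r sR by (simp add: R_def)
    then show "u * r c \<in> OF \<and> r (s c) \<in> OF \<and> F.odvd \<pi> (u * r c - r (s c))"
      using r c uO F.integers_add_mult coset_eq_iff[of "u * r c" "r (s c)"] by (auto simp: R_def s_def)
  qed
  also have "prod (\<lambda>c. r (s c)) R = prod r R" by (rule prod.reindex_bij_betw[OF bij])
  also have "prod (\<lambda>c. u * r c) R - prod r R = prod r R * (u ^ (q - 1) - 1)"
    by (simp add: prod.distrib card algebra_simps)
  finally have d: "F.odvd \<pi> (prod r R * (u ^ (q - 1) - 1))" .
  have P: "prod r R \<noteq> 0" "inverse (prod r R) \<in> OF"
    using unit_prod[of R r] rU unit_iff by blast+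
  have "inverse (prod r R) * (prod r R * (u ^ (q - 1) - 1)) = u ^ (q - 1) - 1"
    using P(1) by (simp flip: mult.assoc)
  then show ?thesis using F.odvd_mult2[OF d P(2)] by (simp only:)
qed

lemma power_residue:
  assumes "x \<in> OF"
  shows "F.odvd \<pi> (x ^ q - x)"
proof (cases "x \<in> UF")
  case True
  have "x ^ q - x = x * (x ^ (q - 1) - 1)"
    using card_residue_field_pos by (simp add: algebra_simps flip: power_Suc)
  then show ?thesis using F.odvd_mult2[OF unit_power_residue[OF True] assms] by simp
next
  case False
  then have d: "F.odvd \<pi> x" using assms nonunit_iff by blast
  have "x ^ q = x * x ^ (q - 1)" using card_residue_field_pos by (simp flip: power_Suc)
  then have "F.odvd \<pi> (x ^ q)" using F.odvd_mult[OF d F.integers_power[OF assms]] by simp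
  then show ?thesis using d F.odvd_diff by blast
qed

text \<open>In \<open>x ^ q - y ^ q = (x - y) * s\<close> the factor \<open>s\<close> is congruent
  to \<open>q * x ^ (q - 1)\<close> modulo \<pi>, hence divisible by \<pi>. So every q-th power
  gains one factor \<pi>.\<close>

lemma power_q_contracts:
  assumes "x \<in> OF" "y \<in> OF" "n > 0" "F.odvd (\<pi> ^ n) (x - y)"
  shows "F.odvd (\<pi> ^ Suc n) (x ^ q - y ^ q)"
proof -
  let ?s = "\<Sum>i<q. y ^ (q - Suc i) * x ^ i"
  have "F.odvd \<pi> (\<pi> ^ n)" using F.odvd_power_le[OF pi_integral, of 1 n] assms(3) by simp
  then have d: "F.odvd \<pi> (y - x)" using F.odvd_trans[OF _ assms(4)] F.odvd_uminus by fastforce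
  have "F.odvd \<pi> (y ^ (q - Suc i) * x ^ i - x ^ (q - 1))" if "i < q" for i
  proof -
    have "y ^ (q - Suc i) * x ^ i - x ^ (q - 1) = (y ^ (q - Suc i) - x ^ (q - Suc i)) * x ^ i"
      using that by (simp add: algebra_simps flip: power_add)
    then show ?thesis
      using odvd_power_diff[OF assms(2,1) d] by (simp add: F.odvd_mult F.integers_power assms)
  qed
  then have "F.odvd \<pi> (\<Sum>i<q. y ^ (q - Suc i) * x ^ i - x ^ (q - 1))" by (intro F.odvd_sum) simp
  then have "F.odvd \<pi> (?s - of_nat q * x ^ (q - 1))" by (simp add: sum_subtractf)
  moreover have "F.odvd \<pi> (of_nat q * x ^ (q - 1))"
    using card_residue_field_nonunit by (intro F.odvd_mult F.integers_power assms)
  ultimately have "F.odvd \<pi> ?s" using F.odvd_add by fastforce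
  then have "F.odvd (\<pi> ^ n * \<pi>) ((x - y) * ?s)" by (rule F.odvd_mult_mono[OF assms(4)])
  then show ?thesis by (simp add: power_diff_sumr2 mult.commute)
qed

lemma power_q_power:
  assumes "x \<in> OF"
  shows "F.odvd (\<pi> ^ Suc n) (x ^ q ^ Suc n - x ^ q ^ n)"
proof (induction n)
  case 0
  then show ?case using power_residue[OF assms] by simp
next
  case (Suc n)
  have "x ^ q ^ Suc (Suc n) - x ^ q ^ Suc n = (x ^ q ^ Suc n) ^ q - (x ^ q ^ n) ^ q"
    by (simp add: mult.commute flip: power_mult)
  then show ?case
    using power_q_contracts[OF _ _ _ Suc] assms F.integers_power by simp
qed

lemma power_q_cauchy:
  assumes "x \<in> OF"
  shows "F.odvd (\<pi> ^ Suc n) (x ^ q ^ (n + m) - x ^ q ^ n)"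
proof (induction m)
  case (Suc m)
  have "F.odvd (\<pi> ^ Suc n) (x ^ q ^ Suc (n + m) - x ^ q ^ (n + m))"
    using F.odvd_trans[OF F.odvd_power_le[OF pi_integral] power_q_power[OF assms]]
    by (metis Suc_le_mono le_add1)
  from F.odvd_add[OF this Suc] show ?case by simp
qed (simp add: F.odvd_0)

text \<open>The representative is the limit of \<open>x ^ q ^ (e * n)\<close>. The factor
  \<open>e\<close> thins out the sequence: \<pi>^(e n + 1) is a multiple of p^n, and completeness is
  available for powers of p.\<close>

lemma teichmueller_exists:
  assumes "x \<in> OF"
  shows "\<exists>t\<in>OF. F.odvd \<pi> (t - x) \<and> t ^ q = t"
proof -
  obtain e where e: "F.odvd F.pe (\<pi> ^ e)" using pi_power_p by blast
  define Y where "Y n = x ^ q ^ (e * n)" for n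
  have pen: "F.odvd (F.pe ^ n) (\<pi> ^ Suc (e * n))" for n
    using F.odvd_mult[OF F.odvd_power[OF e, of n] pi_integral] by (simp add: power_mult mult.commute)
  have YO: "Y n \<in> OF" for n unfolding Y_def using assms F.integers_power by blast
  have "F.odvd (F.pe ^ n) (Y (Suc n) - Y n)" for n
    using F.odvd_trans[OF pen power_q_cauchy[OF assms, of "e * n" e]]
    by (simp add: Y_def add.commute)
  then obtain t where t: "t \<in> OF" "\<And>n. F.odvd (F.pe ^ n) (t - Y n)"
    using F.complete[of Y, OF YO] by blast
  have "F.odvd (F.pe ^ n) (t ^ q - t)" for n
  proof -
    have 1: "F.odvd (F.pe ^ n) (t ^ q - Y n ^ q)"
      using odvd_power_diff[OF t(1) YO t(2)] .
    have "F.odvd (F.pe ^ n) (Y n ^ q - Y n)"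
      using F.odvd_trans[OF pen power_q_power[OF assms, of "e * n"]]
      by (simp add: Y_def mult.commute flip: power_mult)
    from F.odvd_diff[OF F.odvd_add[OF 1 this] t(2)[of n]] show ?thesis by simp
  qed
  then have "t ^ q - t = 0" by (rule F.infinitely_p_divisible)
  moreover have "F.odvd \<pi> (t - x)"
  proof -
    have "F.odvd \<pi> (t - Y 1)" using F.odvd_trans[OF p_nonunit] t(2)[of 1] by simp
    moreover have "F.odvd \<pi> (Y 1 - x)"
      using power_q_cauchy[OF assms, of 0 e] by (simp add: Y_def)
    ultimately show ?thesis using F.odvd_add by fastforce
  qed
  ultimately show ?thesis using t(1) by auto
qed

text \<open>Taking q-th powers fixes both elements but improves every congruence between them by one
  factor \<pi>.\<close>

lemma teichmueller_unique:
  assumes "s \<in> OF" "t \<in> OF" "s ^ q = s" "t ^ q = t" "F.odvd \<pi> (s - t)"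
  shows "s = t"
proof -
  have "F.odvd (\<pi> ^ Suc n) (s - t)" for n
  proof (induction n)
    case 0
    then show ?case using assms(5) by simp
  next
    case (Suc n)
    then show ?case using power_q_contracts[OF assms(1,2) _ Suc] assms(3,4) by simp
  qed
  then have "F.odvd (\<pi> ^ n) (s - t)" for n
    using F.odvd_trans[OF F.odvd_power_le[OF pi_integral]] by (metis le_SucI order_refl)
  then show ?thesis using infinitely_pi_divisible[of "s - t"] by simp
qed

lemma teich_coset:
  assumes "x \<in> OF"
  shows "teich (coset x) \<in> OF" "F.odvd \<pi> (teich (coset x) - x)" "teich (coset x) ^ q = teich (coset x)"
proof -
  obtain t where t: "t \<in> OF" "F.odvd \<pi> (t - x)" "t ^ q = t" using teichmueller_exists[OF assms] by blast
  have "teich (coset x) = t"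
    unfolding teich_def
  proof (rule the_equality)
    show "t \<in> coset x \<and> t ^ q = t" using t by (simp add: mem_coset)
  next
    fix s assume s: "s \<in> coset x \<and> s ^ q = s"
    then have d: "F.odvd \<pi> (s - x)" by (simp add: mem_coset)
    then have "s \<in> OF" using F.odvd_integral[OF d pi_integral] assms F.integers_add_mult(1) by fastforce
    moreover have "F.odvd \<pi> (s - t)" using F.odvd_diff[OF d t(2)] by simp
    ultimately show "s = t" using teichmueller_unique t s by blast
  qed
  then show "teich (coset x) \<in> OF" "F.odvd \<pi> (teich (coset x) - x)" "teich (coset x) ^ q = teich (coset x)"
    using t by simp_all
qed

subsection \<open>Representatives modulo powers of the uniformizer\<close>

abbreviation "TF \<equiv> teich ` residue_field"

lemma TF_integral: "t \<in> TF \<Longrightarrow> t \<in> OF"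
  unfolding residue_field_eq using teich_coset(1) by blast

lemma TF_representative: "x \<in> OF \<Longrightarrow> \<exists>t\<in>TF. F.odvd \<pi> (x - t)"
  unfolding residue_field_eq using teich_coset(2)[of x] F.odvd_uminus by fastforce

lemma TF_unique: "s \<in> TF \<Longrightarrow> t \<in> TF \<Longrightarrow> F.odvd \<pi> (s - t) \<Longrightarrow> s = t"
  unfolding residue_field_eq using teich_coset teichmueller_unique by (smt (verit) image_iff)

lemma I_0: "I 0 = {0}"
  unfolding I_def by auto

text \<open>Splits off the last digit, of weight \<pi>^n; all inductions over \<open>I n\<close>
  rest on this.\<close>

lemma I_Suc: "I (Suc n) = (\<lambda>(\<mu>, t). \<mu> + \<pi> ^ n * t) ` (I n \<times> TF)"
proof (intro equalityI subsetI)
  fix x assume "x \<in> I (Suc n)"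
  then obtain \<mu> where \<mu>: "x = (\<Sum>i<Suc n. \<pi> ^ i * teich (\<mu> i))" "\<forall>i<Suc n. \<mu> i \<in> residue_field"
    unfolding I_def by blast
  have "(\<Sum>i<n. \<pi> ^ i * teich (\<mu> i)) \<in> I n" unfolding I_def using \<mu>(2) by auto
  then show "x \<in> (\<lambda>(\<mu>, t). \<mu> + \<pi> ^ n * t) ` (I n \<times> TF)"
    using \<mu> by (auto intro!: image_eqI[of _ _ "(\<Sum>i<n. \<pi> ^ i * teich (\<mu> i), teich (\<mu> n))"])
next
  fix x assume "x \<in> (\<lambda>(\<mu>, t). \<mu> + \<pi> ^ n * t) ` (I n \<times> TF)"
  then obtain \<mu> \<nu> where \<mu>: "\<forall>i<n. \<mu> i \<in> residue_field" "\<nu> \<in> residue_field"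
    "x = (\<Sum>i<n. \<pi> ^ i * teich (\<mu> i)) + \<pi> ^ n * teich \<nu>"
    unfolding I_def by auto
  have "x = (\<Sum>i<Suc n. \<pi> ^ i * teich ((\<mu>(n := \<nu>)) i))" using \<mu>(3) by simp
  moreover have "\<forall>i<Suc n. (\<mu>(n := \<nu>)) i \<in> residue_field" using \<mu> by (simp add: less_Suc_eq)
  ultimately show "x \<in> I (Suc n)" unfolding I_def by blast
qed

lemma I_SucE:
  assumes "\<mu> \<in> I (Suc n)"
  obtains \<nu> t where "\<nu> \<in> I n" "t \<in> TF" "\<mu> = \<nu> + \<pi> ^ n * t"
proof -
  from assms obtain x where "\<mu> = (\<lambda>(\<mu>, t). \<mu> + \<pi> ^ n * t) x" "x \<in> I n \<times> TF"
    unfolding I_Suc by (rule imageE)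
  then show thesis using that[of "fst x" "snd x"] by (simp add: mem_Times_iff case_prod_unfold)
qed

lemma I_integral: "\<mu> \<in> I n \<Longrightarrow> \<mu> \<in> OF"
proof (induction n arbitrary: \<mu>)
  case 0
  then show ?case by (simp add: I_0 F.integers_0)
next
  case (Suc n)
  from Suc.prems obtain \<nu> t where "\<nu> \<in> I n" "t \<in> TF" "\<mu> = \<nu> + \<pi> ^ n * t" by (rule I_SucE)
  then show ?case
    using Suc.IH TF_integral pi_integral by (simp add: F.integers_add_mult F.integers_power)
qed

lemma finite_I: "finite (I n)"
  by (induction n) (simp_all add: I_0 I_Suc finite_residue_field)

text \<open>The error of a representative modulo \<pi>^n, divided by \<pi>^n, determines the next
  Teichmueller digit.\<close>

lemma I_representative: "x \<in> OF \<Longrightarrow> \<exists>\<mu>\<in>I n. F.odvd (\<pi> ^ n) (x - \<mu>)"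
proof (induction n)
  case 0
  then show ?case by (simp add: I_0 F.odvd_def)
next
  case (Suc n)
  then obtain \<mu> z where \<mu>: "\<mu> \<in> I n" "z \<in> OF" "x - \<mu> = \<pi> ^ n * z" unfolding F.odvd_def by blast
  obtain t where t: "t \<in> TF" "F.odvd \<pi> (z - t)" using TF_representative[OF \<mu>(2)] by blast
  have "x - (\<mu> + \<pi> ^ n * t) = \<pi> ^ n * (z - t)" using \<mu>(3) by (simp add: algebra_simps)
  then have "F.odvd (\<pi> ^ Suc n) (x - (\<mu> + \<pi> ^ n * t))"
    using F.odvd_mult_mono[OF F.odvd_refl t(2), of "\<pi> ^ n"] by (simp add: mult.commute)
  moreover have "\<mu> + \<pi> ^ n * t \<in> I (Suc n)" using \<mu> t by (auto simp: I_Suc)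
  ultimately show ?case by blast
qed

lemma odvd_cancel: "a \<noteq> 0 \<Longrightarrow> F.odvd (a * b) (a * x) \<Longrightarrow> F.odvd b x"
  unfolding F.odvd_def by (simp add: mult.assoc)

text \<open>Reduction modulo \<pi>^n identifies the lower digits by induction; the difference of the
  last digits is then divisible by \<pi>.\<close>

lemma I_unique: "\<mu> \<in> I n \<Longrightarrow> \<nu> \<in> I n \<Longrightarrow> F.odvd (\<pi> ^ n) (\<mu> - \<nu>) \<Longrightarrow> \<mu> = \<nu>"
proof (induction n arbitrary: \<mu> \<nu>)
  case 0
  then show ?case by (simp add: I_0)
next
  case (Suc n)
  obtain a s where as: "a \<in> I n" "s \<in> TF" "\<mu> = a + \<pi> ^ n * s" using Suc.prems(1) by (rule I_SucE)
  obtain b t where bt: "b \<in> I n" "t \<in> TF" "\<nu> = b + \<pi> ^ n * t" using Suc.prems(2) by (rule I_SucE)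
  have "F.odvd (\<pi> ^ n) (\<mu> - \<nu>)"
    using F.odvd_trans[OF F.odvd_power_le[OF pi_integral] Suc.prems(3)] by simp
  moreover have "F.odvd (\<pi> ^ n) (\<pi> ^ n * (s - t))"
    by (intro F.odvd_self_mult F.integers_diff TF_integral as bt)
  ultimately have "F.odvd (\<pi> ^ n) (\<mu> - \<nu> - \<pi> ^ n * (s - t))" by (rule F.odvd_diff)
  moreover have "\<mu> - \<nu> - \<pi> ^ n * (s - t) = a - b" by (simp add: as(3) bt(3) algebra_simps)
  ultimately have ab: "a = b" using Suc.IH[OF as(1) bt(1)] by simp
  have "\<mu> - \<nu> = \<pi> ^ n * (s - t)" by (simp add: as(3) bt(3) ab algebra_simps)
  then have "F.odvd (\<pi> ^ n * \<pi>) (\<pi> ^ n * (s - t))" using Suc.prems(3) by (simp add: mult.commute)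
  then have "F.odvd \<pi> (s - t)" by (rule odvd_cancel[rotated]) (simp add: pi_nonzero)
  then have "s = t" by (rule TF_unique[OF as(2) bt(2)])
  then show ?case by (simp add: as(3) bt(3) ab)
qed

end

section \<open>Cosets of \<open>KZ\<close> in \<open>GL\<^sub>2\<close>\<close>

lemma mat2_nth [simp]:
  "mat2 a b c d $ 1 $ 1 = a" "mat2 a b c d $ 1 $ 2 = b"
  "mat2 a b c d $ 2 $ 1 = c" "mat2 a b c d $ 2 $ 2 = d"
  by (simp_all add: mat2_def)

lemma mat2_eq_iff: "g = h \<longleftrightarrow> g $ 1 $ 1 = h $ 1 $ 1 \<and> g $ 1 $ 2 = h $ 1 $ 2
    \<and> g $ 2 $ 1 = h $ 2 $ 1 \<and> g $ 2 $ 2 = h $ 2 $ 2"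
  for g h :: "'a^2^2"
  by (simp add: Finite_Cartesian_Product.vec_eq_iff forall_2)

lemma mat2_inject [simp]: "mat2 a b c d = mat2 a' b' c' d' \<longleftrightarrow> a = a' \<and> b = b' \<and> c = c' \<and> d = d'"
  by (simp add: mat2_eq_iff)

lemma mat2_cases:
  fixes g :: "'a::zero^2^2"
  obtains a b c d where "g = mat2 a b c d"
  by (rule that[of "g$1$1" "g$1$2" "g$2$1" "g$2$2"]) (simp add: mat2_eq_iff)

lemma mat2_mult [simp]:
  "mat2 a b c d ** mat2 a' b' c' d' =
    mat2 (a * a' + b * c') (a * b' + b * d') (c * a' + d * c') (c * b' + d * d')"
  for a :: "'a::comm_ring_1"
  by (simp add: mat2_eq_iff matrix_matrix_mult_def sum_2)

lemma mat_eq_mat2: "mat z = mat2 z 0 0 z" for z :: "'a::comm_ring_1"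
  by (simp add: mat2_eq_iff Finite_Cartesian_Product.mat_def)

lemma det_mat2 [simp]: "det (mat2 a b c d) = a * d - b * c" for a :: "'a::comm_ring_1"
  by (simp add: det_2)

lemma mat_mult_commute: "mat z ** g = g ** mat z" for g :: "'a::comm_ring_1^2^2"
  by (cases g rule: mat2_cases) (simp add: mat_eq_mat2 mult.commute)

lemma mat_mult_mat: "mat z ** mat w = (mat (z * w) :: 'a::comm_ring_1^2^2)"
  by (simp add: mat_eq_mat2)

lemma matrix_inv_cancel:
  fixes A :: "'a::semiring_1^'n^'m"
  assumes "invertible A"
  shows "A ** matrix_inv A = mat 1" "matrix_inv A ** A = mat 1"
  using someI_ex[OF assms[unfolded invertible_def]] unfolding matrix_inv_def by auto

lemma matrix_inv_eqI:
  fixes A B :: "'a::field^2^2"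
  assumes "A ** B = mat 1"
  shows "matrix_inv A = B"
proof -
  have "invertible A"
    using assms matrix_left_right_inverse[of A B] unfolding invertible_def by blast
  then show ?thesis
    using assms matrix_inv_cancel(2)[of A] by (metis matrix_mul_assoc matrix_mul_lid matrix_mul_rid)
qed

context gl2_setup
begin

section \<open>The groups \<open>G\<close>, \<open>K\<close> and \<open>KZ\<close>\<close>

lemma G_iff_det: "g \<in> G \<longleftrightarrow> det g \<noteq> 0"
  by (simp add: G_def invertible_det_nz)

lemma G_inv: "g \<in> G \<Longrightarrow> g ** matrix_inv g = mat 1" "g \<in> G \<Longrightarrow> matrix_inv g ** g = mat 1"
  by (simp_all add: G_def matrix_inv_cancel)

lemma G_mult: "g \<in> G \<Longrightarrow> h \<in> G \<Longrightarrow> g ** h \<in> G"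
  by (simp add: G_iff_det det_mul)

lemma G_matrix_inv: "g \<in> G \<Longrightarrow> matrix_inv g \<in> G"
  unfolding G_def invertible_def using G_inv[unfolded G_def invertible_def] by blast

lemma matrix_inv_matrix_inv: "g \<in> G \<Longrightarrow> matrix_inv (matrix_inv g) = g"
  by (rule matrix_inv_eqI) (rule G_inv)

lemma matrix_inv_mult: "g \<in> G \<Longrightarrow> h \<in> G \<Longrightarrow> matrix_inv (g ** h) = matrix_inv h ** matrix_inv g"
  by (rule matrix_inv_eqI) (metis G_inv(1) matrix_mul_assoc matrix_mul_lid)

lemma G_cancel: "g \<in> G \<Longrightarrow> matrix_inv g ** (g ** h) = h" "g \<in> G \<Longrightarrow> g ** (matrix_inv g ** h) = h"
  "g \<in> G \<Longrightarrow> h ** g ** matrix_inv g = h" "g \<in> G \<Longrightarrow> h ** matrix_inv g ** g = h"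
  by (simp_all add: G_inv matrix_mul_assoc flip: matrix_mul_assoc[of h])

text \<open>The adjugate divided by the unit determinant is an integral inverse, so a check of
  entries and determinant replaces the search for an inverse.\<close>

lemma K_iff: "g \<in> K \<longleftrightarrow> (\<forall>i j. g $ i $ j \<in> OF) \<and> det g \<in> UF"
proof
  assume "g \<in> K"
  then obtain h where g: "\<forall>i j. g $ i $ j \<in> OF" and h: "\<forall>i j. h $ i $ j \<in> OF" "g ** h = mat 1"
    unfolding K_def by blast
  have "det g \<in> OF" "det h \<in> OF" using g h by (auto simp: det_2 intro!: F.integers_closed)
  moreover have "det g * det h = 1" using h(2) by (metis det_mul det_I)
  ultimately show "(\<forall>i j. g $ i $ j \<in> OF) \<and> det g \<in> UF"
    using g unfolding integer_units_def by blast
next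
  assume *: "(\<forall>i j. g $ i $ j \<in> OF) \<and> det g \<in> UF"
  obtain a b c d where g: "g = mat2 a b c d" by (rule mat2_cases)
  have O: "a \<in> OF" "b \<in> OF" "c \<in> OF" "d \<in> OF" using * g by (auto simp: forall_2)
  define e where "e = inverse (det g)"
  have e: "e \<in> OF" "(a * d - b * c) * e = 1"
    using * g unfolding unit_iff e_def by auto
  define h where "h = mat2 (d * e) (- b * e) (- c * e) (a * e)"
  have "g ** h = mat 1" "h ** g = mat 1"
    using e(2) by (simp_all add: g h_def mat_eq_mat2 algebra_simps)
  moreover have "\<forall>i j. h $ i $ j \<in> OF"
    using O e(1) by (simp add: forall_2 h_def F.integers_closed)
  ultimately show "g \<in> K" using * unfolding K_def by blast
qed

lemma K_mat2: "mat2 a b c d \<in> K \<longleftrightarrow> a \<in> OF \<and> b \<in> OF \<and> c \<in> OF \<and> d \<in> OF \<and> a * d - b * c \<in> UF"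
  by (auto simp: K_iff forall_2)

lemma K_mult: "g \<in> K \<Longrightarrow> h \<in> K \<Longrightarrow> g ** h \<in> K"
  unfolding K_iff det_mul using unit_mult
  by (auto simp: matrix_matrix_mult_def sum_2 intro!: F.integers_closed)

lemma K_matrix_inv: "g \<in> K \<Longrightarrow> matrix_inv g \<in> K"
proof -
  assume "g \<in> K"
  then obtain h where gh: "\<forall>i j. g $ i $ j \<in> OF" "\<forall>i j. h $ i $ j \<in> OF" "g ** h = mat 1" "h ** g = mat 1"
    unfolding K_def by blast
  have "matrix_inv g = h" using gh(3) by (rule matrix_inv_eqI)
  then show ?thesis unfolding K_def using gh by blast
qed

lemma K_G: "g \<in> K \<Longrightarrow> g \<in> G"
  by (simp add: K_iff G_iff_det unit_iff)

lemma KZ_iff: "g \<in> KZ \<longleftrightarrow> (\<exists>z \<kappa>. z \<noteq> 0 \<and> \<kappa> \<in> K \<and> g = mat z ** \<kappa>)"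
  unfolding KZ_def Z_def by (auto simp: mat_mult_commute)

lemma K_KZ: "\<kappa> \<in> K \<Longrightarrow> \<kappa> \<in> KZ"
  unfolding KZ_iff by (intro exI[of _ 1] exI[of _ \<kappa>]) simp

lemma one_K: "mat 1 \<in> K"
  by (simp add: mat_eq_mat2 K_mat2 F.integers_closed unit_1)

lemma mat_KZ: "z \<noteq> 0 \<Longrightarrow> mat z \<in> KZ"
  unfolding KZ_iff by (intro exI[of _ z] exI[of _ "mat 1"]) (simp add: one_K)

lemma KZ_mult: "g \<in> KZ \<Longrightarrow> h \<in> KZ \<Longrightarrow> g ** h \<in> KZ"
proof -
  assume "g \<in> KZ" "h \<in> KZ"
  then obtain z \<kappa> w l where "z \<noteq> 0" "\<kappa> \<in> K" "g = mat z ** \<kappa>" "w \<noteq> 0" "l \<in> K" "h = mat w ** l"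
    unfolding KZ_iff by blast
  moreover have "mat z ** \<kappa> ** (mat w ** l) = mat (z * w) ** (\<kappa> ** l)"
    by (metis mat_mult_commute mat_mult_mat matrix_mul_assoc)
  ultimately show ?thesis
    unfolding KZ_iff by (intro exI[of _ "z * w"] exI[of _ "\<kappa> ** l"]) (simp add: K_mult)
qed

lemma KZ_G: "g \<in> KZ \<Longrightarrow> g \<in> G"
  unfolding KZ_iff by (auto simp: G_iff_det det_mul mat_eq_mat2 K_iff unit_iff)

lemma KZ_matrix_inv: "g \<in> KZ \<Longrightarrow> matrix_inv g \<in> KZ"
proof -
  assume "g \<in> KZ"
  then obtain z \<kappa> where g: "z \<noteq> 0" "\<kappa> \<in> K" "g = mat z ** \<kappa>" unfolding KZ_iff by blast
  have "g ** (mat (inverse z) ** matrix_inv \<kappa>) = mat 1"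
  proof -
    have "g ** (mat (inverse z) ** matrix_inv \<kappa>) = \<kappa> ** (mat z ** mat (inverse z)) ** matrix_inv \<kappa>"
      unfolding g(3) by (simp add: mat_mult_commute[of z \<kappa>] matrix_mul_assoc)
    then show ?thesis using g(1) G_inv(1)[OF K_G[OF g(2)]] by (simp add: mat_mult_mat)
  qed
  then have "matrix_inv g = mat (inverse z) ** matrix_inv \<kappa>" by (rule matrix_inv_eqI)
  then show ?thesis unfolding KZ_iff using g K_matrix_inv by (metis nonzero_imp_inverse_nonzero)
qed

lemma one_KZ: "mat 1 \<in> KZ" using one_K K_KZ by blast

subsection \<open>The vertices of the tree\<close>

lemma g0_G: "g0 n \<mu> \<in> G" and g1_G: "g1 n \<mu> \<in> G" and alpha_G: "alpha \<in> G"
  by (simp_all add: G_iff_det g0_def g1_def alpha_def pi_nonzero)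

lemma matrix_inv_alpha: "matrix_inv alpha = mat2 1 0 0 (inverse \<pi>)"
  by (rule matrix_inv_eqI) (simp add: alpha_def mat_eq_mat2 pi_nonzero)

text \<open>Right multiplication by \<open>K\<close> changes the diagonal entry by a unit and
  \<open>b0\<close> by multiples of \<pi>^n, so the vertex depends only on \<open>n\<close> and a
  residue modulo \<pi>^n.\<close>

lemma upper_triangular_vertex:
  assumes "A \<in> OF" "b0 \<in> OF" "A \<noteq> 0"
  shows "\<exists>n. \<exists>\<mu>\<in>I n. \<exists>\<kappa>\<in>K. mat2 A b0 0 1 = g0 n \<mu> ** \<kappa>"
proof -
  obtain u n where u: "u \<in> UF" "A = u * \<pi> ^ n" using integral_factorization[OF assms(1,3)] .
  obtain \<mu> z where \<mu>: "\<mu> \<in> I n" "z \<in> OF" "b0 - \<mu> = \<pi> ^ n * z"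
    using I_representative[OF assms(2), of n] unfolding F.odvd_def by blast
  have "mat2 u z 0 1 \<in> K" using u(1) \<mu>(2) by (simp add: K_mat2 F.integers_closed unit_iff)
  moreover have "mat2 A b0 0 1 = g0 n \<mu> ** mat2 u z 0 1"
    using u(2) \<mu>(3) by (simp add: g0_def mult.commute diff_eq_eq)
  ultimately show ?thesis using \<mu>(1) by blast
qed

lemma lower_triangular_vertex:
  assumes "F.odvd \<pi> C" "F.odvd \<pi> D" "D \<noteq> 0"
  shows "\<exists>n. \<exists>\<mu>\<in>I n. \<exists>\<kappa>\<in>K. mat2 1 0 C D = g1 n \<mu> ** \<kappa>"
proof -
  obtain C' D' where CD: "C' \<in> OF" "C = \<pi> * C'" "D' \<in> OF" "D = \<pi> * D'"
    using assms unfolding F.odvd_def by blast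
  then have "D' \<noteq> 0" using assms(3) by auto
  then obtain u n where u: "u \<in> UF" "D' = u * \<pi> ^ n" using integral_factorization CD by blast
  obtain \<mu> z where \<mu>: "\<mu> \<in> I n" "z \<in> OF" "C' - \<mu> = \<pi> ^ n * z"
    using I_representative[OF CD(1), of n] unfolding F.odvd_def by blast
  have "mat2 1 0 z u \<in> K" using u(1) \<mu>(2) by (simp add: K_mat2 F.integers_closed unit_iff)
  moreover have "mat2 1 0 C D = g1 n \<mu> ** mat2 1 0 z u"
    using u(2) \<mu>(3) CD by (simp add: g1_def diff_eq_eq algebra_simps)
  ultimately show ?thesis using \<mu>(1) by blast
qed

text \<open>Iwasawa decomposition: integral column operations turn a bottom row containing a unit
  into (0, 1).\<close>

lemma bottom_row_unit_vertex:
  assumes O: "a \<in> OF" "b \<in> OF" "c \<in> OF" "d \<in> OF" and u: "c \<in> UF \<or> d \<in> UF" and det: "a * d - b * c \<noteq> 0"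
  shows "\<exists>n. \<exists>\<mu>\<in>I n. \<exists>\<kappa>\<in>K. mat2 a b c d = g0 n \<mu> ** \<kappa>"
proof -
  have "\<exists>A b0 \<kappa>. A \<in> OF \<and> b0 \<in> OF \<and> A \<noteq> 0 \<and> \<kappa> \<in> K \<and> mat2 a b c d = mat2 A b0 0 1 ** \<kappa>"
  proof (cases "d \<in> UF")
    case True
    then have d: "d \<noteq> 0" "inverse d \<in> OF" unfolding unit_iff by auto
    show ?thesis
    proof (intro exI conjI)
      show "(a * d - b * c) * inverse d \<in> OF" "b * inverse d \<in> OF"
        using O d by (auto intro!: F.integers_closed)
      show "(a * d - b * c) * inverse d \<noteq> 0" using det d by simp
      show "mat2 1 0 c d \<in> K" using O True by (simp add: K_mat2 F.integers_closed)
      show "mat2 a b c d = mat2 ((a * d - b * c) * inverse d) (b * inverse d) 0 1 ** mat2 1 0 c d"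
        using d by (simp add: field_simps)
    qed
  next
    case False
    then have c: "c \<noteq> 0" "inverse c \<in> OF" "c \<in> UF" using u unfolding unit_iff by auto
    show ?thesis
    proof (intro exI conjI)
      show "- (a * d - b * c) * inverse c \<in> OF" "a * inverse c \<in> OF"
        using O c by (auto intro!: F.integers_closed)
      show "- (a * d - b * c) * inverse c \<noteq> 0" using det c by simp
      show "mat2 0 1 c d \<in> K" using O c unit_uminus by (simp add: K_mat2 F.integers_closed)
      show "mat2 a b c d = mat2 (- (a * d - b * c) * inverse c) (a * inverse c) 0 1 ** mat2 0 1 c d"
        using c by (simp add: field_simps)
    qed
  qed
  then obtain A b0 \<kappa> where AB: "A \<in> OF" "b0 \<in> OF" "A \<noteq> 0" "\<kappa> \<in> K" "mat2 a b c d = mat2 A b0 0 1 ** \<kappa>" by blast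
  obtain n \<mu> l where "\<mu> \<in> I n" "l \<in> K" "mat2 A b0 0 1 = g0 n \<mu> ** l"
    using upper_triangular_vertex[OF AB(1-3)] by blast
  then have "mat2 a b c d = g0 n \<mu> ** (l ** \<kappa>)" "l ** \<kappa> \<in> K"
    using AB K_mult by (simp_all add: matrix_mul_assoc)
  then show ?thesis using \<open>\<mu> \<in> I n\<close> by blast
qed

text \<open>With a bottom row divisible by \<pi>, a unit in the top row serves to bring that row to
  (1, 0).\<close>

lemma top_row_unit_vertex:
  assumes O: "a \<in> OF" "b \<in> OF" "F.odvd \<pi> c" "F.odvd \<pi> d" and u: "a \<in> UF \<or> b \<in> UF"
    and det: "a * d - b * c \<noteq> 0"
  shows "\<exists>n. \<exists>\<mu>\<in>I n. \<exists>\<kappa>\<in>K. mat2 a b c d = g1 n \<mu> ** \<kappa>"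
proof -
  have det_dvd: "F.odvd \<pi> (a * d - b * c)"
    by (rule F.odvd_diff[OF F.odvd_mult2[OF O(4,1)] F.odvd_mult2[OF O(3,2)]])
  have "\<exists>C D \<kappa>. F.odvd \<pi> C \<and> F.odvd \<pi> D \<and> D \<noteq> 0 \<and> \<kappa> \<in> K \<and> mat2 a b c d = mat2 1 0 C D ** \<kappa>"
  proof (cases "a \<in> UF")
    case True
    then have a: "a \<noteq> 0" "inverse a \<in> OF" unfolding unit_iff by auto
    show ?thesis
    proof (intro exI conjI)
      show "F.odvd \<pi> (c * inverse a)" "F.odvd \<pi> ((a * d - b * c) * inverse a)"
        using F.odvd_mult[OF O(3) a(2)] F.odvd_mult[OF det_dvd a(2)] by simp_all
      show "(a * d - b * c) * inverse a \<noteq> 0" using det a by simp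
      show "mat2 a b 0 1 \<in> K" using O True by (simp add: K_mat2 F.integers_closed)
      show "mat2 a b c d = mat2 1 0 (c * inverse a) ((a * d - b * c) * inverse a) ** mat2 a b 0 1"
        using a by (simp add: field_simps)
    qed
  next
    case False
    then have b: "b \<noteq> 0" "inverse b \<in> OF" "b \<in> UF" using u unfolding unit_iff by auto
    show ?thesis
    proof (intro exI conjI)
      show "F.odvd \<pi> (d * inverse b)" "F.odvd \<pi> (- (a * d - b * c) * inverse b)"
        using F.odvd_mult[OF O(4) b(2)] F.odvd_mult[OF F.odvd_uminus[OF det_dvd] b(2)] by simp_all
      show "- (a * d - b * c) * inverse b \<noteq> 0" using det b by simp
      show "mat2 a b 1 0 \<in> K" using O b unit_uminus by (simp add: K_mat2 F.integers_closed)
      show "mat2 a b c d = mat2 1 0 (d * inverse b) (- (a * d - b * c) * inverse b) ** mat2 a b 1 0"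
        using b by (simp add: field_simps)
    qed
  qed
  then obtain C D \<kappa> where CD: "F.odvd \<pi> C" "F.odvd \<pi> D" "D \<noteq> 0" "\<kappa> \<in> K" "mat2 a b c d = mat2 1 0 C D ** \<kappa>"
    by blast
  obtain n \<mu> l where "\<mu> \<in> I n" "l \<in> K" "mat2 1 0 C D = g1 n \<mu> ** l"
    using lower_triangular_vertex[OF CD(1-3)] by blast
  then have "mat2 a b c d = g1 n \<mu> ** (l ** \<kappa>)" "l ** \<kappa> \<in> K"
    using CD K_mult by (simp_all add: matrix_mul_assoc)
  then show ?thesis using \<open>\<mu> \<in> I n\<close> by blast
qed

lemma primitive_vertex:
  assumes O: "a \<in> OF" "b \<in> OF" "c \<in> OF" "d \<in> OF" and u: "a \<in> UF \<or> b \<in> UF \<or> c \<in> UF \<or> d \<in> UF"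
    and det: "a * d - b * c \<noteq> 0"
  shows "(\<exists>n. \<exists>\<mu>\<in>I n. \<exists>\<kappa>\<in>K. mat2 a b c d = g0 n \<mu> ** \<kappa>) \<or> (\<exists>n. \<exists>\<mu>\<in>I n. \<exists>\<kappa>\<in>K. mat2 a b c d = g1 n \<mu> ** \<kappa>)"
proof (cases "c \<in> UF \<or> d \<in> UF")
  case True
  then show ?thesis using bottom_row_unit_vertex[OF O _ det] by blast
next
  case False
  then have "F.odvd \<pi> c" "F.odvd \<pi> d" "a \<in> UF \<or> b \<in> UF" using O u nonunit_iff by auto
  then show ?thesis using top_row_unit_vertex[OF O(1,2) _ _ _ det] by blast
qed

text \<open>The two halves of the tree obtained by removing the edge between \<open>KZ\<close> and \<open>\<alpha>KZ\<close>.\<close>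

definition H0 :: "('f^2^2) set" where
  "H0 = {g0 n \<mu> ** \<kappa> | n \<mu> \<kappa>. \<mu> \<in> I n \<and> \<kappa> \<in> KZ}"

definition H1 :: "('f^2^2) set" where
  "H1 = {g1 n \<mu> ** \<kappa> | n \<mu> \<kappa>. \<mu> \<in> I n \<and> \<kappa> \<in> KZ}"

lemma H0_KZ: "g \<in> H0 \<Longrightarrow> \<kappa> \<in> KZ \<Longrightarrow> g ** \<kappa> \<in> H0" and H1_KZ: "g \<in> H1 \<Longrightarrow> \<kappa> \<in> KZ \<Longrightarrow> g ** \<kappa> \<in> H1"
  unfolding H0_def H1_def using KZ_mult by (smt (verit) matrix_mul_assoc mem_Collect_eq)+

lemma H0_G: "g \<in> H0 \<Longrightarrow> g \<in> G" and H1_G: "g \<in> H1 \<Longrightarrow> g \<in> G"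
  unfolding H0_def H1_def using G_mult g0_G g1_G KZ_G by blast+

lemma g0_H0: "\<mu> \<in> I n \<Longrightarrow> g0 n \<mu> \<in> H0" and g1_H1: "\<mu> \<in> I n \<Longrightarrow> g1 n \<mu> \<in> H1"
  unfolding H0_def H1_def using one_KZ by (metis (mono_tags, lifting) matrix_mul_rid mem_Collect_eq)+

lemma K_vertex_H0: "\<exists>n. \<exists>\<mu>\<in>I n. \<exists>\<kappa>\<in>K. g = g0 n \<mu> ** \<kappa> \<Longrightarrow> g \<in> H0"
  and K_vertex_H1: "\<exists>n. \<exists>\<mu>\<in>I n. \<exists>\<kappa>\<in>K. g = g1 n \<mu> ** \<kappa> \<Longrightarrow> g \<in> H1"
  unfolding H0_def H1_def using K_KZ by blast+

lemma H0_scale_iff: "z \<noteq> 0 \<Longrightarrow> mat z ** g \<in> H0 \<longleftrightarrow> g \<in> H0"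
  and H1_scale_iff: "z \<noteq> 0 \<Longrightarrow> mat z ** g \<in> H1 \<longleftrightarrow> g \<in> H1"
proof -
  assume z: "z \<noteq> 0"
  have eq: "mat (inverse z) ** (mat z ** g) = g"
    using z by (simp add: mat_mult_mat matrix_mul_assoc)
  show "mat z ** g \<in> H0 \<longleftrightarrow> g \<in> H0" "mat z ** g \<in> H1 \<longleftrightarrow> g \<in> H1"
    using H0_KZ[OF _ mat_KZ] H1_KZ[OF _ mat_KZ] z eq
    by (metis mat_mult_commute nonzero_imp_inverse_nonzero)+
qed

text \<open>Dividing by an entry of least valuation, which is a central operation, makes the matrix
  integral with a unit entry.\<close>

lemma G_vertices: "g \<in> G \<Longrightarrow> g \<in> H0 \<or> g \<in> H1"
proof -
  assume "g \<in> G"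
  obtain a b c d where g: "g = mat2 a b c d" by (rule mat2_cases)
  have det: "a * d - b * c \<noteq> 0" using \<open>g \<in> G\<close> g by (simp add: G_iff_det)
  define E where "E = {a, b, c, d} - {0}"
  have E: "finite E" "E \<noteq> {}" using det by (auto simp: E_def)
  obtain x where x: "x \<in> E" "\<And>y. y \<in> E \<Longrightarrow> val x \<le> val y"
    using E by (metis arg_min_if_finite not_le)
  have x0: "x \<noteq> 0" using x by (simp add: E_def)
  have O: "inverse x * y \<in> OF" if "y \<in> {a, b, c, d}" for y
    using that x x0 by (cases "y = 0") (auto simp: integral_iff_val val_mult val_inverse E_def)
  have "inverse x * x \<in> UF" using x0 by (simp add: unit_1)
  then have u: "inverse x * a \<in> UF \<or> inverse x * b \<in> UF \<or> inverse x * c \<in> UF \<or> inverse x * d \<in> UF"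
    using x(1) by (auto simp: E_def)
  have "inverse x * a * (inverse x * d) - inverse x * b * (inverse x * c) = inverse x ^ 2 * (a * d - b * c)"
    by (simp add: algebra_simps power2_eq_square)
  then have "inverse x * a * (inverse x * d) - inverse x * b * (inverse x * c) \<noteq> 0" using det x0 by simp
  then have "mat2 (inverse x * a) (inverse x * b) (inverse x * c) (inverse x * d) \<in> H0 \<union> H1"
    using primitive_vertex[OF O O O O u] K_vertex_H0 K_vertex_H1 by blast
  moreover have "mat2 (inverse x * a) (inverse x * b) (inverse x * c) (inverse x * d) = mat (inverse x) ** g"
    by (simp add: g mat_eq_mat2)
  ultimately show ?thesis using x0 by (simp add: H0_scale_iff H1_scale_iff)
qed

text \<open>The invariants that separate vertices: \<open>val z\<close> bounds the valuations of the
  nonzero entries from below and is half the valuation of the determinant.\<close>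

lemma KZ_entries:
  assumes "mat2 a b c d \<in> KZ"
  obtains z where "z \<noteq> 0" "a * inverse z \<in> OF" "b * inverse z \<in> OF" "c * inverse z \<in> OF" "d * inverse z \<in> OF"
    "val (a * d - b * c) = 2 * val z" "a * d - b * c \<noteq> 0"
proof -
  obtain z \<kappa> where z: "z \<noteq> 0" "\<kappa> \<in> K" "mat2 a b c d = mat z ** \<kappa>" using assms unfolding KZ_iff by blast
  obtain a' b' c' d' where \<kappa>: "\<kappa> = mat2 a' b' c' d'" by (rule mat2_cases)
  have eq: "a = z * a'" "b = z * b'" "c = z * c'" "d = z * d'" using z(3) by (simp_all add: \<kappa> mat_eq_mat2)
  have O: "a' \<in> OF" "b' \<in> OF" "c' \<in> OF" "d' \<in> OF" "a' * d' - b' * c' \<in> UF" using z(2) by (simp_all add: \<kappa> K_mat2)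
  have "a * d - b * c = z * z * (a' * d' - b' * c')" by (simp add: eq algebra_simps)
  then have "val (a * d - b * c) = 2 * val z" "a * d - b * c \<noteq> 0"
    using z(1) O(5) by (simp_all add: unit_iff_val val_mult)
  then show thesis using that[of z] O z(1) by (simp add: eq field_simps)
qed

lemma upper_triangular_KZ:
  assumes "mat2 A b0 0 1 \<in> KZ"
  shows "A \<in> UF" "b0 \<in> OF"
proof -
  obtain z where "z \<noteq> 0" "A * inverse z \<in> OF" "b0 * inverse z \<in> OF" "0 * inverse z \<in> OF"
    "1 * inverse z \<in> OF" "val (A * 1 - b0 * 0) = 2 * val z" "A * 1 - b0 * 0 \<noteq> 0"
    using assms by (rule KZ_entries)
  note z = this[simplified]
  \<comment> \<open>The entry 1 gives \<open>val z \<le> 0\<close>; the entry \<open>A\<close>,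
    which is also the determinant, gives \<open>val z \<ge> 0\<close>.\<close>
  have "val z = 0" using z by (simp add: integral_iff_val val_mult val_inverse)
  then show "A \<in> UF" "b0 \<in> OF"
    using z by (cases "b0 = 0"; simp add: unit_iff_val integral_iff_val val_mult val_inverse)+
qed

lemma lower_triangular_KZ:
  assumes "mat2 1 0 C D \<in> KZ"
  shows "D \<in> UF" "C \<in> OF"
proof -
  obtain z where "z \<noteq> 0" "1 * inverse z \<in> OF" "0 * inverse z \<in> OF" "C * inverse z \<in> OF"
    "D * inverse z \<in> OF" "val (1 * D - 0 * C) = 2 * val z" "1 * D - 0 * C \<noteq> 0"
    using assms by (rule KZ_entries)
  note z = this[simplified]
  have "val z = 0" using z by (simp add: integral_iff_val val_mult val_inverse)
  then show "D \<in> UF" "C \<in> OF"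
    using z by (cases "C = 0"; simp add: unit_iff_val integral_iff_val val_mult val_inverse)+
qed

lemma g0_unique:
  assumes "\<mu> \<in> I n" "\<nu> \<in> I m" "\<kappa> \<in> KZ" "g0 n \<mu> ** \<kappa> = g0 m \<nu>"
  shows "n = m \<and> \<mu> = \<nu>"
proof -
  obtain a b c d where \<kappa>: "\<kappa> = mat2 a b c d" by (rule mat2_cases)
  have eq: "c = 0" "d = 1" "\<pi> ^ n * a = \<pi> ^ m" "\<pi> ^ n * b + \<mu> = \<nu>"
    using assms(4) by (auto simp: \<kappa> g0_def)
  have u: "a \<in> UF" "b \<in> OF" using upper_triangular_KZ assms(3) by (simp_all add: \<kappa> eq)
  have "val (\<pi> ^ n * a) = val (\<pi> ^ m)" using eq by simp
  then have nm: "n = m" using u(1) pi_nonzero by (simp add: val_mult val_power val_pi unit_iff_val)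
  have "\<nu> - \<mu> = \<pi> ^ n * b" using eq(4) by (simp add: algebra_simps)
  then have "F.odvd (\<pi> ^ n) (\<nu> - \<mu>)" using u(2) F.odvd_self_mult by simp
  then show ?thesis using I_unique[of \<nu> n \<mu>] assms nm by auto
qed

lemma g1_unique:
  assumes "\<mu> \<in> I n" "\<nu> \<in> I m" "\<kappa> \<in> KZ" "g1 n \<mu> ** \<kappa> = g1 m \<nu>"
  shows "n = m \<and> \<mu> = \<nu>"
proof -
  obtain a b c d where \<kappa>: "\<kappa> = mat2 a b c d" by (rule mat2_cases)
  have eq: "a = 1" "b = 0" "\<pi> ^ Suc n * d = \<pi> ^ Suc m" "\<pi> * \<mu> + \<pi> ^ Suc n * c = \<pi> * \<nu>"
    using assms(4) by (auto simp: \<kappa> g1_def)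
  have u: "d \<in> UF" "c \<in> OF" using lower_triangular_KZ assms(3) by (simp_all add: \<kappa> eq)
  have "val (\<pi> ^ Suc n * d) = val (\<pi> ^ Suc m)" using eq(3) by (simp only:)
  then have nm: "n = m" using u(1) pi_nonzero by (simp add: val_mult val_power val_pi unit_iff_val del: power_Suc)
  have "\<pi> * (\<nu> - \<mu>) = \<pi> * (\<pi> ^ n * c)" using eq(4) by (simp add: algebra_simps)
  then have "\<nu> - \<mu> = \<pi> ^ n * c" using pi_nonzero mult_left_cancel by blast
  then have "F.odvd (\<pi> ^ n) (\<nu> - \<mu>)" using u(2) F.odvd_self_mult by simp
  then show ?thesis using I_unique[of \<nu> n \<mu>] assms nm by auto
qed

text \<open>Comparing determinants would give \<open>n + 2 * val z = m + 1\<close>, while the upper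
  left entry of the element of \<open>KZ\<close> has valuation \<open>- n\<close> and forces
  \<open>val z \<le> - n\<close>; the left side would be at most 0.\<close>

lemma g0_neq_g1:
  assumes "\<mu> \<in> I n" "\<nu> \<in> I m" "\<kappa> \<in> KZ"
  shows "g0 n \<mu> ** \<kappa> \<noteq> g1 m \<nu>"
proof
  assume "g0 n \<mu> ** \<kappa> = g1 m \<nu>"
  obtain a b c d where \<kappa>: "\<kappa> = mat2 a b c d" by (rule mat2_cases)
  have eq: "c = \<pi> * \<nu>" "d = \<pi> ^ Suc m" "\<pi> ^ n * a + \<mu> * c = 1" "\<pi> ^ n * b + \<mu> * d = 0"
    using \<open>g0 n \<mu> ** \<kappa> = g1 m \<nu>\<close> by (auto simp: \<kappa> g0_def g1_def)
  obtain z where z: "z \<noteq> 0" "a * inverse z \<in> OF" "val (a * d - b * c) = 2 * val z"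
    using assms(3) unfolding \<kappa> by (rule KZ_entries)
  have "F.odvd \<pi> (\<mu> * c)" unfolding eq
    using I_integral assms by (intro F.odvd_mult2 F.odvd_self_mult)
  then have "1 - \<mu> * c \<in> UF"
    using F.odvd_add[of \<pi> "1 - \<mu> * c" "\<mu> * c"] not_pi_dvd_1 nonunit_iff[of "1 - \<mu> * c"]
      nonunit_iff[of "\<mu> * c"] F.integers_diff[OF F.integers_1] by fastforce
  then have "\<pi> ^ n * a \<in> UF" using eq(3) by (metis add_diff_cancel_right')
  then have a: "a \<noteq> 0" "val a = - int n"
    using pi_nonzero by (auto simp: unit_iff_val val_mult val_power val_pi)
  have na: "\<pi> ^ n * a = 1 - \<mu> * c" using eq(3) by (simp add: eq_diff_eq)
  have nb: "\<pi> ^ n * b = - (\<mu> * d)" using eq(4) by (simp add: eq_neg_iff_add_eq_0)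
  have "\<pi> ^ n * (a * d - b * c) = (\<pi> ^ n * a) * d - (\<pi> ^ n * b) * c"
    by (simp add: right_diff_distrib mult.assoc)
  also have "\<dots> = d" unfolding na nb by (simp add: algebra_simps)
  finally have "\<pi> ^ n * (a * d - b * c) = d" .
  then have "val (\<pi> ^ n * (a * d - b * c)) = int (Suc m)" "a * d - b * c \<noteq> 0"
    using pi_nonzero by (auto simp: eq(2) val_power val_pi simp del: power_Suc)
  then have "int n + 2 * val z = int (Suc m)"
    using z pi_nonzero by (simp add: val_mult val_power val_pi)
  moreover have "- int n - val z \<ge> 0"
    using z a by (simp add: integral_iff_val val_mult val_inverse)
  ultimately show False by simp
qed

lemma H0_H1_disjoint: "g \<in> H0 \<Longrightarrow> g \<notin> H1"
proof
  assume "g \<in> H0" "g \<in> H1"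
  then obtain n \<mu> \<kappa> m \<nu> l where *: "\<mu> \<in> I n" "\<kappa> \<in> KZ" "g = g0 n \<mu> ** \<kappa>" "\<nu> \<in> I m" "l \<in> KZ" "g = g1 m \<nu> ** l"
    unfolding H0_def H1_def by blast
  have "g0 n \<mu> ** (\<kappa> ** matrix_inv l) = g1 m \<nu>"
    using * G_cancel(3)[OF KZ_G[OF *(5)]] by (metis matrix_mul_assoc)
  then show False using g0_neq_g1 * KZ_mult KZ_matrix_inv by blast
qed

subsection \<open>The double coset of the Hecke operator\<close>

text \<open>The neighbours of the vertex \<open>gKZ\<close> of the tree are the \<open>gyKZ\<close> with \<open>y\<close> in \<open>Y\<close>.\<close>

definition Y :: "('f^2^2) set" where
  "Y = insert alpha (g0 1 ` I 1)"

text \<open>The support of \<open>psi\<close>: the matrices that move the base vertex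
  \<open>KZ\<close> to one of its neighbours.\<close>

definition Delta :: "('f^2^2) set" where
  "Delta = {\<kappa> ** matrix_inv alpha ** \<kappa>' | \<kappa> \<kappa>'. \<kappa> \<in> KZ \<and> \<kappa>' \<in> KZ}"

lemma alpha_eq_g1: "alpha = g1 0 0"
  by (simp add: alpha_def g1_def)

lemma finite_Y: "finite Y"
  by (simp add: Y_def finite_I)

lemma Y_cases:
  assumes "y \<in> Y"
  obtains "y = g1 0 0" | \<mu> where "\<mu> \<in> I 1" "y = g0 1 \<mu>"
  using assms unfolding Y_def alpha_eq_g1 by blast

lemma Y_G: "y \<in> Y \<Longrightarrow> y \<in> G"
  by (auto elim!: Y_cases simp: g0_G g1_G)

lemma Y_integral: "y \<in> Y \<Longrightarrow> y $ i $ j \<in> OF"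
proof -
  have "\<forall>i j. y $ i $ j \<in> OF" if "y \<in> Y"
    using that
    by (cases rule: Y_cases) (simp_all add: g0_def g1_def forall_2 F.integers_closed pi_integral I_integral)
  then show "y \<in> Y \<Longrightarrow> y $ i $ j \<in> OF" by blast
qed

lemma val_det_Y: "y \<in> Y \<Longrightarrow> val (det y) = 1"
  by (auto elim!: Y_cases simp: g0_def g1_def val_pi)

lemma Y_distinct:
  assumes "y \<in> Y" "y' \<in> Y" "\<kappa> \<in> KZ" "y ** \<kappa> = y'"
  shows "y = y'"
proof -
  have 0: "(0::'f) \<in> I 0" by (simp add: I_0)
  have inv: "y' ** matrix_inv \<kappa> = y"
    unfolding assms(4)[symmetric] by (rule G_cancel(3)[OF KZ_G[OF assms(3)]])
  show ?thesis
    using assms(1)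
  proof (cases rule: Y_cases)
    case y: 1
    show ?thesis
      using assms(2)
    proof (cases rule: Y_cases)
      case 1
      then show ?thesis using y by simp
    next
      case (2 \<mu>)
      then show ?thesis using g0_neq_g1[OF 2(1) 0 KZ_matrix_inv[OF assms(3)]] inv y by simp
    qed
  next
    case y: (2 \<mu>)
    show ?thesis
      using assms(2)
    proof (cases rule: Y_cases)
      case 1
      then show ?thesis using g0_neq_g1[OF y(1) 0 assms(3)] assms(4) y by simp
    next
      case (2 \<nu>)
      then show ?thesis using g0_unique[OF y(1) 2(1) assms(3)] assms(4) y by simp
    qed
  qed
qed

lemma Delta_left: "\<kappa> \<in> KZ \<Longrightarrow> g \<in> Delta \<Longrightarrow> \<kappa> ** g \<in> Delta"
  unfolding Delta_def using KZ_mult by (force simp: matrix_mul_assoc)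

lemma Delta_right: "\<kappa> \<in> KZ \<Longrightarrow> g \<in> Delta \<Longrightarrow> g ** \<kappa> \<in> Delta"
  unfolding Delta_def using KZ_mult by (force simp: matrix_mul_assoc[symmetric])

lemma Delta_G: "g \<in> Delta \<Longrightarrow> g \<in> G"
  unfolding Delta_def using KZ_G G_mult G_matrix_inv[OF alpha_G] by blast

abbreviation w :: "'f^2^2" where "w \<equiv> mat2 0 1 1 0"

lemma w_KZ: "w \<in> KZ"
  by (intro K_KZ) (simp add: K_mat2 F.integers_closed unit_uminus unit_1)

text \<open>\<open>alpha\<close> and its inverse differ by a scalar and the Weyl element
  \<open>w\<close> on both sides. Hence \<open>Delta\<close> is closed under inversion: being
  neighbours is symmetric.\<close>

lemma alpha_Delta: "alpha \<in> Delta"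
proof -
  have "alpha = (mat \<pi> ** w) ** matrix_inv alpha ** w"
    unfolding matrix_inv_alpha by (simp add: alpha_def mat_eq_mat2 pi_nonzero)
  then show ?thesis
    unfolding Delta_def using KZ_mult[OF mat_KZ[OF pi_nonzero] w_KZ] w_KZ by blast
qed

lemma Y_Delta: "y \<in> Y \<Longrightarrow> y \<in> Delta"
proof (erule Y_cases)
  assume "y = g1 0 0"
  then show ?thesis using alpha_Delta by (simp add: alpha_eq_g1)
next
  fix \<mu> assume \<mu>: "\<mu> \<in> I 1" "y = g0 1 \<mu>"
  have "mat2 1 \<mu> 0 1 \<in> KZ"
    using I_integral[OF \<mu>(1)] by (intro K_KZ) (simp add: K_mat2 F.integers_closed unit_1)
  moreover have "y = mat2 1 \<mu> 0 1 ** matrix_inv alpha ** mat \<pi>"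
    by (simp add: \<mu> g0_def matrix_inv_alpha mat_eq_mat2 pi_nonzero)
  ultimately show ?thesis unfolding Delta_def using mat_KZ[OF pi_nonzero] by blast
qed

lemma Delta_inv: "g \<in> Delta \<Longrightarrow> matrix_inv g \<in> Delta"
proof -
  assume "g \<in> Delta"
  then obtain \<kappa> \<kappa>' where \<kappa>: "\<kappa> \<in> KZ" "\<kappa>' \<in> KZ" "g = \<kappa> ** matrix_inv alpha ** \<kappa>'" unfolding Delta_def by blast
  have "matrix_inv g = matrix_inv \<kappa>' ** (alpha ** matrix_inv \<kappa>)"
    unfolding \<kappa>(3) using \<kappa> KZ_G alpha_G
    by (simp add: matrix_inv_mult G_mult G_matrix_inv matrix_inv_matrix_inv)
  then show ?thesis using Delta_left Delta_right alpha_Delta KZ_matrix_inv \<kappa> by metis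
qed

text \<open>Up to right multiplication by \<open>KZ\<close>, \<open>g\<close> is a primitive matrix
  with determinant of valuation 1. The representatives \<open>g0 n \<mu>\<close> and
  \<open>g1 n \<mu>\<close> have determinants of valuation \<open>n\<close> and
  \<open>n + 1\<close>, so only those in \<open>Y\<close> qualify.\<close>

lemma Delta_Y: "g \<in> Delta \<Longrightarrow> \<exists>y\<in>Y. \<exists>\<kappa>\<in>KZ. g = y ** \<kappa>"
proof -
  assume "g \<in> Delta"
  then obtain \<kappa> \<kappa>' where \<kappa>: "\<kappa> \<in> KZ" "\<kappa>' \<in> KZ" "g = \<kappa> ** matrix_inv alpha ** \<kappa>'" unfolding Delta_def by blast
  obtain z k where k: "z \<noteq> 0" "k \<in> K" "\<kappa> = mat z ** k" using \<kappa>(1) unfolding KZ_iff by blast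
  obtain a b c d where abcd: "k = mat2 a b c d" by (rule mat2_cases)
  have O: "a \<in> OF" "b \<in> OF" "c \<in> OF" "d \<in> OF" and u: "a * d - b * c \<in> UF"
    using k(2) by (simp_all add: abcd K_mat2)
  \<comment> \<open>\<open>k ** matrix_inv alpha\<close> cleared of its denominator \<pi>.\<close>
  define h where "h = mat2 (\<pi> * a) b (\<pi> * c) d"
  have "\<kappa> ** matrix_inv alpha = h ** mat (z * inverse \<pi>)"
    by (simp add: k(3) abcd h_def matrix_inv_alpha mat_eq_mat2 pi_nonzero algebra_simps)
  then have g: "g = h ** (mat (z * inverse \<pi>) ** \<kappa>')" by (simp add: \<kappa>(3) matrix_mul_assoc)
  have l: "mat (z * inverse \<pi>) ** \<kappa>' \<in> KZ" using k(1) pi_nonzero \<kappa>(2) by (intro KZ_mult mat_KZ) auto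
  have ud: "b \<in> UF \<or> d \<in> UF"
  proof (rule ccontr)
    assume "\<not> ?thesis"
    then have "F.odvd \<pi> b" "F.odvd \<pi> d" using O nonunit_iff by auto
    then have "F.odvd \<pi> (a * d - b * c)" using O by (intro F.odvd_diff F.odvd_mult F.odvd_mult2)
    then show False using u nonunit_iff by blast
  qed
  have deth: "det h = \<pi> * (a * d - b * c)" by (simp add: h_def algebra_simps)
  have valh: "val (det h) = 1" "det h \<noteq> 0"
    using u pi_nonzero unfolding deth by (simp_all add: unit_iff_val val_mult val_pi)
  have det: "\<pi> * a * d - b * (\<pi> * c) \<noteq> 0" using valh(2) by (simp add: h_def)
  have "(\<exists>n. \<exists>\<mu>\<in>I n. \<exists>\<kappa>\<in>K. h = g0 n \<mu> ** \<kappa>) \<or> (\<exists>n. \<exists>\<mu>\<in>I n. \<exists>\<kappa>\<in>K. h = g1 n \<mu> ** \<kappa>)"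
    unfolding h_def using O ud det pi_integral
    by (intro primitive_vertex) (auto intro: F.integers_add_mult)
  then have "\<exists>y\<in>Y. \<exists>\<kappa>\<in>K. h = y ** \<kappa>"
  proof
    assume "\<exists>n. \<exists>\<mu>\<in>I n. \<exists>\<kappa>\<in>K. h = g0 n \<mu> ** \<kappa>"
    then obtain n \<mu> l where l: "\<mu> \<in> I n" "l \<in> K" "h = g0 n \<mu> ** l" by blast
    have "val (det h) = int n"
      unfolding l(3) det_mul using l(2) pi_nonzero by (simp add: g0_def K_iff unit_iff_val val_mult val_power val_pi)
    then have "n = 1" using valh by simp
    then show ?thesis using l unfolding Y_def by blast
  next
    assume "\<exists>n. \<exists>\<mu>\<in>I n. \<exists>\<kappa>\<in>K. h = g1 n \<mu> ** \<kappa>"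
    then obtain n \<mu> l where l: "\<mu> \<in> I n" "l \<in> K" "h = g1 n \<mu> ** l" by blast
    have "val (det h) = int (Suc n)"
      unfolding l(3) det_mul using l(2) pi_nonzero
      by (simp add: g1_def K_iff unit_iff_val val_mult val_power val_pi)
    then have "n = 0" using valh by simp
    then show ?thesis using l unfolding Y_def alpha_eq_g1 by (auto simp: I_0)
  qed
  then obtain y m where "y \<in> Y" "m \<in> K" "h = y ** m" by blast
  then show ?thesis using g l K_KZ KZ_mult by (metis matrix_mul_assoc)
qed

subsection \<open>Neighbours in the two halves of the tree\<close>

lemma upper_triangular_H0: "a \<in> OF \<Longrightarrow> b \<in> OF \<Longrightarrow> a \<noteq> 0 \<Longrightarrow> mat2 a b 0 1 \<in> H0"
  using upper_triangular_vertex K_vertex_H0 by blast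

text \<open>For \<open>n > 0\<close>, \<open>alpha\<close> leads one step back towards the base
  vertex once a scalar \<pi> is removed, and the other elements of \<open>Y\<close> lead one step
  away. For \<open>n = 0\<close> the step \<open>alpha\<close> would enter the other half.\<close>

lemma H0_neighbour:
  assumes "n > 0" "\<mu> \<in> I n" "y \<in> Y"
  shows "g0 n \<mu> ** y \<in> H0"
  using assms(3)
proof (cases rule: Y_cases)
  case 1
  obtain m where m: "n = Suc m" using assms(1) by (cases n) auto
  have "g0 n \<mu> ** y = mat \<pi> ** mat2 (\<pi> ^ m) \<mu> 0 1"
    by (simp add: 1 g0_def g1_def mat_eq_mat2 m mult.commute)
  then show ?thesis
    using pi_nonzero I_integral[OF assms(2)]
    by (simp add: H0_scale_iff upper_triangular_H0 F.integers_power pi_integral)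
next
  case (2 \<nu>)
  have "g0 n \<mu> ** y = mat2 (\<pi> ^ n * \<pi>) (\<pi> ^ n * \<nu> + \<mu>) 0 1"
    by (simp add: 2 g0_def)
  then show ?thesis
    using pi_nonzero I_integral[OF assms(2)] I_integral[OF 2(1)]
    by (simp add: upper_triangular_H0 F.integers_closed pi_integral)
qed

text \<open>Here the step back is the one with \<nu> divisible by \<pi>, where a scalar \<pi> can be
  removed. For \<open>alpha\<close> and for a unit \<nu> the product already has a unit in the top
  row and a bottom row divisible by \<pi>.\<close>

lemma H1_neighbour:
  assumes "n > 0" "\<mu> \<in> I n" "y \<in> Y"
  shows "g1 n \<mu> ** y \<in> H1"
proof -
  have \<mu>: "\<mu> \<in> OF" using I_integral assms(2) .
  obtain m where m: "n = Suc m" using assms(1) by (cases n) auto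
  have pd: "F.odvd \<pi> (\<pi> * x)" if "x \<in> OF" for x using that by (rule F.odvd_self_mult)
  show ?thesis
    using assms(3)
  proof (cases rule: Y_cases)
    case 1
    have "g1 n \<mu> ** y = mat2 1 0 (\<pi> * \<mu>) (\<pi> * \<pi> ^ Suc n)"
      by (simp add: 1 g1_def algebra_simps)
    moreover have "\<dots> \<in> H1"
      using \<mu> pi_nonzero pi_integral
      by (intro K_vertex_H1 lower_triangular_vertex pd) (auto intro!: F.integers_closed)
    ultimately show ?thesis by simp
  next
    case (2 \<nu>)
    have \<nu>: "\<nu> \<in> OF" using I_integral 2(1) .
    show ?thesis
    proof (cases "\<nu> \<in> UF")
      case True
      have "g1 n \<mu> ** y = mat2 \<pi> \<nu> (\<pi> * (\<mu> * \<pi>)) (\<pi> * (\<mu> * \<nu> + \<pi> ^ n))"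
        by (simp add: 2 g0_def g1_def algebra_simps)
      moreover have "\<dots> \<in> H1"
        using \<mu> \<nu> pi_nonzero pi_integral True
        by (intro K_vertex_H1 top_row_unit_vertex pd) (auto intro!: F.integers_closed simp: algebra_simps)
      ultimately show ?thesis by simp
    next
      case False
      then have "F.odvd \<pi> \<nu>" using \<nu> nonunit_iff by blast
      then obtain l where l: "l \<in> OF" "\<nu> = \<pi> * l" unfolding F.odvd_def by blast
      have "g1 n \<mu> ** y = mat \<pi> ** mat2 1 l (\<pi> * \<mu>) (\<pi> * (\<mu> * l + \<pi> ^ m))"
        by (simp add: 2 l g0_def g1_def mat_eq_mat2 m algebra_simps)
      moreover have "mat2 1 l (\<pi> * \<mu>) (\<pi> * (\<mu> * l + \<pi> ^ m)) \<in> H1"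
        using \<mu> l pi_nonzero pi_integral unit_1
        by (intro K_vertex_H1 top_row_unit_vertex pd) (auto intro!: F.integers_closed simp: algebra_simps)
      ultimately show ?thesis using pi_nonzero by (simp add: H1_scale_iff)
    qed
  qed
qed

text \<open>The flip of the central edge: \<open>beta\<close> moves the vertex of the identity to
  that of \<open>alpha\<close> and back.\<close>

abbreviation beta :: "'f^2^2" where "beta \<equiv> mat2 0 1 \<pi> 0"

lemma beta_G: "beta \<in> G"
  by (simp add: G_iff_det pi_nonzero)

lemma beta_g0: "beta ** g0 n \<mu> = g1 n \<mu> ** w"
  by (simp add: g0_def g1_def algebra_simps)

lemma beta_g1: "beta ** g1 n \<mu> = g0 n \<mu> ** (mat \<pi> ** w)"
  by (simp add: g0_def g1_def mat_eq_mat2 algebra_simps)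

end

section \<open>Substitution in polynomials\<close>

abbreviation lk where "lk \<equiv> Poly_Mapping.lookup"
abbreviation ky where "ky \<equiv> Poly_Mapping.keys"
abbreviation sg where "sg \<equiv> Poly_Mapping.single"

definition mono_subst :: "('s xy_var \<Rightarrow> ('s, 'c::comm_ring_1) mvpoly) \<Rightarrow> ('s xy_var \<Rightarrow>\<^sub>0 nat) \<Rightarrow> ('s, 'c) mvpoly" where
  "mono_subst L m = (\<Prod>z\<in>ky m. L z ^ lk m z)"

lemma mv_subst_eq: "mv_subst L P = (\<Sum>m\<in>ky P. mv_const (lk P m) * mono_subst L m)"
  by (simp add: mv_subst_def mono_subst_def)

lemma mv_const_0: "mv_const 0 = 0" and mv_const_1: "mv_const 1 = 1"
  by (simp_all add: mv_const_def)

lemma mv_const_add: "mv_const (a + b) = mv_const a + mv_const b"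
  by (simp add: mv_const_def single_add)

lemma mv_const_uminus: "mv_const (- a) = - mv_const a"
  by (simp add: mv_const_def single_uminus)

lemma mv_const_mult: "mv_const (a * b) = mv_const a * mv_const b"
  by (simp add: mv_const_def mult_single)

lemma mv_const_single: "mv_const a * sg m b = sg m (a * b)"
  by (simp add: mv_const_def mult_single)

lemma lookup_mv_const_mult: "lk (mv_const a * P) m = a * lk P m"
  for a :: "'c::comm_ring_1" and P :: "('s, 'c) mvpoly"
proof (cases "a = 0")
  case False
  have "mv_const a * P = Poly_Mapping.map ((*) a) P"
    unfolding mv_const_def by (rule mult_map_scale_conv_mult[symmetric])
  then show ?thesis by (simp add: map.rep_eq when_def)
qed (simp add: mv_const_0)

lemma mvpoly_sum_single: "P = (\<Sum>m\<in>ky P. sg m (lk P m))"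
  by (rule poly_mapping_eqI) (simp add: lookup_sum lookup_single when_def in_keys_iff)

lemma mono_subst_superset:
  assumes "finite A" "ky m \<subseteq> A"
  shows "mono_subst L m = (\<Prod>z\<in>A. L z ^ lk m z)"
  unfolding mono_subst_def
  by (rule prod.mono_neutral_left) (use assms in \<open>auto simp: in_keys_iff\<close>)

lemma mono_subst_add: "mono_subst L (m + n) = mono_subst L m * mono_subst L n"
proof -
  let ?A = "ky m \<union> ky n"
  have "ky (m + n) \<subseteq> ?A" by (rule Poly_Mapping.keys_add)
  then show ?thesis
    by (simp add: mono_subst_superset[of ?A] lookup_add power_add prod.distrib)
qed

lemma mono_subst_0: "mono_subst L 0 = 1"
  by (simp add: mono_subst_def)

lemma mv_subst_superset:
  assumes "finite A" "ky P \<subseteq> A"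
  shows "mv_subst L P = (\<Sum>m\<in>A. mv_const (lk P m) * mono_subst L m)"
  unfolding mv_subst_eq
  by (rule sum.mono_neutral_left) (use assms in \<open>auto simp: in_keys_iff mv_const_0\<close>)

lemma mv_subst_add: "mv_subst L (P + Q) = mv_subst L P + mv_subst L Q"
proof -
  let ?A = "ky P \<union> ky Q"
  have "ky (P + Q) \<subseteq> ?A" by (rule Poly_Mapping.keys_add)
  then show ?thesis
    by (simp add: mv_subst_superset[of ?A] lookup_add mv_const_add distrib_right sum.distrib)
qed

lemma mv_subst_0: "mv_subst L 0 = 0"
  by (simp add: mv_subst_eq)

lemma mv_subst_sum: "mv_subst L (\<Sum>i\<in>A. f i) = (\<Sum>i\<in>A. mv_subst L (f i))"
  by (induction A rule: infinite_finite_induct) (simp_all add: mv_subst_0 mv_subst_add)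

lemma mv_subst_single: "mv_subst L (sg m c) = mv_const c * mono_subst L m"
  by (subst mv_subst_superset[of "{m}"]) auto

lemma mv_subst_mult: "mv_subst L (P * Q) = mv_subst L P * mv_subst L Q"
proof -
  have "P * Q = (\<Sum>m\<in>ky P. \<Sum>n\<in>ky Q. sg (m + n) (lk P m * lk Q n))"
    by (subst mvpoly_sum_single[of P], subst mvpoly_sum_single[of Q])
      (simp add: sum_product mult_single)
  then have "mv_subst L (P * Q)
    = (\<Sum>m\<in>ky P. \<Sum>n\<in>ky Q. (mv_const (lk P m) * mono_subst L m) * (mv_const (lk Q n) * mono_subst L n))"
    by (simp add: mv_subst_sum mv_subst_single mv_const_mult mono_subst_add mult_ac)
  also have "\<dots> = mv_subst L P * mv_subst L Q"
    unfolding mv_subst_eq by (rule sum_product[symmetric])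
  finally show ?thesis .
qed

lemma mv_subst_const: "mv_subst L (mv_const c) = mv_const c"
  unfolding mv_const_def by (simp add: mv_subst_single mono_subst_0) (simp add: mv_const_def)

lemma mv_subst_1: "mv_subst L 1 = 1"
  using mv_subst_const[of L 1] by (simp add: mv_const_1)

lemma mv_subst_power: "mv_subst L (P ^ n) = mv_subst L P ^ n"
  by (induction n) (simp_all add: mv_subst_1 mv_subst_mult)

lemma mv_subst_prod: "mv_subst L (\<Prod>i\<in>A. f i) = (\<Prod>i\<in>A. mv_subst L (f i))"
  by (induction A rule: infinite_finite_induct) (simp_all add: mv_subst_1 mv_subst_mult)

lemma mv_subst_var: "mv_subst L (mv_var z) = L z"
  by (simp add: mv_var_def mv_subst_single mono_subst_def mv_const_1)

lemma mv_subst_subst: "mv_subst L (mv_subst M P) = mv_subst (\<lambda>z. mv_subst L (M z)) P"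
  by (simp add: mv_subst_eq[of M P] mv_subst_eq[of _ P] mv_subst_sum mv_subst_mult mv_subst_const
      mono_subst_def mv_subst_prod mv_subst_power)

lemma mv_subst_cong:
  assumes "\<And>m z. m \<in> ky P \<Longrightarrow> z \<in> ky m \<Longrightarrow> L z = M z"
  shows "mv_subst L P = mv_subst M P"
  unfolding mv_subst_def using assms by (intro sum.cong prod.cong arg_cong2[of _ _ _ _ "(*)"]) auto

lemma mv_var_power: "mv_var z ^ n = sg (sg z n) 1"
  by (induction n) (simp_all add: mv_var_def mult_single flip: single_add)

lemma prod_single: "(\<Prod>i\<in>A. sg (m i) (1 :: 'c::comm_ring_1)) = sg (\<Sum>i\<in>A. m i) 1"
  by (induction A rule: infinite_finite_induct) (simp_all add: mult_single)

subsection \<open>Multihomogeneous polynomials with coefficients in a subring\<close>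

definition wt :: "('s xy_var \<Rightarrow>\<^sub>0 nat) \<Rightarrow> 's \<Rightarrow> nat" where
  "wt m s = lk m (VX s) + lk m (VY s)"

definition subring :: "'c::comm_ring_1 set \<Rightarrow> bool" where
  "subring R \<longleftrightarrow> 0 \<in> R \<and> 1 \<in> R \<and> (\<forall>x\<in>R. \<forall>y\<in>R. x + y \<in> R \<and> x * y \<in> R)"

text \<open>The coefficient ring is a parameter so that one proof serves both \<open>V\<close>, with
  \<open>R = UNIV\<close>, and the lattice \<open>V0\<close>, with \<open>R\<close> the integers of
  C.\<close>

definition homog :: "'c::comm_ring_1 set \<Rightarrow> ('s \<Rightarrow> nat) \<Rightarrow> ('s, 'c) mvpoly set" where
  "homog R k = {P. (\<forall>m\<in>ky P. wt m = k) \<and> (\<forall>m. lk P m \<in> R)}"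

lemma wt_add: "wt (m + n) = (\<lambda>s. wt m s + wt n s)"
  by (simp add: wt_def lookup_add fun_eq_iff)

lemma homog_0: "subring R \<Longrightarrow> 0 \<in> homog R k"
  by (simp add: homog_def subring_def)

lemma homog_add: "subring R \<Longrightarrow> P \<in> homog R k \<Longrightarrow> Q \<in> homog R k \<Longrightarrow> P + Q \<in> homog R k"
  unfolding homog_def subring_def using Poly_Mapping.keys_add[of P Q] by (auto simp: lookup_add)

lemma homog_sum: "subring R \<Longrightarrow> (\<And>i. i \<in> A \<Longrightarrow> f i \<in> homog R k) \<Longrightarrow> sum f A \<in> homog R k"
  by (induction A rule: infinite_finite_induct) (simp_all add: homog_0 homog_add)

lemma homog_single: "subring R \<Longrightarrow> c \<in> R \<Longrightarrow> wt m = k \<Longrightarrow> sg m c \<in> homog R k"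
  by (simp add: homog_def subring_def lookup_single when_def)

lemma homog_scale: "subring R \<Longrightarrow> c \<in> R \<Longrightarrow> P \<in> homog R k \<Longrightarrow> mv_const c * P \<in> homog R k"
  unfolding homog_def by (auto simp: lookup_mv_const_mult in_keys_iff subring_def)

lemma homog_mult:
  assumes "subring R" "P \<in> homog R k" "Q \<in> homog R l"
  shows "P * Q \<in> homog R (\<lambda>s. k s + l s)"
proof -
  have "P * Q = (\<Sum>m\<in>ky P. \<Sum>n\<in>ky Q. sg (m + n) (lk P m * lk Q n))"
    by (subst mvpoly_sum_single[of P], subst mvpoly_sum_single[of Q])
      (simp add: sum_product mult_single)
  also have "\<dots> \<in> homog R (\<lambda>s. k s + l s)"
    using assms by (intro homog_sum homog_single) (auto simp: homog_def wt_add subring_def)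
  finally show ?thesis .
qed

lemma homog_1: "subring R \<Longrightarrow> 1 \<in> homog R (\<lambda>_. 0)"
  unfolding single_one[symmetric] by (rule homog_single) (auto simp: subring_def wt_def fun_eq_iff)

lemma homog_power: "subring R \<Longrightarrow> P \<in> homog R k \<Longrightarrow> P ^ n \<in> homog R (\<lambda>s. n * k s)"
  by (induction n) (auto simp: homog_1 dest: homog_mult)

lemma homog_prod:
  "subring R \<Longrightarrow> (\<And>i. i \<in> A \<Longrightarrow> f i \<in> homog R (k i)) \<Longrightarrow> prod f A \<in> homog R (\<lambda>s. \<Sum>i\<in>A. k i s)"
  by (induction A rule: infinite_finite_induct) (auto simp: homog_1 dest: homog_mult)

primrec index :: "'s xy_var \<Rightarrow> 's" where
  "index (VX s) = s" | "index (VY s) = s"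

lemma sum_index_eq_wt:
  assumes "finite A" "ky m \<subseteq> A"
  shows "(\<Sum>z\<in>A. lk m z * (if index z = s then 1 else 0)) = wt m s"
proof -
  have "(\<Sum>z\<in>A. lk m z * (if index z = s then 1 else 0))
      = (\<Sum>z\<in>A \<union> {VX s, VY s}. lk m z * (if index z = s then 1 else 0))"
    using assms by (intro sum.mono_neutral_left) (auto simp: in_keys_iff)
  also have "\<dots> = (\<Sum>z\<in>{VX s, VY s}. lk m z * (if index z = s then 1 else 0))"
  proof (rule sum.mono_neutral_right)
    show "\<forall>z\<in>A \<union> {VX s, VY s} - {VX s, VY s}. lk m z * (if index z = s then 1 else 0) = 0"
    proof
      fix z assume "z \<in> A \<union> {VX s, VY s} - {VX s, VY s}"
      then show "lk m z * (if index z = s then 1 else 0) = 0" by (cases z) auto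
    qed
  qed (use assms in auto)
  also have "\<dots> = wt m s" by (simp add: wt_def)
  finally show ?thesis .
qed

text \<open>Assumption \<open>L\<close> is restricted to indices of positive degree because the
  variables are indexed by all maps from F to C, and outside \<open>S\<close> these may respect
  neither addition nor integrality.\<close>

lemma homog_subst:
  assumes R: "subring R" and P: "P \<in> homog R k"
    and L: "\<And>z. k (index z) \<noteq> 0 \<Longrightarrow> L z \<in> homog R (\<lambda>s. if index z = s then 1 else 0)"
  shows "mv_subst L P \<in> homog R k"
  unfolding mv_subst_eq
proof (rule homog_sum[OF R])
  fix m assume m: "m \<in> ky P"
  then have wt: "wt m = k" and c: "lk P m \<in> R" using P by (auto simp: homog_def)
  have "mono_subst L m \<in> homog R (\<lambda>s. \<Sum>z\<in>ky m. lk m z * (if index z = s then 1 else 0))"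
    unfolding mono_subst_def
  proof (rule homog_prod[OF R], rule homog_power[OF R], rule L)
    fix z assume "z \<in> ky m"
    then have "wt m (index z) \<noteq> 0" by (cases z) (auto simp: wt_def in_keys_iff)
    then show "k (index z) \<noteq> 0" using wt by simp
  qed
  then have "mono_subst L m \<in> homog R k"
    using sum_index_eq_wt[of "ky m" m] wt by (simp add: fun_eq_iff)
  then show "mv_const (lk P m) * mono_subst L m \<in> homog R k" by (rule homog_scale[OF R c])
qed

section \<open>The representation and the kernel of the Hecke operator\<close>

context gl2_setup
begin

text \<open>The number of embeddings equals the degree, which is positive; infinite sets have
  cardinality 0 by convention.\<close>

lemma finite_S: "finite S"
proof -
  obtain b where b: "F.vs.independent b" "UNIV \<subseteq> F.vs.span b" "card b = F.vs.dim UNIV"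
    by (rule F.vs.basis_exists[of UNIV])
  obtain c where c: "finite c" "F.vs.span c = UNIV" using F.finite_spanning_set by blast
  have fin: "finite b" using F.vs.independent_span_bound[OF c(1) b(1)] c(2) by simp
  have "b \<noteq> {}"
  proof
    assume "b = {}"
    then have "UNIV \<subseteq> {0 :: 'f}" using b(2) by simp
    then have "(1::'f) \<in> {0}" by (rule subsetD) (rule UNIV_I)
    then show False by simp
  qed
  then have "card b > 0" using fin by (simp add: card_gt_0_iff)
  then have "card S > 0" using card_homs b(3) unfolding extension_degree_def by simp
  then show ?thesis by (simp add: card_gt_0_iff)
qed

lemma S_hom: "\<sigma> \<in> S \<Longrightarrow> field_hom \<sigma>"
  by (simp add: algebra_homs_def)

lemma S_0: "\<sigma> \<in> S \<Longrightarrow> \<sigma> 0 = 0" and S_1: "\<sigma> \<in> S \<Longrightarrow> \<sigma> 1 = 1"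
  and S_add: "\<sigma> \<in> S \<Longrightarrow> \<sigma> (x + y) = \<sigma> x + \<sigma> y" and S_mult: "\<sigma> \<in> S \<Longrightarrow> \<sigma> (x * y) = \<sigma> x * \<sigma> y"
  and S_inverse: "\<sigma> \<in> S \<Longrightarrow> \<sigma> (inverse x) = inverse (\<sigma> x)"
  and S_eq_0_iff: "\<sigma> \<in> S \<Longrightarrow> \<sigma> x = 0 \<longleftrightarrow> x = 0"
  and S_power: "\<sigma> \<in> S \<Longrightarrow> \<sigma> (x ^ n) = \<sigma> x ^ n"
proof -
  assume "\<sigma> \<in> S"
  then interpret h: field_hom \<sigma> by (rule S_hom)
  show "\<sigma> 0 = 0" "\<sigma> 1 = 1" "\<sigma> (x + y) = \<sigma> x + \<sigma> y" "\<sigma> (x * y) = \<sigma> x * \<sigma> y"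
    "\<sigma> (inverse x) = inverse (\<sigma> x)" "\<sigma> x = 0 \<longleftrightarrow> x = 0" "\<sigma> (x ^ n) = \<sigma> x ^ n"
    by (simp_all add: hom_distribs)
qed

lemma S_powi: "\<sigma> \<in> S \<Longrightarrow> \<sigma> (x powi n) = \<sigma> x powi n"
  by (simp add: power_int_def S_power S_inverse flip: power_inverse)

lemma S_integral: "\<sigma> \<in> S \<Longrightarrow> x \<in> OF \<Longrightarrow> \<sigma> x \<in> OC"
proof -
  assume \<sigma>: "\<sigma> \<in> S" and x: "x \<in> OF"
  interpret h: field_hom \<sigma> using \<sigma> by (rule S_hom)
  obtain P where P: "lead_coeff P = 1" "poly (map_poly F.zp P) x = 0" using x F.integers_iff by blast
  have "\<sigma> (F.zp z) = C.zp z" for z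
    using \<sigma> unfolding algebra_homs_def F.zp_def C.zp_def by simp
  then have eq: "map_poly \<sigma> (map_poly F.zp P) = map_poly C.zp P"
    by (subst map_poly_map_poly) (auto simp: o_def)
  have "poly (map_poly \<sigma> (map_poly F.zp P)) (\<sigma> x) = \<sigma> (poly (map_poly F.zp P) x)"
    by (rule h.poly_map_poly)
  then show ?thesis unfolding C.integers_iff using P eq by auto
qed

lemma S_unit: "\<sigma> \<in> S \<Longrightarrow> x \<in> UF \<Longrightarrow> \<sigma> x \<in> OC"
  using S_integral unit_iff by blast

lemma rt_nonzero: "\<sigma> \<in> S \<Longrightarrow> rt \<sigma> \<noteq> 0"
  using square_roots[of \<sigma>] pi_nonzero S_eq_0_iff[of \<sigma> \<pi>] by auto

lemma subring_UNIV: "subring UNIV" and subring_OC: "subring OC"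
  by (simp_all add: subring_def C.integers_closed)

text \<open>Weights are functions on all maps from F to C; truncation outside \<open>S\<close>
  excludes the variables with other indices from \<open>homog R (restr k)\<close>.\<close>

definition restr :: "('f, 'c) weight \<Rightarrow> ('f, 'c) weight" where
  "restr k \<sigma> = (if \<sigma> \<in> S then k \<sigma> else 0)"

definition expo :: "('f, 'c) weight \<Rightarrow> ('f, 'c) weight \<Rightarrow> (('f \<Rightarrow> 'c) xy_var \<Rightarrow>\<^sub>0 nat)" where
  "expo k i = (\<Sum>\<sigma>\<in>S. sg (VX \<sigma>) (k \<sigma> - i \<sigma>) + sg (VY \<sigma>) (i \<sigma>))"

lemma lookup_expo:
  "lk (expo k i) (VX \<sigma>) = restr (\<lambda>\<sigma>. k \<sigma> - i \<sigma>) \<sigma>" "lk (expo k i) (VY \<sigma>) = restr i \<sigma>"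
  unfolding expo_def restr_def using finite_S
  by (simp_all add: lookup_sum lookup_add lookup_single when_def)

lemma monom_tensor_eq: "monom_tensor k i = sg (expo k i) 1"
  unfolding monom_tensor_def expo_def
  by (simp add: mv_var_power mult_single prod_single)

lemma mv_const_monom_tensor: "mv_const c * monom_tensor k i = sg (expo k i) c"
  by (simp add: monom_tensor_eq mv_const_single)

lemma expo_inj:
  assumes "i \<in> PiE S (\<lambda>\<sigma>. {..k \<sigma>})" "j \<in> PiE S (\<lambda>\<sigma>. {..k \<sigma>})" "expo k i = expo k j"
  shows "i = j"
proof (rule PiE_ext[OF assms(1,2)])
  fix \<sigma> assume "\<sigma> \<in> S"
  then show "i \<sigma> = j \<sigma>" using arg_cong[OF assms(3), of "\<lambda>m. lk m (VY \<sigma>)"] by (simp add: lookup_expo restr_def)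
qed

lemma wt_expo: "i \<in> PiE S (\<lambda>\<sigma>. {..k \<sigma>}) \<Longrightarrow> wt (expo k i) = restr k"
proof
  fix \<sigma> assume "i \<in> PiE S (\<lambda>\<sigma>. {..k \<sigma>})"
  then show "wt (expo k i) \<sigma> = restr k \<sigma>"
    by (cases "\<sigma> \<in> S") (auto simp: wt_def lookup_expo restr_def dest: PiE_mem)
qed

lemma expo_surj:
  assumes "wt m = restr k"
  shows "\<exists>i\<in>PiE S (\<lambda>\<sigma>. {..k \<sigma>}). m = expo k i"
proof
  let ?i = "restrict (\<lambda>\<sigma>. lk m (VY \<sigma>)) S"
  have wt: "lk m (VX \<sigma>) + lk m (VY \<sigma>) = (if \<sigma> \<in> S then k \<sigma> else 0)" for \<sigma>
    using fun_cong[OF assms, of \<sigma>] by (simp add: wt_def restr_def)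
  show "?i \<in> PiE S (\<lambda>\<sigma>. {..k \<sigma>})" using wt by (auto simp: PiE_iff) (metis le_add2)
  show "m = expo k ?i"
  proof (rule poly_mapping_eqI)
    fix z
    show "lk m z = lk (expo k ?i) z"
    proof (cases z)
      case (VX \<sigma>)
      then show ?thesis using wt[of \<sigma>] by (cases "\<sigma> \<in> S") (auto simp: lookup_expo restr_def)
    next
      case (VY \<sigma>)
      then show ?thesis using wt[of \<sigma>] by (cases "\<sigma> \<in> S") (auto simp: lookup_expo restr_def)
    qed
  qed
qed

lemma finite_weights: "finite (PiE S (\<lambda>\<sigma>. {..k \<sigma> :: nat}))"
  using finite_S by (intro finite_PiE) auto

text \<open>The monomial tensors are exactly the monomials of multidegree \<open>restr k\<close>, so
  membership in \<open>V\<close> or \<open>V0\<close> becomes a condition on exponents and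
  coefficients.\<close>

lemma V_over_eq:
  assumes R: "subring R"
  shows "V_over R k = homog R (restr k)"
proof (intro equalityI subsetI)
  fix P assume "P \<in> V_over R k"
  then obtain c where c: "\<forall>i. c i \<in> R" "P = (\<Sum>i\<in>PiE S (\<lambda>\<sigma>. {..k \<sigma>}). sg (expo k i) (c i))"
    unfolding V_over_def by (auto simp: mv_const_monom_tensor)
  show "P \<in> homog R (restr k)"
    unfolding c(2) by (intro homog_sum[OF R] homog_single[OF R]) (use c(1) wt_expo in auto)
next
  fix P assume P: "P \<in> homog R (restr k)"
  have "P = (\<Sum>i\<in>PiE S (\<lambda>\<sigma>. {..k \<sigma>}). sg (expo k i) (lk P (expo k i)))"
  proof (rule poly_mapping_eqI)
    fix m
    let ?f = "\<Sum>i\<in>PiE S (\<lambda>\<sigma>. {..k \<sigma>}). sg (expo k i) (lk P (expo k i))"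
    show "lk P m = lk ?f m"
    proof (cases "wt m = restr k")
      case True
      then obtain i where i: "i \<in> PiE S (\<lambda>\<sigma>. {..k \<sigma>})" "m = expo k i" using expo_surj by blast
      have "lk ?f m = (\<Sum>j\<in>PiE S (\<lambda>\<sigma>. {..k \<sigma>}). if j = i then lk P (expo k i) else 0)"
        unfolding lookup_sum lookup_single when_def
        by (rule sum.cong) (use i expo_inj in auto)
      then show ?thesis using i finite_weights by simp
    next
      case False
      then have "lk P m = 0" using P unfolding homog_def by (auto simp: in_keys_iff)
      moreover have "lk ?f m = 0"
        unfolding lookup_sum lookup_single when_def using False wt_expo by (intro sum.neutral) auto
      ultimately show ?thesis by simp
    qed
  qed
  moreover have "\<forall>i. lk P (expo k i) \<in> R" using P by (simp add: homog_def)
  ultimately show "P \<in> V_over R k"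
    unfolding V_over_def mv_const_monom_tensor by (auto intro: exI[of _ "\<lambda>i. lk P (expo k i)"])
qed

lemma V_eq: "V k = homog UNIV (restr k)" and V0_eq: "V0 k = homog OC (restr k)"
  unfolding V_def V0_def by (rule V_over_eq, rule subring_UNIV, rule V_over_eq, rule subring_OC)

lemma V0_iff: "P \<in> V0 k \<longleftrightarrow> P \<in> V k \<and> (\<forall>m. lk P m \<in> OC)"
  by (auto simp: V_eq V0_eq homog_def)

lemma V_0: "0 \<in> V k" and V_add: "P \<in> V k \<Longrightarrow> Q \<in> V k \<Longrightarrow> P + Q \<in> V k"
  and V_scale: "P \<in> V k \<Longrightarrow> mv_const c * P \<in> V k"
  and V_sum: "(\<And>i. i \<in> A \<Longrightarrow> f i \<in> V k) \<Longrightarrow> sum f A \<in> V k"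
  unfolding V_eq using subring_UNIV by (auto intro: homog_0 homog_add homog_scale homog_sum)

lemma V0_0: "0 \<in> V0 k" and V0_add: "P \<in> V0 k \<Longrightarrow> Q \<in> V0 k \<Longrightarrow> P + Q \<in> V0 k"
  and V0_scale: "c \<in> OC \<Longrightarrow> P \<in> V0 k \<Longrightarrow> mv_const c * P \<in> V0 k"
  and V0_sum: "(\<And>i. i \<in> A \<Longrightarrow> f i \<in> V0 k) \<Longrightarrow> sum f A \<in> V0 k"
  unfolding V0_eq using subring_OC by (auto intro: homog_0 homog_add homog_scale homog_sum)

lemma V_index: "P \<in> V k \<Longrightarrow> m \<in> ky P \<Longrightarrow> z \<in> ky m \<Longrightarrow> index z \<in> S"
proof -
  assume "P \<in> V k" "m \<in> ky P" "z \<in> ky m"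
  have "wt m = restr k" using \<open>P \<in> V k\<close> \<open>m \<in> ky P\<close> by (simp add: V_eq homog_def)
  moreover have "wt m (index z) \<noteq> 0" using \<open>z \<in> ky m\<close> by (cases z) (auto simp: wt_def in_keys_iff)
  ultimately show ?thesis by (auto simp: restr_def split: if_splits)
qed

lemma var_image_mult:
  assumes "index z \<in> S"
  shows "mv_subst (var_image g) (var_image h z) = var_image (g ** h) z"
  using assms
  by (cases z) (simp_all add: mv_subst_add mv_subst_mult mv_subst_const mv_subst_var
      matrix_matrix_mult_def sum_2 S_add S_mult mv_const_add mv_const_mult algebra_simps)

lemma subst_var_image_mult:
  assumes "P \<in> V k"
  shows "mv_subst (var_image g) (mv_subst (var_image h) P) = mv_subst (var_image (g ** h)) P"
  unfolding mv_subst_subst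
  by (rule mv_subst_cong) (rule var_image_mult, rule V_index[OF assms])

lemma var_image_homog:
  assumes R: "subring R" and "\<And>i j. index z \<in> S \<Longrightarrow> index z (g $ i $ j) \<in> R" "index z \<in> S"
  shows "var_image g z \<in> homog R (\<lambda>s. if index z = s then 1 else 0)"
proof -
  have var: "mv_var (VX s) \<in> homog R (\<lambda>t. if s = t then 1 else 0)"
    "mv_var (VY s) \<in> homog R (\<lambda>t. if s = t then 1 else 0)" for s :: "'f \<Rightarrow> 'c"
    unfolding mv_var_def using R
    by (auto intro!: homog_single simp: wt_def lookup_single when_def fun_eq_iff subring_def)
  show ?thesis
    by (cases z) (use assms var in \<open>auto intro!: homog_add homog_scale\<close>)
qed

lemma V_subst: "P \<in> V k \<Longrightarrow> mv_subst (var_image g) P \<in> V k"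
  unfolding V_eq
  by (rule homog_subst[OF subring_UNIV]) (auto intro!: var_image_homog[OF subring_UNIV] simp: restr_def split: if_splits)

lemma V0_subst:
  assumes "\<forall>i j. g $ i $ j \<in> OF" "P \<in> V0 k"
  shows "mv_subst (var_image g) P \<in> V0 k"
  using assms(2) unfolding V0_eq
  by (rule homog_subst[OF subring_OC])
    (auto intro!: var_image_homog[OF subring_OC] S_integral assms(1)[rule_format] simp: restr_def split: if_splits)

section \<open>The twisted action of \<open>G\<close> and the lattice preserved by
  \<open>KZ\<close>\<close>

definition chi :: "('f, 'c) weight \<Rightarrow> int \<Rightarrow> 'c" where
  "chi k n = (\<Prod>\<sigma>\<in>S. rt \<sigma> powi (- n * int (k \<sigma>)))"

lemma rho_eq: "rho k g P = mv_const (chi k (val (det g))) * mv_subst (var_image g) P"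
  by (simp add: rho_def chi_def)

lemma chi_add: "chi k (m + n) = chi k m * chi k n"
  unfolding chi_def
  by (simp add: rt_nonzero power_int_add[symmetric] algebra_simps flip: prod.distrib)

lemma chi_0: "chi k 0 = 1"
  by (simp add: chi_def)

lemma rho_V: "P \<in> V k \<Longrightarrow> rho k g P \<in> V k"
  unfolding rho_eq by (intro V_scale V_subst)

lemma rho_mult:
  assumes "g \<in> G" "h \<in> G" "P \<in> V k"
  shows "rho k (g ** h) P = rho k g (rho k h P)"
proof -
  have "val (det (g ** h)) = val (det g) + val (det h)"
    using assms by (simp add: det_mul val_mult G_iff_det)
  then show ?thesis
    unfolding rho_eq
    by (simp add: chi_add mv_const_mult mv_subst_mult mv_subst_const subst_var_image_mult[OF assms(3)] mult.assoc)
qed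

lemma rho_0: "rho k g 0 = 0"
  by (simp add: rho_eq mv_subst_0)

lemma rho_add: "rho k g (P + Q) = rho k g P + rho k g Q"
  by (simp add: rho_eq mv_subst_add distrib_left)

lemma rho_sum: "rho k g (\<Sum>i\<in>A. f i) = (\<Sum>i\<in>A. rho k g (f i))"
  by (simp add: rho_eq mv_subst_sum sum_distrib_left)

lemma rho_scale: "rho k g (mv_const c * P) = mv_const c * rho k g P"
  by (simp add: rho_eq mv_subst_mult mv_subst_const mult_ac)

lemma prod_keys_S:
  fixes f :: "('f \<Rightarrow> 'c) xy_var \<Rightarrow> 'a::comm_monoid_mult"
  assumes "wt m = restr k"
  shows "(\<Prod>z\<in>ky m. f z ^ lk m z) = (\<Prod>\<sigma>\<in>S. f (VX \<sigma>) ^ lk m (VX \<sigma>) * f (VY \<sigma>) ^ lk m (VY \<sigma>))"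
proof -
  have sub: "ky m \<subseteq> VX ` S \<union> VY ` S"
  proof
    fix z assume "z \<in> ky m"
    then have "restr k (index z) \<noteq> 0"
      using fun_cong[OF assms, of "index z"] by (cases z) (auto simp: wt_def in_keys_iff)
    then have "index z \<in> S" by (auto simp: restr_def split: if_splits)
    then show "z \<in> VX ` S \<union> VY ` S" by (cases z) auto
  qed
  have "(\<Prod>z\<in>ky m. f z ^ lk m z) = (\<Prod>z\<in>VX ` S \<union> VY ` S. f z ^ lk m z)"
    by (rule prod.mono_neutral_left) (use finite_S sub in \<open>auto simp: in_keys_iff\<close>)
  also have "\<dots> = (\<Prod>z\<in>VX ` S. f z ^ lk m z) * (\<Prod>z\<in>VY ` S. f z ^ lk m z)"
    by (rule prod.union_disjoint) (use finite_S in auto)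
  also have "\<dots> = (\<Prod>\<sigma>\<in>S. f (VX \<sigma>) ^ lk m (VX \<sigma>) * f (VY \<sigma>) ^ lk m (VY \<sigma>))"
    by (simp add: prod.reindex inj_on_def prod.distrib)
  finally show ?thesis .
qed

lemma subst_diagonal:
  assumes "P \<in> V k"
  shows "mv_subst (var_image (mat2 a 0 0 d)) P =
    (\<Sum>m\<in>ky P. sg m (lk P m * (\<Prod>\<sigma>\<in>S. \<sigma> a ^ lk m (VX \<sigma>) * \<sigma> d ^ lk m (VY \<sigma>))))"
  unfolding mv_subst_eq
proof (rule sum.cong[OF refl])
  fix m assume "m \<in> ky P"
  then have m: "wt m = restr k" using assms by (simp add: V_eq homog_def)
  let ?c = "case_xy_var (\<lambda>\<sigma>. \<sigma> a) (\<lambda>\<sigma>. \<sigma> d)"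
  have "mono_subst (var_image (mat2 a 0 0 d)) m = (\<Prod>z\<in>ky m. (mv_const (?c z) * mv_var z) ^ lk m z)"
    unfolding mono_subst_def
  proof (rule prod.cong[OF refl])
    fix z assume "z \<in> ky m"
    then have "index z \<in> S" using V_index[OF assms \<open>m \<in> ky P\<close>] by blast
    then have "var_image (mat2 a 0 0 d) z = mv_const (?c z) * mv_var z"
      by (cases z) (simp_all add: S_0 mv_const_0)
    then show "var_image (mat2 a 0 0 d) z ^ lk m z = (mv_const (?c z) * mv_var z) ^ lk m z" by simp
  qed
  also have "\<dots> = (\<Prod>z\<in>ky m. mv_const (?c z) ^ lk m z) * (\<Prod>z\<in>ky m. mv_var z ^ lk m z)"
    by (simp add: power_mult_distrib prod.distrib)
  also have "(\<Prod>z\<in>ky m. mv_var z ^ lk m z) = sg m (1::'c)"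
    by (simp add: mv_var_power prod_single flip: mvpoly_sum_single)
  also have "(\<Prod>z\<in>ky m. mv_const (?c z) ^ lk m z) = mv_const (\<Prod>z\<in>ky m. ?c z ^ lk m z)"
  proof -
    have pw: "mv_const x ^ n = mv_const (x ^ n)" for x :: 'c and n
      by (induction n) (simp_all add: mv_const_1 mv_const_mult)
    have pr: "(\<Prod>z\<in>A. mv_const (f z)) = mv_const (\<Prod>z\<in>A. f z)" for A :: "('f \<Rightarrow> 'c) xy_var set" and f :: "_ \<Rightarrow> 'c"
      by (induction A rule: infinite_finite_induct) (simp_all add: mv_const_1 mv_const_mult)
    show ?thesis by (simp only: pw pr)
  qed
  also have "(\<Prod>z\<in>ky m. ?c z ^ lk m z) = (\<Prod>\<sigma>\<in>S. \<sigma> a ^ lk m (VX \<sigma>) * \<sigma> d ^ lk m (VY \<sigma>))"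
    using prod_keys_S[OF m, of ?c] by simp
  finally show "mv_const (lk P m) * mono_subst (var_image (mat2 a 0 0 d)) m
    = sg m (lk P m * (\<Prod>\<sigma>\<in>S. \<sigma> a ^ lk m (VX \<sigma>) * \<sigma> d ^ lk m (VY \<sigma>)))"
    by (simp add: mv_const_single)
qed

lemma V_wt: "P \<in> V k \<Longrightarrow> m \<in> ky P \<Longrightarrow> \<sigma> \<in> S \<Longrightarrow> lk m (VX \<sigma>) + lk m (VY \<sigma>) = k \<sigma>"
proof -
  assume "P \<in> V k" "m \<in> ky P" "\<sigma> \<in> S"
  then have "wt m = restr k" by (simp add: V_eq homog_def)
  from fun_cong[OF this, of \<sigma>] show ?thesis using \<open>\<sigma> \<in> S\<close> by (simp add: wt_def restr_def)
qed

text \<open>The power of \<open>rt \<sigma>\<close> replaces \<open>z\<close> by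
  \<open>z * \<pi> powi (- val z)\<close>, so only the unit part of a scalar acts. This is why all
  of \<open>KZ\<close>, and not just \<open>K\<close>, preserves the lattice.\<close>

lemma rho_scalar:
  assumes "P \<in> V k" "z \<noteq> 0"
  shows "rho k (mat z) P = mv_const (\<Prod>\<sigma>\<in>S. \<sigma> (z * \<pi> powi (- val z)) ^ k \<sigma>) * P"
proof -
  have c: "chi k (2 * val z) * (\<Prod>\<sigma>\<in>S. \<sigma> z ^ k \<sigma>) = (\<Prod>\<sigma>\<in>S. \<sigma> (z * \<pi> powi (- val z)) ^ k \<sigma>)"
    unfolding chi_def prod.distrib[symmetric]
  proof (rule prod.cong[OF refl])
    fix \<sigma> assume \<sigma>: "\<sigma> \<in> S"
    have "rt \<sigma> powi (- (2 * val z) * int (k \<sigma>)) = ((rt \<sigma> powi 2) powi (- val z)) powi int (k \<sigma>)"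
      by (simp only: power_int_mult[symmetric]) (simp add: algebra_simps)
    also have "rt \<sigma> powi 2 = \<sigma> \<pi>" using square_roots[OF \<sigma>] by simp
    finally show "rt \<sigma> powi (- (2 * val z) * int (k \<sigma>)) * \<sigma> z ^ k \<sigma> = \<sigma> (z * \<pi> powi (- val z)) ^ k \<sigma>"
      using \<sigma> by (simp add: S_mult S_powi power_mult_distrib)
  qed
  have "mv_subst (var_image (mat z)) P = (\<Sum>m\<in>ky P. mv_const (\<Prod>\<sigma>\<in>S. \<sigma> z ^ k \<sigma>) * sg m (lk P m))"
    unfolding mat_eq_mat2 subst_diagonal[OF assms(1)]
  proof (rule sum.cong[OF refl])
    fix m assume m: "m \<in> ky P"
    have "(\<Prod>\<sigma>\<in>S. \<sigma> z ^ lk m (VX \<sigma>) * \<sigma> z ^ lk m (VY \<sigma>)) = (\<Prod>\<sigma>\<in>S. \<sigma> z ^ k \<sigma>)"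
      by (rule prod.cong[OF refl]) (simp add: V_wt[OF assms(1) m] flip: power_add)
    then show "sg m (lk P m * (\<Prod>\<sigma>\<in>S. \<sigma> z ^ lk m (VX \<sigma>) * \<sigma> z ^ lk m (VY \<sigma>)))
        = mv_const (\<Prod>\<sigma>\<in>S. \<sigma> z ^ k \<sigma>) * sg m (lk P m)"
      by (simp only: mv_const_single) (simp only: mult.commute)
  qed
  also have "\<dots> = mv_const (\<Prod>\<sigma>\<in>S. \<sigma> z ^ k \<sigma>) * P"
    by (simp flip: sum_distrib_left mvpoly_sum_single)
  finally have "mv_subst (var_image (mat z)) P = mv_const (\<Prod>\<sigma>\<in>S. \<sigma> z ^ k \<sigma>) * P" .
  moreover have "val (det (mat z :: 'f^2^2)) = 2 * val z"
    using assms(2) by (simp add: mat_eq_mat2 val_mult)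
  ultimately show ?thesis
    unfolding rho_eq by (simp add: c mult.assoc[symmetric] flip: mv_const_mult)
qed

lemma rho_1: "P \<in> V k \<Longrightarrow> rho k (mat 1) P = P"
  using rho_scalar[of P k 1] by (simp add: val_1 S_1 mv_const_1)

lemma rho_V0:
  assumes "\<kappa> \<in> KZ" "P \<in> V0 k"
  shows "rho k \<kappa> P \<in> V0 k"
proof -
  obtain z g where z: "z \<noteq> 0" "g \<in> K" "\<kappa> = mat z ** g" using assms(1) unfolding KZ_iff by blast
  have P: "P \<in> V k" using assms(2) V0_iff by blast
  have "rho k g P \<in> V0 k"
    using z(2) V0_subst[OF _ assms(2), of g] unfolding rho_eq
    by (simp add: K_iff val_unit chi_0 mv_const_1)
  moreover have "rho k \<kappa> P = rho k (mat z) (rho k g P)"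
    unfolding z(3) using z KZ_G mat_KZ K_G P by (intro rho_mult) auto
  moreover have "\<sigma> (z * \<pi> powi (- val z)) \<in> OC" if "\<sigma> \<in> S" for \<sigma>
  proof (rule S_unit[OF that])
    have "val (z * \<pi> powi (- val z)) = 0"
      using val_mult[of z "\<pi> powi (- val z)"] z(1) pi_nonzero val_eq[OF unit_1, of "\<pi> powi (- val z)" "- val z"]
      by simp
    then show "z * \<pi> powi (- val z) \<in> UF" using z(1) pi_nonzero by (simp add: unit_iff_val)
  qed
  ultimately show ?thesis
    using rho_scalar[OF rho_V[OF P] z(1), of g]
    by (auto intro!: V0_scale C.integers_prod C.integers_power)
qed

section \<open>The kernel of the Hecke operator\<close>

definition hc :: "('f, 'c) weight \<Rightarrow> 'c" where
  "hc k = chi k (- 1)"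

text \<open>\<open>hc k\<close> is the product of the \<open>rt \<sigma> ^ k \<sigma>\<close>, and
  the twist in \<open>rho\<close> contributes the same product. Together they give
  \<open>\<sigma> \<pi> ^ k \<sigma>\<close>; the action of the inverse of \<open>alpha\<close>
  divides by \<open>\<sigma> \<pi>\<close> for each \<open>VY \<sigma>\<close>, which leaves the
  exponent of \<open>VX \<sigma>\<close>.\<close>

lemma U_eq: "P \<in> V k \<Longrightarrow> U P = mv_const (hc k) * rho k (matrix_inv alpha) P"
proof -
  assume P: "P \<in> V k"
  have v: "val (det (matrix_inv alpha)) = - 1"
    using pi_nonzero by (simp add: matrix_inv_alpha val_inverse val_pi)
  have "hc k * chi k (- 1) * (\<Prod>\<sigma>\<in>S. \<sigma> 1 ^ lk m (VX \<sigma>) * \<sigma> (inverse \<pi>) ^ lk m (VY \<sigma>))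
      = (\<Prod>\<sigma>\<in>S. \<sigma> \<pi> ^ lk m (VX \<sigma>))" if m: "m \<in> ky P" for m
    unfolding hc_def chi_def prod.distrib[symmetric]
  proof (rule prod.cong[OF refl])
    fix \<sigma> assume \<sigma>: "\<sigma> \<in> S"
    have "rt \<sigma> powi (- (- 1) * int (k \<sigma>)) * rt \<sigma> powi (- (- 1) * int (k \<sigma>)) = \<sigma> \<pi> ^ k \<sigma>"
      using square_roots[OF \<sigma>] by (simp add: power_mult_distrib[symmetric] power2_eq_square)
    also have "\<dots> = \<sigma> \<pi> ^ lk m (VX \<sigma>) * \<sigma> \<pi> ^ lk m (VY \<sigma>)"
      by (simp add: V_wt[OF P m \<sigma>, symmetric] power_add)
    finally have rr: "rt \<sigma> powi (- (- 1) * int (k \<sigma>)) * rt \<sigma> powi (- (- 1) * int (k \<sigma>))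
        = \<sigma> \<pi> ^ lk m (VX \<sigma>) * \<sigma> \<pi> ^ lk m (VY \<sigma>)" .
    have "\<sigma> \<pi> ^ lk m (VY \<sigma>) * \<sigma> (inverse \<pi>) ^ lk m (VY \<sigma>) = 1"
      using \<sigma> pi_nonzero by (simp add: S_inverse S_eq_0_iff flip: power_mult_distrib)
    then show "rt \<sigma> powi (- (- 1) * int (k \<sigma>)) * rt \<sigma> powi (- (- 1) * int (k \<sigma>))
        * (\<sigma> 1 ^ lk m (VX \<sigma>) * \<sigma> (inverse \<pi>) ^ lk m (VY \<sigma>)) = \<sigma> \<pi> ^ lk m (VX \<sigma>)"
      unfolding rr using \<sigma> by (simp add: S_1 mult.assoc)
  qed
  then have "U P = mv_const (hc k * chi k (- 1)) * (\<Sum>m\<in>ky P. sg m (lk P m *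
      (\<Prod>\<sigma>\<in>S. \<sigma> 1 ^ lk m (VX \<sigma>) * \<sigma> (inverse \<pi>) ^ lk m (VY \<sigma>))))"
    unfolding U_def sum_distrib_left mv_const_single
    by (intro sum.cong refl arg_cong[of _ _ "sg _"]) (simp add: mult.left_commute)
  also have "\<dots> = mv_const (hc k) * rho k (matrix_inv alpha) P"
    unfolding rho_eq v unfolding matrix_inv_alpha subst_diagonal[OF P] by (simp add: mv_const_mult mult.assoc)
  finally show ?thesis .
qed

text \<open>On the double coset the kernel is a scalar multiple of \<open>rho\<close>, hence
  independent of the factorization of \<open>g\<close>.\<close>

lemma psi_Delta:
  assumes "g \<in> Delta" "v \<in> V k"
  shows "psi k g v = mv_const (hc k) * rho k g v"
proof -
  have val: "rho k \<kappa> (U (rho k \<kappa>' v)) = mv_const (hc k) * rho k g v"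
    if "\<kappa> \<in> KZ" "\<kappa>' \<in> KZ" "g = \<kappa> ** matrix_inv alpha ** \<kappa>'" for \<kappa> \<kappa>'
  proof -
    have "rho k \<kappa> (U (rho k \<kappa>' v)) = mv_const (hc k) * rho k \<kappa> (rho k (matrix_inv alpha) (rho k \<kappa>' v))"
      by (simp add: U_eq[OF rho_V[OF assms(2)]] rho_scale)
    also have "rho k \<kappa> (rho k (matrix_inv alpha) (rho k \<kappa>' v)) = rho k g v"
      unfolding that(3) using that KZ_G assms(2) rho_V G_matrix_inv[OF alpha_G] G_mult
      by (simp add: rho_mult)
    finally show ?thesis .
  qed
  obtain \<kappa> \<kappa>' where \<kappa>: "\<kappa> \<in> KZ" "\<kappa>' \<in> KZ" "g = \<kappa> ** matrix_inv alpha ** \<kappa>'"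
    using assms(1) unfolding Delta_def by blast
  have "(THE w. \<exists>\<kappa>\<in>KZ. \<exists>\<kappa>'\<in>KZ. g = \<kappa> ** matrix_inv alpha ** \<kappa>' \<and> w = rho k \<kappa> (U (rho k \<kappa>' v)))
      = mv_const (hc k) * rho k g v"
  proof (rule the_equality)
    show "\<exists>\<kappa>\<in>KZ. \<exists>\<kappa>'\<in>KZ. g = \<kappa> ** matrix_inv alpha ** \<kappa>' \<and> mv_const (hc k) * rho k g v = rho k \<kappa> (U (rho k \<kappa>' v))"
      using \<kappa> val[OF \<kappa>] by metis
  next
    fix w assume "\<exists>\<kappa>\<in>KZ. \<exists>\<kappa>'\<in>KZ. g = \<kappa> ** matrix_inv alpha ** \<kappa>' \<and> w = rho k \<kappa> (U (rho k \<kappa>' v))"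
    then obtain l l' where "l \<in> KZ" "l' \<in> KZ" "g = l ** matrix_inv alpha ** l'" "w = rho k l (U (rho k l' v))"
      by blast
    then show "w = mv_const (hc k) * rho k g v" using val by blast
  qed
  moreover have "\<exists>\<kappa>\<in>KZ. \<exists>\<kappa>'\<in>KZ. g = \<kappa> ** matrix_inv alpha ** \<kappa>'" using \<kappa> by blast
  ultimately show ?thesis unfolding psi_def by simp
qed

lemma psi_not_Delta: "g \<notin> Delta \<Longrightarrow> psi k g v = 0"
  unfolding psi_def Delta_def by (auto simp del: not_ex)

lemma psi_V: "v \<in> V k \<Longrightarrow> psi k g v \<in> V k"
  by (cases "g \<in> Delta") (simp_all add: psi_Delta psi_not_Delta V_0 V_scale rho_V)

lemma psi_left:
  assumes "\<kappa> \<in> KZ" "v \<in> V k"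
  shows "psi k (\<kappa> ** g) v = rho k \<kappa> (psi k g v)"
proof (cases "g \<in> Delta")
  case True
  then show ?thesis
    using assms Delta_left[OF assms(1) True] KZ_G Delta_G
    by (simp add: psi_Delta rho_mult rho_scale)
next
  case False
  have "\<kappa> ** g \<notin> Delta"
    using False Delta_left[OF KZ_matrix_inv[OF assms(1)]] G_cancel(1)[OF KZ_G[OF assms(1)]] by metis
  then show ?thesis using False by (simp add: psi_not_Delta rho_0)
qed

lemma psi_right:
  assumes "\<kappa> \<in> KZ" "v \<in> V k"
  shows "psi k (g ** \<kappa>) v = psi k g (rho k \<kappa> v)"
proof (cases "g \<in> Delta")
  case True
  then show ?thesis
    using assms Delta_right[OF assms(1) True] KZ_G Delta_G rho_V
    by (simp add: psi_Delta rho_mult)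
next
  case False
  have "g ** \<kappa> \<notin> Delta"
    using False Delta_right[OF KZ_matrix_inv[OF assms(1)]] G_cancel(3)[OF KZ_G[OF assms(1)]] by metis
  then show ?thesis using False by (simp add: psi_not_Delta)
qed

text \<open>The determinant of \<open>y\<close> has valuation 1, so \<open>hc\<close> cancels the
  twist in \<open>rho\<close>: no square root survives, and substitution by an integral matrix
  remains.\<close>

lemma psi_Y:
  assumes "y \<in> Y" "v \<in> V k"
  shows "psi k y v = mv_subst (var_image y) v"
proof -
  have "psi k y v = mv_const (chi k (- 1) * chi k 1) * mv_subst (var_image y) v"
    using assms by (simp add: psi_Delta Y_Delta rho_eq val_det_Y hc_def mv_const_mult mult.assoc)
  also have "chi k (- 1) * chi k 1 = 1"
    using chi_add[of k "- 1" 1] by (simp add: chi_0)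
  finally show ?thesis by (simp add: mv_const_1)
qed

lemma psi_Y_V0: "y \<in> Y \<Longrightarrow> v \<in> V0 k \<Longrightarrow> psi k y v \<in> V0 k"
  using V0_subst[of y v k] V0_iff[of v k] psi_Y Y_integral by simp

end

section \<open>The Hecke operator\<close>

context gl2_setup
begin

section \<open>Compactly induced functions\<close>

definition finite_support :: "('f, 'c) ifun \<Rightarrow> bool" where
  "finite_support f \<longleftrightarrow> (\<exists>A. finite A \<and> A \<subseteq> G \<and> (\<forall>g\<in>G. f g \<noteq> 0 \<longrightarrow> (\<exists>h\<in>A. \<exists>\<kappa>\<in>KZ. g = \<kappa> ** h)))"

lemma ind_V_iff: "f \<in> ind k (V k) \<longleftrightarrow> (\<forall>g. g \<notin> G \<longrightarrow> f g = 0) \<and> (\<forall>g. f g \<in> V k) \<and>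
    (\<forall>\<kappa>\<in>KZ. \<forall>g\<in>G. f (\<kappa> ** g) = rho k \<kappa> (f g)) \<and> finite_support f"
  unfolding ind_def finite_support_def using V_0 by auto

lemma ind_V0_iff: "f \<in> ind k (V0 k) \<longleftrightarrow> f \<in> ind k (V k) \<and> (\<forall>g. f g \<in> V0 k)"
  unfolding ind_def using V0_0 V0_iff by auto

lemma ind_V: "f \<in> ind k (V k) \<Longrightarrow> f g \<in> V k"
  by (simp add: ind_V_iff)

lemma ind_equivariant: "f \<in> ind k (V k) \<Longrightarrow> \<kappa> \<in> KZ \<Longrightarrow> g \<in> G \<Longrightarrow> f (\<kappa> ** g) = rho k \<kappa> (f g)"
  by (simp add: ind_V_iff)

lemma ind_outside: "f \<in> ind k (V k) \<Longrightarrow> g \<notin> G \<Longrightarrow> f g = 0"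
  by (simp add: ind_V_iff)

lemma ind_finite_support: "f \<in> ind k (V k) \<Longrightarrow> finite_support f"
  by (simp add: ind_V_iff)

lemma finite_support_union:
  assumes "finite_support f" "finite_support f'" "\<And>g. h g \<noteq> 0 \<Longrightarrow> f g \<noteq> 0 \<or> f' g \<noteq> 0"
  shows "finite_support h"
proof -
  obtain A A' where "finite A" "A \<subseteq> G" "\<forall>g\<in>G. f g \<noteq> 0 \<longrightarrow> (\<exists>h\<in>A. \<exists>\<kappa>\<in>KZ. g = \<kappa> ** h)"
    "finite A'" "A' \<subseteq> G" "\<forall>g\<in>G. f' g \<noteq> 0 \<longrightarrow> (\<exists>h\<in>A'. \<exists>\<kappa>\<in>KZ. g = \<kappa> ** h)"
    using assms(1,2) unfolding finite_support_def by blast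
  then show ?thesis
    unfolding finite_support_def using assms(3) by (intro exI[of _ "A \<union> A'"]) blast
qed

lemma ind_V_0: "(\<lambda>_. 0) \<in> ind k (V k)"
  by (auto simp: ind_V_iff V_0 rho_0 finite_support_def)

lemma ind_V_add: "f \<in> ind k (V k) \<Longrightarrow> f' \<in> ind k (V k) \<Longrightarrow> (\<lambda>g. f g + f' g) \<in> ind k (V k)"
  by (auto simp: ind_V_iff V_add rho_add intro: finite_support_union[of f f'])

lemma ind_V_scale: "f \<in> ind k (V k) \<Longrightarrow> (\<lambda>g. mv_const c * f g) \<in> ind k (V k)"
  by (auto simp: ind_V_iff V_scale rho_scale intro: finite_support_union[of f f])

lemma mv_const_minus_1: "mv_const (- 1) * P = - P"
  by (simp add: mv_const_uminus mv_const_1)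

lemma ind_V_diff: "f \<in> ind k (V k) \<Longrightarrow> f' \<in> ind k (V k) \<Longrightarrow> (\<lambda>g. f g - f' g) \<in> ind k (V k)"
  using ind_V_add[OF _ ind_V_scale[of f' k "- 1"], of f] by (simp add: mv_const_minus_1)

lemma ind_V_sum:
  "(\<And>i. i \<in> A \<Longrightarrow> f i \<in> ind k (V k)) \<Longrightarrow> (\<lambda>g. \<Sum>i\<in>A. f i g) \<in> ind k (V k)"
  by (induction A rule: infinite_finite_induct) (simp_all add: ind_V_0 ind_V_add)

lemma ind_V0_add: "f \<in> ind k (V0 k) \<Longrightarrow> f' \<in> ind k (V0 k) \<Longrightarrow> (\<lambda>g. f g + f' g) \<in> ind k (V0 k)"
  by (simp add: ind_V0_iff ind_V_add V0_add)

lemma ind_V0_scale: "c \<in> OC \<Longrightarrow> f \<in> ind k (V0 k) \<Longrightarrow> (\<lambda>g. mv_const c * f g) \<in> ind k (V0 k)"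
  by (simp add: ind_V0_iff ind_V_scale V0_scale)

lemma ind_V0_V: "f \<in> ind k (V0 k) \<Longrightarrow> f \<in> ind k (V k)"
  by (simp add: ind_V0_iff)

section \<open>Cosets and the Hecke operator as a sum over neighbours\<close>

definition gcos :: "'f^2^2 \<Rightarrow> ('f^2^2) set" where
  "gcos g = (\<lambda>\<kappa>. g ** \<kappa>) ` KZ"

lemma gcos_mult: "g \<in> G \<Longrightarrow> \<kappa> \<in> KZ \<Longrightarrow> gcos (g ** \<kappa>) = gcos g"
proof (intro equalityI subsetI)
  assume g: "g \<in> G" and \<kappa>: "\<kappa> \<in> KZ"
  show "x \<in> gcos g" if "x \<in> gcos (g ** \<kappa>)" for x
    using that \<kappa> KZ_mult unfolding gcos_def by (auto simp flip: matrix_mul_assoc)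
  show "x \<in> gcos (g ** \<kappa>)" if x: "x \<in> gcos g" for x
  proof -
    obtain l where l: "l \<in> KZ" "x = g ** l" using x unfolding gcos_def by blast
    then have "x = g ** \<kappa> ** (matrix_inv \<kappa> ** l)"
      using G_cancel(2)[OF KZ_G[OF \<kappa>]] by (simp flip: matrix_mul_assoc)
    then show ?thesis unfolding gcos_def using KZ_mult[OF KZ_matrix_inv[OF \<kappa>] l(1)] by blast
  qed
qed

lemma cosets_eq: "cosets = gcos ` G"
  by (simp add: cosets_def gcos_def)

lemma rep_gcos: "g \<in> G \<Longrightarrow> \<exists>\<kappa>\<in>KZ. rep (gcos g) = g ** \<kappa>"
proof -
  assume "g \<in> G"
  have "g ** mat 1 \<in> gcos g" unfolding gcos_def using one_KZ by blast
  then have "rep (gcos g) \<in> gcos g" unfolding rep_def by (rule someI)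
  then show ?thesis unfolding gcos_def by blast
qed

lemma rep_G: "A \<in> cosets \<Longrightarrow> rep A \<in> G"
  unfolding cosets_eq using rep_gcos G_mult KZ_G by (metis imageE)

lemma gcos_rep: "A \<in> cosets \<Longrightarrow> gcos (rep A) = A"
  unfolding cosets_eq using rep_gcos gcos_mult by (metis imageE)

lemma psi_0: "psi k g 0 = 0"
  using psi_Delta[OF _ V_0, of g k] psi_not_Delta by (cases "g \<in> Delta") (simp_all add: rho_0)

text \<open>At \<open>h\<close> only the coset of the inverse of \<open>h ** g\<close> can
  contribute, because the bracket of any other coset is supported elsewhere.\<close>

lemma hecke_bracket_eq:
  assumes g: "g \<in> G" and h: "h \<in> G" and v: "v \<in> V k"
  shows "hecke_bracket k g v h = psi k (h ** g) v"
proof -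
  define T where "T = {A. A \<in> cosets \<and> psi k (matrix_inv (rep A)) v \<noteq> 0}"
  define t where "t A = bracket k (g ** rep A) (psi k (matrix_inv (rep A)) v) h" for A
  have hg: "h ** g \<in> G" using g h G_mult by blast
  define A0 where "A0 = gcos (matrix_inv (h ** g))"
  have A0: "A0 \<in> cosets" unfolding A0_def cosets_eq using G_matrix_inv[OF hg] by blast
  obtain l where l: "l \<in> KZ" "rep A0 = matrix_inv (h ** g) ** l"
    unfolding A0_def using rep_gcos[OF G_matrix_inv[OF hg]] by blast
  have hgr: "h ** (g ** rep A0) = l"
    using l(2) G_cancel(2)[OF hg, of l] by (simp add: matrix_mul_assoc)
  have inv: "l ** matrix_inv (rep A0) = h ** g"
    unfolding l(2) using l(1) KZ_G hg
    by (simp add: matrix_inv_mult G_matrix_inv matrix_inv_matrix_inv G_cancel)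
  have tA0: "t A0 = psi k (h ** g) v"
    unfolding t_def bracket_def hgr using psi_left[OF l(1) v, of "matrix_inv (rep A0)"] l(1) inv by simp
  have tA: "t A = 0" if A: "A \<in> cosets" "A \<noteq> A0" for A
  proof -
    have "h ** (g ** rep A) \<notin> KZ"
    proof
      assume k: "h ** (g ** rep A) \<in> KZ"
      have "rep A = matrix_inv (h ** g) ** (h ** (g ** rep A))"
        using G_cancel(1)[OF hg, of "rep A"] by (simp add: matrix_mul_assoc)
      then have "A = A0" unfolding A0_def using gcos_mult[OF G_matrix_inv[OF hg] k] gcos_rep[OF A(1)] by simp
      then show False using A(2) by simp
    qed
    then show ?thesis unfolding t_def bracket_def by simp
  qed
  \<comment> \<open>The index set has to be finite for the sum to be meaningful: a sum over an
    infinite set is 0 by convention.\<close>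
  have "T \<subseteq> gcos ` Y"
  proof
    fix A assume A: "A \<in> T"
    then have "matrix_inv (rep A) \<in> Delta" unfolding T_def using psi_not_Delta by blast
    then have "rep A \<in> Delta" using Delta_inv matrix_inv_matrix_inv rep_G A unfolding T_def by force
    then obtain y \<kappa> where y: "y \<in> Y" "\<kappa> \<in> KZ" "rep A = y ** \<kappa>" using Delta_Y by blast
    then have "A = gcos y" using gcos_mult Y_G gcos_rep A unfolding T_def by force
    then show "A \<in> gcos ` Y" using y by blast
  qed
  then have "finite T" using finite_Y finite_subset by blast
  have "hecke_bracket k g v h = sum t T" unfolding hecke_bracket_def T_def t_def ..
  also have "\<dots> = sum t {A0}"
  proof (rule sum.mono_neutral_cong)
    show "t A = 0" if "A \<in> {A0} - T" for A
      using that A0 unfolding T_def t_def bracket_def by (auto simp: rho_0)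
    show "t A = 0" if "A \<in> T - {A0}" for A using that tA unfolding T_def by blast
  qed (use \<open>finite T\<close> in auto)
  finally show ?thesis using tA0 by simp
qed

lemma hecke_bracket_outside: "h \<notin> G \<Longrightarrow> hecke_bracket k g v h = 0"
proof -
  assume h: "h \<notin> G"
  have "h ** x \<notin> KZ" for x
    using h KZ_G[of "h ** x"] by (auto simp: G_iff_det det_mul)
  then show ?thesis unfolding hecke_bracket_def bracket_def by simp
qed

lemma hecke_outside: "h \<notin> G \<Longrightarrow> hecke k f h = 0"
  unfolding hecke_def by (simp add: hecke_bracket_outside)

abbreviation fcosets :: "('f, 'c) ifun \<Rightarrow> ('f^2^2) set set" where
  "fcosets f \<equiv> {A. A \<in> cosets \<and> f (matrix_inv (rep A)) \<noteq> 0}"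

lemma finite_fcosets:
  assumes "f \<in> ind k (V k)"
  shows "finite (fcosets f)"
proof -
  obtain A where A: "finite A" "A \<subseteq> G" "\<forall>g\<in>G. f g \<noteq> 0 \<longrightarrow> (\<exists>h\<in>A. \<exists>\<kappa>\<in>KZ. g = \<kappa> ** h)"
    using ind_finite_support[OF assms] unfolding finite_support_def by blast
  have "fcosets f \<subseteq> (\<lambda>h. gcos (matrix_inv h)) ` A"
  proof
    fix c assume c: "c \<in> fcosets f"
    then have r: "rep c \<in> G" using rep_G by blast
    obtain h \<kappa> where h: "h \<in> A" "\<kappa> \<in> KZ" "matrix_inv (rep c) = \<kappa> ** h"
      using A(3) c G_matrix_inv[OF r] by blast
    have hG: "h \<in> G" using h A(2) by blast
    have "rep c = matrix_inv h ** matrix_inv \<kappa>"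
      using matrix_inv_matrix_inv[OF r] matrix_inv_mult[OF KZ_G[OF h(2)] hG] h(3) by simp
    then have "c = gcos (matrix_inv h)"
      using gcos_mult[OF G_matrix_inv[OF hG] KZ_matrix_inv[OF h(2)]] gcos_rep[of c] c by simp
    then show "c \<in> (\<lambda>h. gcos (matrix_inv h)) ` A" using h(1) by blast
  qed
  then show ?thesis using A(1) finite_subset by blast
qed

lemma hecke_eq_cosets:
  assumes "f \<in> ind k (V k)" "h \<in> G"
  shows "hecke k f h = (\<Sum>A\<in>fcosets f. psi k (h ** rep A) (f (matrix_inv (rep A))))"
  unfolding hecke_def
  by (rule sum.cong) (auto intro!: hecke_bracket_eq rep_G assms(2) ind_V[OF assms(1)])

text \<open>The term of a coset vanishes unless \<open>h ** rep A\<close> lies in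
  \<open>Delta\<close>, which singles out the cosets of \<open>matrix_inv h ** y\<close> with
  \<open>y\<close> in \<open>Y\<close>. The choice of \<open>rep A\<close> drops out by equivariance
  of \<open>f\<close>.\<close>

lemma hecke_eq:
  assumes f: "f \<in> ind k (V k)" and h: "h \<in> G"
  shows "hecke k f h = (\<Sum>y\<in>Y. psi k y (f (matrix_inv y ** h)))"
proof -
  define t where "t A = psi k (h ** rep A) (f (matrix_inv (rep A)))" for A
  define c where "c y = gcos (matrix_inv h ** y)" for y
  have hi: "matrix_inv h \<in> G" using G_matrix_inv[OF h] .
  have cG: "c y \<in> cosets" if "y \<in> Y" for y
    unfolding c_def cosets_eq using G_mult[OF hi Y_G[OF that]] by blast
  have inj: "inj_on c Y"
  proof (rule inj_onI)
    fix y y' assume y: "y \<in> Y" "y' \<in> Y" "c y = c y'"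
    have "matrix_inv h ** y' ** mat 1 \<in> c y'" unfolding c_def gcos_def using one_KZ by blast
    then obtain \<kappa> where \<kappa>: "\<kappa> \<in> KZ" "matrix_inv h ** y' = matrix_inv h ** y ** \<kappa>"
      using y(3) unfolding c_def gcos_def by auto
    then have "y ** \<kappa> = y'"
      using G_cancel(2)[OF h, of "y'"] G_cancel(2)[OF h, of "y ** \<kappa>"] by (simp add: matrix_mul_assoc)
    then show "y = y'" using Y_distinct y \<kappa> by blast
  qed
  have tc: "t (c y) = psi k y (f (matrix_inv y ** h))" if y: "y \<in> Y" for y
  proof -
    have yG: "y \<in> G" using Y_G y .
    obtain \<kappa> where \<kappa>: "\<kappa> \<in> KZ" "rep (c y) = matrix_inv h ** y ** \<kappa>"
      unfolding c_def using rep_gcos[OF G_mult[OF hi yG]] by blast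
    have \<kappa>G: "\<kappa> \<in> G" using KZ_G \<kappa> by blast
    have 1: "h ** rep (c y) = y ** \<kappa>"
      unfolding \<kappa>(2) using G_cancel(2)[OF h, of "y ** \<kappa>"] by (simp add: matrix_mul_assoc)
    have "matrix_inv (rep (c y)) = matrix_inv \<kappa> ** (matrix_inv y ** h)"
      unfolding \<kappa>(2) using h hi yG \<kappa>G by (simp add: matrix_inv_mult G_mult matrix_inv_matrix_inv)
    then have 2: "f (matrix_inv (rep (c y))) = rho k (matrix_inv \<kappa>) (f (matrix_inv y ** h))"
      using ind_equivariant[OF f KZ_matrix_inv[OF \<kappa>(1)]] G_mult[OF G_matrix_inv[OF yG] h] by simp
    have "t (c y) = psi k y (rho k \<kappa> (rho k (matrix_inv \<kappa>) (f (matrix_inv y ** h))))"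
      unfolding t_def 1 2 using psi_right[OF \<kappa>(1) rho_V[OF ind_V[OF f]]] .
    also have "rho k \<kappa> (rho k (matrix_inv \<kappa>) (f (matrix_inv y ** h))) = f (matrix_inv y ** h)"
      using rho_mult[OF \<kappa>G G_matrix_inv[OF \<kappa>G] ind_V[OF f]] rho_1[OF ind_V[OF f]] G_inv(1)[OF \<kappa>G] by metis
    finally show ?thesis .
  qed
  have "hecke k f h = sum t (fcosets f)" unfolding t_def by (rule hecke_eq_cosets[OF f h])
  also have "\<dots> = sum t (c ` Y)"
  proof (rule sum.mono_neutral_cong)
    show "finite (c ` Y)" using finite_Y by blast
    show "finite (fcosets f)" using finite_fcosets f .
    show "t A = 0" if "A \<in> c ` Y - fcosets f" for A
      using that cG unfolding t_def by (auto simp: psi_0)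
    show "t A = 0" if A: "A \<in> fcosets f - c ` Y" for A
    proof -
      have "h ** rep A \<notin> Delta"
      proof
        assume "h ** rep A \<in> Delta"
        then obtain y \<kappa> where y: "y \<in> Y" "\<kappa> \<in> KZ" "h ** rep A = y ** \<kappa>" using Delta_Y by blast
        then have "rep A = matrix_inv h ** y ** \<kappa>"
          using G_cancel(1)[OF h, of "rep A"] by (simp add: matrix_mul_assoc)
        then have "A = c y"
          unfolding c_def using gcos_mult[OF G_mult[OF hi Y_G[OF y(1)]] y(2)] gcos_rep A by force
        then show False using A y by blast
      qed
      then show ?thesis unfolding t_def by (rule psi_not_Delta)
    qed
  qed auto
  also have "\<dots> = (\<Sum>y\<in>Y. psi k y (f (matrix_inv y ** h)))"
    unfolding sum.reindex[OF inj] using tc by simp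
  finally show ?thesis .
qed

lemma hecke_ind:
  assumes f: "f \<in> ind k (V k)"
  shows "hecke k f \<in> ind k (V k)"
  unfolding ind_V_iff
proof (intro conjI allI impI ballI)
  show "hecke k f g = 0" if "g \<notin> G" for g using hecke_outside that .
  show "hecke k f g \<in> V k" for g
  proof (cases "g \<in> G")
    case True
    then show ?thesis unfolding hecke_eq[OF f True] by (intro V_sum psi_V ind_V[OF f])
  qed (simp add: hecke_outside V_0)
  show "hecke k f (\<kappa> ** g) = rho k \<kappa> (hecke k f g)" if "\<kappa> \<in> KZ" "g \<in> G" for \<kappa> g
    unfolding hecke_eq_cosets[OF f that(2)] hecke_eq_cosets[OF f G_mult[OF KZ_G[OF that(1)] that(2)]] rho_sum
    using psi_left[OF that(1) ind_V[OF f]] by (simp flip: matrix_mul_assoc)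
  obtain A where A: "finite A" "A \<subseteq> G" "\<forall>g\<in>G. f g \<noteq> 0 \<longrightarrow> (\<exists>h\<in>A. \<exists>\<kappa>\<in>KZ. g = \<kappa> ** h)"
    using ind_finite_support[OF f] unfolding finite_support_def by blast
  show "finite_support (hecke k f)"
    unfolding finite_support_def
  proof (intro exI[of _ "(\<lambda>(y, a). matrix_inv y ** a) ` (Y \<times> A)"] conjI ballI impI)
    show "finite ((\<lambda>(y, a). matrix_inv y ** a) ` (Y \<times> A))" using finite_Y A(1) by blast
    show "(\<lambda>(y, a). matrix_inv y ** a) ` (Y \<times> A) \<subseteq> G"
      using Y_G A(2) G_mult G_matrix_inv by auto
    fix g assume g: "g \<in> G" "hecke k f g \<noteq> 0"
    then obtain y where y: "y \<in> Y" "psi k y (f (matrix_inv y ** g)) \<noteq> 0"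
      unfolding hecke_eq[OF f g(1)] by (meson sum.neutral)
    have yG: "y \<in> G" using Y_G y(1) .
    have "f (matrix_inv y ** g) \<noteq> 0" using y(2) psi_0 by metis
    then obtain a \<kappa> where a: "a \<in> A" "\<kappa> \<in> KZ" "matrix_inv y ** g = \<kappa> ** a"
      using A(3) G_mult[OF G_matrix_inv[OF yG] g(1)] by blast
    have g_eq: "g = (y ** \<kappa>) ** a"
      using G_cancel(2)[OF yG, of g] a(3) by (simp add: matrix_mul_assoc)
    \<comment> \<open>The factor from \<open>KZ\<close> stands between \<open>y\<close> and
      \<open>a\<close>. Inversion inside \<open>Delta\<close> moves it to the left, at the price of
      another element \<open>y'\<close> of \<open>Y\<close>.\<close>
    have yk: "y ** \<kappa> \<in> Delta" using Delta_right Y_Delta y(1) a(2) by blast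
    then obtain y' l where y': "y' \<in> Y" "l \<in> KZ" "matrix_inv (y ** \<kappa>) = y' ** l" using Delta_inv Delta_Y by blast
    have "y ** \<kappa> = matrix_inv l ** matrix_inv y'"
      using matrix_inv_matrix_inv[OF Delta_G[OF yk]] y' matrix_inv_mult[OF Y_G[OF y'(1)] KZ_G[OF y'(2)]] by simp
    then have "g = matrix_inv l ** (matrix_inv y' ** a)" using g_eq by (simp add: matrix_mul_assoc)
    then show "\<exists>h\<in>(\<lambda>(y, a). matrix_inv y ** a) ` (Y \<times> A). \<exists>\<kappa>\<in>KZ. g = \<kappa> ** h"
      using y'(1) a(1) KZ_matrix_inv[OF y'(2)]
      by (intro bexI[of _ "matrix_inv y' ** a"] bexI[of _ "matrix_inv l"]) auto
  qed
qed

lemma psi_Y_add: "y \<in> Y \<Longrightarrow> v \<in> V k \<Longrightarrow> v' \<in> V k \<Longrightarrow> psi k y (v + v') = psi k y v + psi k y v'"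
  by (simp add: psi_Y V_add mv_subst_add)

lemma psi_Y_scale: "y \<in> Y \<Longrightarrow> v \<in> V k \<Longrightarrow> psi k y (mv_const c * v) = mv_const c * psi k y v"
  by (simp add: psi_Y V_scale mv_subst_mult mv_subst_const)

lemma hecke_add:
  assumes "f \<in> ind k (V k)" "f' \<in> ind k (V k)"
  shows "hecke k (\<lambda>g. f g + f' g) h = hecke k f h + hecke k f' h"
proof (cases "h \<in> G")
  case True
  have "(\<Sum>y\<in>Y. psi k y (f (matrix_inv y ** h) + f' (matrix_inv y ** h)))
      = (\<Sum>y\<in>Y. psi k y (f (matrix_inv y ** h)) + psi k y (f' (matrix_inv y ** h)))"
    by (rule sum.cong) (simp_all add: psi_Y_add ind_V[OF assms(1)] ind_V[OF assms(2)])
  then show ?thesis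
    using True assms ind_V_add[OF assms] by (simp add: hecke_eq sum.distrib)
qed (simp add: hecke_outside)

lemma hecke_scale:
  assumes "f \<in> ind k (V k)"
  shows "hecke k (\<lambda>g. mv_const c * f g) h = mv_const c * hecke k f h"
proof (cases "h \<in> G")
  case True
  have "(\<Sum>y\<in>Y. psi k y (mv_const c * f (matrix_inv y ** h)))
      = (\<Sum>y\<in>Y. mv_const c * psi k y (f (matrix_inv y ** h)))"
    by (rule sum.cong) (simp_all add: psi_Y_scale ind_V[OF assms(1)])
  then show ?thesis
    using True assms ind_V_scale[OF assms] by (simp add: hecke_eq sum_distrib_left)
qed (simp add: hecke_outside)

lemma hecke_V0:
  assumes "f \<in> ind k (V0 k)"
  shows "hecke k f \<in> ind k (V0 k)"
  unfolding ind_V0_iff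
proof (intro conjI allI)
  have f: "f \<in> ind k (V k)" "\<And>g. f g \<in> V0 k" using assms by (simp_all add: ind_V0_iff)
  show "hecke k f \<in> ind k (V k)" using hecke_ind f(1) .
  show "hecke k f g \<in> V0 k" for g
  proof (cases "g \<in> G")
    case True
    then show ?thesis unfolding hecke_eq[OF f(1) True] by (intro V0_sum psi_Y_V0 f(2))
  qed (simp add: hecke_outside V0_0)
qed

lemma hecke_minus_ind: "f \<in> ind k (V k) \<Longrightarrow> hecke_minus k a f \<in> ind k (V k)"
  unfolding hecke_minus_def[abs_def] by (intro ind_V_diff hecke_ind ind_V_scale)

lemma hecke_minus_V0:
  assumes "a \<in> OC" "f \<in> ind k (V0 k)"
  shows "hecke_minus k a f \<in> ind k (V0 k)"
proof -
  have "hecke_minus k a f = (\<lambda>g. hecke k f g + mv_const (- a) * f g)"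
    by (simp add: hecke_minus_def[abs_def] mv_const_uminus)
  then show ?thesis
    using ind_V0_add[OF hecke_V0[OF assms(2)] ind_V0_scale[OF C.integers_uminus[OF assms(1)] assms(2)]] by simp
qed

lemma hecke_minus_add:
  assumes "f \<in> ind k (V k)" "f' \<in> ind k (V k)"
  shows "hecke_minus k a (\<lambda>g. f g + f' g) h = hecke_minus k a f h + hecke_minus k a f' h"
  using hecke_add[OF assms] by (simp add: hecke_minus_def algebra_simps)

lemma hecke_minus_scale:
  assumes "f \<in> ind k (V k)"
  shows "hecke_minus k a (\<lambda>g. mv_const c * f g) h = mv_const c * hecke_minus k a f h"
  using hecke_scale[OF assms] by (simp add: hecke_minus_def algebra_simps)

lemma hecke_minus_0: "hecke_minus k a (\<lambda>_. 0) h = 0"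
  using hecke_minus_scale[OF ind_V_0, of k a 0 h] by (simp add: mv_const_0)

lemma hecke_minus_sum:
  "(\<And>i. i \<in> A \<Longrightarrow> f i \<in> ind k (V k)) \<Longrightarrow> hecke_minus k a (\<lambda>g. \<Sum>i\<in>A. f i g) h = (\<Sum>i\<in>A. hecke_minus k a (f i) h)"
  by (induction A rule: infinite_finite_induct) (simp_all add: hecke_minus_0 hecke_minus_add ind_V_sum)

lemma translate_ind:
  assumes f: "f \<in> ind k (V k)" and b: "b \<in> G"
  shows "(\<lambda>g. f (g ** b)) \<in> ind k (V k)"
  unfolding ind_V_iff
proof (intro conjI allI impI ballI)
  show "f (g ** b) = 0" if "g \<notin> G" for g
    using that by (intro ind_outside[OF f]) (simp add: G_iff_det det_mul)
  show "f (g ** b) \<in> V k" for g using ind_V f .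
  show "f (\<kappa> ** g ** b) = rho k \<kappa> (f (g ** b))" if "\<kappa> \<in> KZ" "g \<in> G" for \<kappa> g
    using ind_equivariant[OF f that(1) G_mult[OF that(2) b]] by (simp add: matrix_mul_assoc)
  obtain A where A: "finite A" "A \<subseteq> G" "\<forall>g\<in>G. f g \<noteq> 0 \<longrightarrow> (\<exists>h\<in>A. \<exists>\<kappa>\<in>KZ. g = \<kappa> ** h)"
    using ind_finite_support[OF f] unfolding finite_support_def by blast
  show "finite_support (\<lambda>g. f (g ** b))"
    unfolding finite_support_def
  proof (intro exI[of _ "(\<lambda>a. a ** matrix_inv b) ` A"] conjI ballI impI)
    show "finite ((\<lambda>a. a ** matrix_inv b) ` A)" using A(1) by blast
    show "(\<lambda>a. a ** matrix_inv b) ` A \<subseteq> G" using A(2) G_mult G_matrix_inv[OF b] by blast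
    fix g assume g: "g \<in> G" "f (g ** b) \<noteq> 0"
    then obtain a \<kappa> where a: "a \<in> A" "\<kappa> \<in> KZ" "g ** b = \<kappa> ** a" using A(3) G_mult[OF g(1) b] by blast
    then have "g = \<kappa> ** (a ** matrix_inv b)"
      using G_cancel(3)[OF b, of g] by (simp add: matrix_mul_assoc)
    then show "\<exists>h\<in>(\<lambda>a. a ** matrix_inv b) ` A. \<exists>\<kappa>\<in>KZ. g = \<kappa> ** h" using a by blast
  qed
qed

text \<open>The sum over \<open>Y\<close> multiplies the argument on the left and translation
  multiplies it on the right.\<close>

lemma hecke_minus_translate:
  assumes f: "f \<in> ind k (V k)" and b: "b \<in> G"
  shows "hecke_minus k a (\<lambda>g. f (g ** b)) h = hecke_minus k a f (h ** b)"
proof (cases "h \<in> G")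
  case True
  then show ?thesis
    using hecke_eq[OF f G_mult[OF True b]] hecke_eq[OF translate_ind[OF assms] True]
    by (simp add: hecke_minus_def matrix_mul_assoc)
next
  case False
  then have "h ** b \<notin> G" by (simp add: G_iff_det det_mul)
  then show ?thesis using False ind_outside[OF f] by (simp add: hecke_minus_def hecke_outside)
qed

end

section \<open>Closedness of finite-dimensional subspaces\<close>

context gl2_setup
begin

abbreviation vp :: 'c where "vp \<equiv> \<sigma>\<^sub>0 \<pi>"

lemma vp_nonzero: "vp \<noteq> 0"
  using S_eq_0_iff[OF \<sigma>\<^sub>0] pi_nonzero by simp

lemma vp_integral: "vp \<in> OC"
  using S_integral[OF \<sigma>\<^sub>0 pi_integral] .

text \<open>Transported from F by the embedding; it makes high powers of \<open>vp\<close> divisible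
  by high powers of p in C.\<close>

lemma vp_power_p: "\<exists>e. C.odvd C.pe (vp ^ e)"
proof -
  obtain e z where e: "z \<in> OF" "\<pi> ^ e = F.pe * z" using pi_power_p unfolding F.odvd_def by blast
  interpret h: field_hom \<sigma>\<^sub>0 using S_hom[OF \<sigma>\<^sub>0] .
  have "\<sigma>\<^sub>0 F.pe = C.pe" by (simp flip: F.of_nat_card C.of_nat_card add: hom_distribs)
  then have "vp ^ e = C.pe * \<sigma>\<^sub>0 z" using arg_cong[OF e(2), of \<sigma>\<^sub>0] by (simp add: hom_distribs)
  then show ?thesis unfolding C.odvd_def using S_integral[OF \<sigma>\<^sub>0 e(1)] by blast
qed

lemma infinitely_vp_divisible:
  assumes "\<And>n. C.odvd (vp ^ n) x"
  shows "x = 0"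
proof (rule C.infinitely_p_divisible)
  fix n
  obtain e where e: "C.odvd C.pe (vp ^ e)" using vp_power_p by blast
  show "C.odvd (C.pe ^ n) x"
    using C.odvd_trans[OF C.odvd_power[OF e, of n] assms[of "e * n", unfolded power_mult]] .
qed

lemma vp_denominator: "\<exists>t. vp ^ t * c \<in> OC"
proof -
  obtain e z where e: "z \<in> OC" "vp ^ e = C.pe * z" using vp_power_p unfolding C.odvd_def by blast
  obtain t where t: "C.pe ^ t * c \<in> OC" using C.integral_multiple by blast
  have "vp ^ (e * t) * c = z ^ t * (C.pe ^ t * c)"
    by (simp add: power_mult e(2) power_mult_distrib mult_ac)
  then show ?thesis using t e(1) C.integers_add_mult(2) C.integers_power by metis
qed

lemma vp_power_mono: "vp ^ s * c \<in> OC \<Longrightarrow> s \<le> t \<Longrightarrow> vp ^ t * c \<in> OC"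
proof -
  assume "vp ^ s * c \<in> OC" "s \<le> t"
  moreover have "vp ^ t = vp ^ (t - s) * vp ^ s" using \<open>s \<le> t\<close> by (simp flip: power_add)
  ultimately show ?thesis using vp_integral by (simp add: mult.assoc C.integers_add_mult C.integers_power)
qed

text \<open>Bounded denominators. On an infinite domain this is a genuine condition; it keeps the
  loss of precision in the elimination below uniform.\<close>

definition bounded_fun :: "('x \<Rightarrow> 'c) \<Rightarrow> bool" where
  "bounded_fun u \<longleftrightarrow> (\<exists>t. \<forall>x. vp ^ t * u x \<in> OC)"

lemma bounded_fun_scale: "bounded_fun u \<Longrightarrow> bounded_fun (\<lambda>x. c * u x)"
proof -
  assume "bounded_fun u"
  then obtain t where t: "\<And>x. vp ^ t * u x \<in> OC" unfolding bounded_fun_def by blast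
  obtain s where s: "vp ^ s * c \<in> OC" using vp_denominator by blast
  have "vp ^ (s + t) * (c * u x) \<in> OC" for x
    using C.integers_add_mult(2)[OF s t[of x]] by (simp add: power_add mult_ac)
  then show ?thesis unfolding bounded_fun_def by blast
qed

lemma bounded_fun_diff: "bounded_fun v \<Longrightarrow> bounded_fun u \<Longrightarrow> bounded_fun (\<lambda>x. v x - u x)"
proof -
  assume "bounded_fun v" "bounded_fun u"
  then obtain s t where s: "\<And>x. vp ^ s * v x \<in> OC" and t: "\<And>x. vp ^ t * u x \<in> OC" unfolding bounded_fun_def by blast
  have "vp ^ (s + t) * v x - vp ^ (s + t) * u x \<in> OC" for x
    by (intro C.integers_diff vp_power_mono[OF s] vp_power_mono[OF t]) auto
  then show ?thesis unfolding bounded_fun_def by (auto simp: right_diff_distrib)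
qed

text \<open>Induction on the number of generators: choose a point where a generator does not vanish and
  subtract multiples of it so that all other functions vanish there.\<close>

lemma span_closed:
  fixes u :: "'j \<Rightarrow> 'x \<Rightarrow> 'c"
  assumes "finite J" "\<And>j. j \<in> J \<Longrightarrow> bounded_fun (u j)"
    "\<And>n. \<exists>c. \<forall>x. C.odvd (vp ^ n) (f x - (\<Sum>j\<in>J. c j * u j x))"
  shows "\<exists>c. \<forall>x. f x = (\<Sum>j\<in>J. c j * u j x)"
  using assms
proof (induction J arbitrary: f u)
  case empty
  then show ?case using infinitely_vp_divisible by (metis diff_zero sum.empty)
next
  case (insert j J)
  show ?case
  proof (cases "\<forall>x. u j x = 0")
    case True
    then show ?thesis
      using insert.IH[of u f] insert.prems insert.hyps by simp
  next
    case False
    then obtain x0 where x0: "u j x0 \<noteq> 0" by blast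
    define a where "a = inverse (u j x0)"
    have a: "a * u j x0 = 1" using x0 by (simp add: a_def)
    define u' where "u' i x = u i x - u i x0 * a * u j x" for i x
    define f' where "f' x = f x - f x0 * a * u j x" for x
    have bj: "bounded_fun (u j)" using insert.prems by simp
    have "\<exists>c. \<forall>x. f' x = (\<Sum>i\<in>J. c i * u' i x)"
    proof (rule insert.IH)
      show "bounded_fun (u' i)" if "i \<in> J" for i
        unfolding u'_def[abs_def] using insert.prems(1) that by (intro bounded_fun_diff bounded_fun_scale) auto
      fix n
      obtain t where t: "\<And>x. vp ^ t * (a * u j x) \<in> OC"
        using bounded_fun_scale[OF bj, of a] unfolding bounded_fun_def by blast
      \<comment> \<open>Subtracting a multiple of \<open>a * u j\<close> costs the denominator
        \<open>vp ^ t\<close>, hence the approximation is requested with exponent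
        \<open>n + t\<close>.\<close>
      obtain c where "\<And>x. C.odvd (vp ^ (n + t)) (f x - (\<Sum>i\<in>insert j J. c i * u i x))"
        using insert.prems(2)[of "n + t"] by blast
      then obtain e where e: "\<And>x. e x \<in> OC" "\<And>x. f x - (\<Sum>i\<in>insert j J. c i * u i x) = vp ^ (n + t) * e x"
        unfolding C.odvd_def by metis
      have e': "f x = c j * u j x + (\<Sum>i\<in>J. c i * u i x) + vp ^ (n + t) * e x" for x
        using e(2)[of x] insert.hyps by (simp add: diff_eq_eq add_ac)
      have "f' x - (\<Sum>i\<in>J. c i * u' i x) = vp ^ n * (vp ^ t * e x - vp ^ t * (a * u j x) * e x0)" for x
      proof -
        have "(\<Sum>i\<in>J. c i * u' i x) = (\<Sum>i\<in>J. c i * u i x) - (\<Sum>i\<in>J. c i * u i x0) * (a * u j x)"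
          unfolding u'_def by (simp add: right_diff_distrib sum_subtractf sum_distrib_right mult.assoc)
        moreover have "f x0 * (a * u j x) = c j * u j x + (\<Sum>i\<in>J. c i * u i x0) * (a * u j x)
            + vp ^ (n + t) * e x0 * (a * u j x)"
        proof -
          have "c j * u j x0 * (a * u j x) = c j * u j x * (a * u j x0)" by (simp only: mult_ac)
          then show ?thesis unfolding e'[of x0] by (simp add: distrib_right a)
        qed
        ultimately show ?thesis
          unfolding f'_def by (subst e'[of x]) (simp add: power_add right_diff_distrib mult.assoc mult.left_commute mult.commute[of "e x0"])
      qed
      then show "\<exists>c. \<forall>x. C.odvd (vp ^ n) (f' x - (\<Sum>i\<in>J. c i * u' i x))"
        using e(1) t vp_integral
        by (intro exI[of _ c] allI) (simp add: C.odvd_self_mult C.integers_diff C.integers_add_mult C.integers_power)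
    qed
    then obtain c where c: "\<And>x. f' x = (\<Sum>i\<in>J. c i * u' i x)" by blast
    \<comment> \<open>Undoing the elimination: the coefficient of \<open>u j\<close> collects what
      was subtracted from \<open>f\<close> and from the other generators.\<close>
    define c' where "c' = c(j := f x0 * a - (\<Sum>i\<in>J. c i * u i x0) * a)"
    have "f x = (\<Sum>i\<in>insert j J. c' i * u i x)" for x
    proof -
      have "(\<Sum>i\<in>J. c i * u' i x) = (\<Sum>i\<in>J. c i * u i x) - (\<Sum>i\<in>J. c i * u i x0) * (a * u j x)"
        unfolding u'_def by (simp add: right_diff_distrib sum_subtractf sum_distrib_right mult.assoc)
      then have "f x = f x0 * a * u j x + ((\<Sum>i\<in>J. c i * u i x) - (\<Sum>i\<in>J. c i * u i x0) * (a * u j x))"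
        using c[of x] unfolding f'_def by (simp add: diff_eq_eq add.commute)
      moreover have "(\<Sum>i\<in>J. c' i * u i x) = (\<Sum>i\<in>J. c i * u i x)"
        using insert.hyps by (intro sum.cong) (auto simp: c'_def)
      ultimately show ?thesis using insert.hyps by (simp add: c'_def algebra_simps)
    qed
    then show ?thesis by blast
  qed
qed

section \<open>Supports and restriction to half of the tree\<close>

definition vert :: "bool \<Rightarrow> nat \<Rightarrow> 'f \<Rightarrow> 'f^2^2" where
  "vert b = (if b then g0 else g1)"

text \<open>\<open>vert True n \<mu>\<close> has distance \<open>n\<close> from the base vertex and
  \<open>vert False n \<mu>\<close> has distance \<open>n + 1\<close>, so this describes the ball of
  radius \<open>N\<close>.\<close>

definition inside :: "nat \<Rightarrow> bool \<Rightarrow> nat \<Rightarrow> bool" where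
  "inside N b n \<longleftrightarrow> (if b then n \<le> N else n < N)"

lemma vert_G: "vert b n \<mu> \<in> G"
  by (simp add: vert_def g0_G g1_G)

lemma vert_unique:
  assumes "\<mu> \<in> I n" "\<nu> \<in> I m" "\<kappa> \<in> KZ" "vert b n \<mu> ** \<kappa> = vert b' m \<nu>"
  shows "b = b' \<and> n = m \<and> \<mu> = \<nu>"
proof (cases "b = b'")
  case True
  then show ?thesis
    using g0_unique[OF assms(1-3)] g1_unique[OF assms(1-3)] assms(4)
    by (cases b) (auto simp: vert_def)
next
  case False
  have inv: "vert b' m \<nu> ** matrix_inv \<kappa> = vert b n \<mu>"
    unfolding assms(4)[symmetric] by (rule G_cancel(3)[OF KZ_G[OF assms(3)]])
  show ?thesis
  proof (cases b)
    case True
    then show ?thesis using g0_neq_g1[OF assms(1-3)] assms(4) False by (auto simp: vert_def)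
  next
    case b: False
    then show ?thesis
      using g0_neq_g1[OF assms(2,1) KZ_matrix_inv[OF assms(3)]] inv False by (auto simp: vert_def)
  qed
qed

lemma vert_cases:
  assumes "h \<in> G"
  obtains b n \<mu> where "\<mu> \<in> I n" "h ** vert b n \<mu> \<in> KZ"
proof -
  have "\<exists>b n. \<exists>\<mu>\<in>I n. \<exists>\<kappa>\<in>KZ. matrix_inv h = vert b n \<mu> ** \<kappa>"
    using G_vertices[OF G_matrix_inv[OF assms]]
  proof
    assume "matrix_inv h \<in> H0"
    then obtain n \<mu> \<kappa> where "\<mu> \<in> I n" "\<kappa> \<in> KZ" "matrix_inv h = g0 n \<mu> ** \<kappa>" unfolding H0_def by blast
    then show ?thesis by (intro exI[of _ True] exI[of _ n] bexI[of _ \<mu>] bexI[of _ \<kappa>]) (simp_all add: vert_def)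
  next
    assume "matrix_inv h \<in> H1"
    then obtain n \<mu> \<kappa> where "\<mu> \<in> I n" "\<kappa> \<in> KZ" "matrix_inv h = g1 n \<mu> ** \<kappa>" unfolding H1_def by blast
    then show ?thesis by (intro exI[of _ False] exI[of _ n] bexI[of _ \<mu>] bexI[of _ \<kappa>]) (simp_all add: vert_def)
  qed
  then obtain b n \<mu> \<kappa> where v: "\<mu> \<in> I n" "\<kappa> \<in> KZ" "matrix_inv h = vert b n \<mu> ** \<kappa>" by blast
  have one: "h ** vert b n \<mu> ** \<kappa> = mat 1"
    using G_inv(1)[OF assms] v(3) by (simp add: matrix_mul_assoc)
  have "h ** vert b n \<mu> = matrix_inv \<kappa>"
    using G_cancel(3)[OF KZ_G[OF v(2)], of "h ** vert b n \<mu>"] unfolding one by simp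
  then show thesis using that v KZ_matrix_inv by metis
qed

lemma vert_KZ_unique:
  assumes "h ** vert b n \<mu> \<in> KZ" "h ** vert b' m \<nu> \<in> KZ" "\<mu> \<in> I n" "\<nu> \<in> I m" "h \<in> G"
  shows "b = b' \<and> n = m \<and> \<mu> = \<nu>"
proof (rule vert_unique[OF assms(3,4)])
  let ?\<kappa> = "matrix_inv (h ** vert b n \<mu>) ** (h ** vert b' m \<nu>)"
  show "?\<kappa> \<in> KZ" using assms(1,2) KZ_mult KZ_matrix_inv by blast
  show "vert b n \<mu> ** ?\<kappa> = vert b' m \<nu>"
    using assms(5) by (simp add: matrix_inv_mult vert_G matrix_mul_assoc[symmetric] G_cancel)
qed

text \<open>The value of \<open>f\<close> at the vertex \<open>gKZ\<close>.\<close>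

abbreviation atv :: "('f, 'c) ifun \<Rightarrow> 'f^2^2 \<Rightarrow> ('f, 'c) tensor" where
  "atv f g \<equiv> f (matrix_inv g)"

lemma inv_vert_KZ: "matrix_inv (vert b n \<mu>) ** vert b n \<mu> \<in> KZ"
  by (simp add: G_inv vert_G one_KZ)

lemma bracket_ind:
  assumes g: "g \<in> G" and v: "v \<in> V k"
  shows "bracket k g v \<in> ind k (V k)"
  unfolding ind_V_iff
proof (intro conjI allI impI ballI)
  show "bracket k g v h = 0" if "h \<notin> G" for h
    using that KZ_G[of "h ** g"] unfolding bracket_def by (auto simp: G_iff_det det_mul)
  show "bracket k g v h \<in> V k" for h unfolding bracket_def using rho_V[OF v] V_0 by simp
  show "bracket k g v (\<kappa> ** h) = rho k \<kappa> (bracket k g v h)" if \<kappa>: "\<kappa> \<in> KZ" and h: "h \<in> G" for \<kappa> h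
  proof -
    have "\<kappa> ** h ** g \<in> KZ \<longleftrightarrow> h ** g \<in> KZ"
      using KZ_mult[OF \<kappa>, of "h ** g"] KZ_mult[OF KZ_matrix_inv[OF \<kappa>], of "\<kappa> ** h ** g"]
        G_cancel(1)[OF KZ_G[OF \<kappa>], of "h ** g"] by (auto simp: matrix_mul_assoc)
    then show ?thesis
      unfolding bracket_def using rho_mult[OF KZ_G[OF \<kappa>] G_mult[OF h g] v] by (simp add: matrix_mul_assoc rho_0)
  qed
  show "finite_support (bracket k g v)"
    unfolding finite_support_def
  proof (intro exI[of _ "{matrix_inv g}"] conjI ballI impI)
    show "{matrix_inv g} \<subseteq> G" using G_matrix_inv[OF g] by blast
    fix h assume h: "h \<in> G" "bracket k g v h \<noteq> 0"
    then have "h ** g \<in> KZ" unfolding bracket_def by (auto split: if_splits)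
    moreover have "h = h ** g ** matrix_inv g" using G_cancel(3)[OF g] by simp
    ultimately show "\<exists>x\<in>{matrix_inv g}. \<exists>\<kappa>\<in>KZ. h = \<kappa> ** x" by blast
  qed simp
qed

lemma bracket_at:
  assumes "f \<in> ind k (V k)" "g \<in> G" "h ** g \<in> KZ"
  shows "bracket k g (atv f g) h = f h"
  using ind_equivariant[OF assms(1,3) G_matrix_inv[OF assms(2)]] G_cancel(3)[OF assms(2), of h] assms(3)
  unfolding bracket_def by simp

text \<open>Every \<open>h\<close> in \<open>G\<close> belongs to a single vertex, so at most one
  bracket of the sum is nonzero at \<open>h\<close>.\<close>

lemma sum_brackets:
  assumes D: "finite D" "D \<subseteq> {(n, \<mu>). \<mu> \<in> I n}"
    and h: "h \<in> G" "h ** vert b n \<mu> \<in> KZ" "\<mu> \<in> I n"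
  shows "(\<Sum>(m, \<nu>)\<in>D. bracket k (g0 m \<nu>) (v True m \<nu>) h + bracket k (g1 m \<nu>) (v False m \<nu>) h)
    = (if (n, \<mu>) \<in> D then rho k (h ** vert b n \<mu>) (v b n \<mu>) else 0)"
proof -
  have z: "bracket k (vert b' m \<nu>) x h = (if b' = b \<and> (m, \<nu>) = (n, \<mu>) then rho k (h ** vert b n \<mu>) x else 0)"
    if \<nu>: "\<nu> \<in> I m" for b' m \<nu> x
  proof (cases "h ** vert b' m \<nu> \<in> KZ")
    case True
    have "b = b' \<and> n = m \<and> \<mu> = \<nu>" using vert_KZ_unique[OF h(2) True h(3) \<nu> h(1)] .
    then show ?thesis using h(2) by (simp add: bracket_def)
  next
    case False
    have "\<not> (b' = b \<and> (m, \<nu>) = (n, \<mu>))"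
    proof
      assume "b' = b \<and> (m, \<nu>) = (n, \<mu>)"
      then have "vert b' m \<nu> = vert b n \<mu>" by simp
      then show False using False h(2) by simp
    qed
    then show ?thesis using False unfolding bracket_def by (simp only: if_False)
  qed
  have "(\<Sum>(m, \<nu>)\<in>D. bracket k (g0 m \<nu>) (v True m \<nu>) h + bracket k (g1 m \<nu>) (v False m \<nu>) h)
      = (\<Sum>x\<in>D. if x = (n, \<mu>) then rho k (h ** vert b n \<mu>) (v b n \<mu>) else 0)"
  proof (rule sum.cong[OF refl])
    fix x assume x: "x \<in> D"
    obtain m \<nu> where mn: "x = (m, \<nu>)" by (cases x)
    have \<nu>: "\<nu> \<in> I m" using x D(2) mn by auto
    show "(case x of (m, \<nu>) \<Rightarrow> bracket k (g0 m \<nu>) (v True m \<nu>) h + bracket k (g1 m \<nu>) (v False m \<nu>) h)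
        = (if x = (n, \<mu>) then rho k (h ** vert b n \<mu>) (v b n \<mu>) else 0)"
      using z[OF \<nu>, of True "v True m \<nu>"] z[OF \<nu>, of False "v False m \<nu>"]
      by (cases b) (auto simp: mn vert_def)
  qed
  then show ?thesis using D(1) by simp
qed

lemma finite_nonzero_vertices:
  assumes f: "f \<in> ind k (V k)"
  shows "finite {(n, \<mu>). \<mu> \<in> I n \<and> atv f (vert b n \<mu>) \<noteq> 0}"
proof (rule finite_imageD)
  let ?D = "{(n, \<mu>). \<mu> \<in> I n \<and> atv f (vert b n \<mu>) \<noteq> 0}"
  let ?c = "\<lambda>(n, \<mu>). gcos (vert b n \<mu>)"
  show "finite (?c ` ?D)"
  proof (rule finite_subset[OF _ finite_fcosets[OF f]], clarify)
    fix n \<mu> assume nz: "atv f (vert b n \<mu>) \<noteq> 0"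
    obtain \<kappa> where \<kappa>: "\<kappa> \<in> KZ" "rep (gcos (vert b n \<mu>)) = vert b n \<mu> ** \<kappa>" using rep_gcos[OF vert_G] by blast
    have "atv f (vert b n \<mu> ** \<kappa>) = rho k (matrix_inv \<kappa>) (atv f (vert b n \<mu>))"
      using ind_equivariant[OF f KZ_matrix_inv[OF \<kappa>(1)] G_matrix_inv[OF vert_G]]
      by (simp add: matrix_inv_mult vert_G KZ_G[OF \<kappa>(1)])
    moreover have "atv f (vert b n \<mu>) = rho k \<kappa> (rho k (matrix_inv \<kappa>) (atv f (vert b n \<mu>)))"
      using rho_mult[OF KZ_G[OF \<kappa>(1)] G_matrix_inv[OF KZ_G[OF \<kappa>(1)]] ind_V[OF f]]
        G_inv(1)[OF KZ_G[OF \<kappa>(1)]] rho_1[OF ind_V[OF f]] by metis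
    ultimately have "atv f (rep (gcos (vert b n \<mu>))) \<noteq> 0" using nz \<kappa>(2) rho_0 by metis
    then show "gcos (vert b n \<mu>) \<in> cosets \<and> atv f (rep (gcos (vert b n \<mu>))) \<noteq> 0"
      unfolding cosets_eq using vert_G by blast
  qed
  show "inj_on ?c ?D"
  proof (rule inj_onI, clarify)
    fix n \<mu> m \<nu> assume "\<mu> \<in> I n" "\<nu> \<in> I m" "gcos (vert b n \<mu>) = gcos (vert b m \<nu>)"
    moreover have "vert b m \<nu> ** mat 1 \<in> gcos (vert b m \<nu>)" unfolding gcos_def using one_KZ by blast
    ultimately have "vert b m \<nu> \<in> gcos (vert b n \<mu>)" by simp
    then obtain \<kappa> where "\<kappa> \<in> KZ" "vert b n \<mu> ** \<kappa> = vert b m \<nu>" unfolding gcos_def by force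
    then show "n = m \<and> \<mu> = \<nu>" using vert_unique \<open>\<mu> \<in> I n\<close> \<open>\<nu> \<in> I m\<close> by blast
  qed
qed

section \<open>Decompositions and the spaces \<open>B\<close> and \<open>B0\<close> in terms of
  values at vertices\<close>

lemma decomposition_exists:
  assumes f: "f \<in> ind k (V k)"
  shows "decomposition k f (\<lambda>n \<mu>. atv f (g0 n \<mu>)) (\<lambda>n \<mu>. atv f (g1 n \<mu>))"
proof -
  define D where "D = {(n, \<mu>). \<mu> \<in> I n \<and> (atv f (g0 n \<mu>) \<noteq> 0 \<or> atv f (g1 n \<mu>) \<noteq> 0)}"
  have "D = {(n, \<mu>). \<mu> \<in> I n \<and> atv f (vert True n \<mu>) \<noteq> 0} \<union> {(n, \<mu>). \<mu> \<in> I n \<and> atv f (vert False n \<mu>) \<noteq> 0}"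
    by (auto simp: D_def vert_def)
  then have fin: "finite D" using finite_nonzero_vertices[OF f] by simp
  have sub: "D \<subseteq> {(n, \<mu>). \<mu> \<in> I n}" by (auto simp: D_def)
  have eq: "f h = (\<Sum>(n, \<mu>)\<in>D. bracket k (g0 n \<mu>) (atv f (g0 n \<mu>)) h + bracket k (g1 n \<mu>) (atv f (g1 n \<mu>)) h)" for h
  proof (cases "h \<in> G")
    case True
    then obtain b n \<mu> where v: "\<mu> \<in> I n" "h ** vert b n \<mu> \<in> KZ" by (rule vert_cases)
    have fh: "f h = rho k (h ** vert b n \<mu>) (atv f (vert b n \<mu>))"
      using bracket_at[OF f vert_G v(2)] v(2) by (simp add: bracket_def)
    have "(n, \<mu>) \<notin> D \<Longrightarrow> atv f (vert b n \<mu>) = 0" using v(1) by (auto simp: D_def vert_def)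
    then show ?thesis
      using sum_brackets[OF fin sub True v(2,1), of k "\<lambda>b n \<mu>. atv f (vert b n \<mu>)"] fh
      by (auto simp: vert_def rho_0)
  next
    case False
    then show ?thesis
      using ind_outside[OF f] ind_outside[OF bracket_ind[OF g0_G ind_V[OF f]]]
        ind_outside[OF bracket_ind[OF g1_G ind_V[OF f]]] by (simp add: case_prod_unfold)
  qed
  show ?thesis
    unfolding decomposition_def Let_def D_def[symmetric]
    by (intro conjI allI ballI fin ind_V[OF f]) (rule eq)
qed

text \<open>Evaluation at a vertex isolates its coefficient. Decompositions are therefore unique,
  and the existential quantifiers in \<open>B\<close> and \<open>B0\<close> become vanishing
  conditions.\<close>

lemma decomposition_values:
  assumes d: "decomposition k f v0 v1" and \<mu>: "\<mu> \<in> I n"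
  shows "v0 n \<mu> = atv f (g0 n \<mu>)" "v1 n \<mu> = atv f (g1 n \<mu>)"
proof -
  define D where "D = {(n, \<mu>). \<mu> \<in> I n \<and> (v0 n \<mu> \<noteq> 0 \<or> v1 n \<mu> \<noteq> 0)}"
  define v where "v b = (if b then v0 else v1)" for b
  have fin: "finite D" and eq: "\<And>h. f h = (\<Sum>(n, \<mu>)\<in>D. bracket k (g0 n \<mu>) (v0 n \<mu>) h + bracket k (g1 n \<mu>) (v1 n \<mu>) h)"
    using d unfolding decomposition_def Let_def D_def by auto
  have sub: "D \<subseteq> {(n, \<mu>). \<mu> \<in> I n}" by (auto simp: D_def)
  have V: "v b n \<mu> \<in> V k" for b using d \<mu> unfolding decomposition_def v_def by auto
  have "atv f (vert b n \<mu>) = v b n \<mu>" for b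
  proof -
    have "atv f (vert b n \<mu>) = (if (n, \<mu>) \<in> D then rho k (mat 1) (v b n \<mu>) else 0)"
      using sum_brackets[OF fin sub G_matrix_inv[OF vert_G] inv_vert_KZ \<mu>, of k v] eq
      by (simp add: v_def G_inv vert_G)
    also have "\<dots> = v b n \<mu>"
    proof (cases "(n, \<mu>) \<in> D")
      case True
      then show ?thesis by (simp add: rho_1[OF V[of b]])
    next
      case False
      then show ?thesis using \<mu> by (simp add: D_def v_def)
    qed
    finally show ?thesis .
  qed
  from this[of True] this[of False] show "v0 n \<mu> = atv f (g0 n \<mu>)" "v1 n \<mu> = atv f (g1 n \<mu>)"
    by (simp_all add: v_def vert_def)
qed

lemma B_iff: "f \<in> B k N \<longleftrightarrow> f \<in> ind k (V k) \<and> (\<forall>b n. \<forall>\<mu>\<in>I n. \<not> inside N b n \<longrightarrow> atv f (vert b n \<mu>) = 0)"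
proof
  assume "f \<in> B k N"
  then obtain v0 v1 where f: "f \<in> ind k (V k)" and d: "decomposition k f v0 v1"
    and z: "\<forall>n. \<forall>\<mu>\<in>I n. (n > N \<longrightarrow> v0 n \<mu> = 0) \<and> (n + 1 > N \<longrightarrow> v1 n \<mu> = 0)"
    unfolding B_def by blast
  have "atv f (vert b n \<mu>) = 0" if "\<mu> \<in> I n" "\<not> inside N b n" for b n \<mu>
    using decomposition_values[OF d that(1)] z that by (cases b) (auto simp: vert_def inside_def)
  then show "f \<in> ind k (V k) \<and> (\<forall>b n. \<forall>\<mu>\<in>I n. \<not> inside N b n \<longrightarrow> atv f (vert b n \<mu>) = 0)" using f by blast
next
  assume f: "f \<in> ind k (V k) \<and> (\<forall>b n. \<forall>\<mu>\<in>I n. \<not> inside N b n \<longrightarrow> atv f (vert b n \<mu>) = 0)"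
  have "(n > N \<longrightarrow> atv f (g0 n \<mu>) = 0) \<and> (n + 1 > N \<longrightarrow> atv f (g1 n \<mu>) = 0)" if "\<mu> \<in> I n" for n \<mu>
  proof -
    have "\<not> inside N b n \<longrightarrow> atv f (vert b n \<mu>) = 0" for b using f that by blast
    from this[of True] this[of False] show ?thesis by (auto simp: vert_def inside_def)
  qed
  then show "f \<in> B k N" unfolding B_def using f decomposition_exists by blast
qed

lemma B0_iff: "f \<in> B0 k \<longleftrightarrow> f \<in> ind k (V k) \<and> (\<forall>n. \<forall>\<mu>\<in>I n. atv f (g1 n \<mu>) = 0)"
  unfolding B0_def using decomposition_exists decomposition_values(2) by (auto simp: Bex_def; metis)

section \<open>Divisibility at vertices, with possibly negative exponents, and restriction to unions
  of vertices\<close>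

definition dv :: "('f, 'c) weight \<Rightarrow> int \<Rightarrow> ('f, 'c) tensor \<Rightarrow> bool" where
  "dv k e x \<longleftrightarrow> mv_const (vp powi (- e)) * x \<in> V0 k"

lemma dv_mono: "dv k e x \<Longrightarrow> e' \<le> e \<Longrightarrow> dv k e' x"
proof -
  assume d: "dv k e x" and le: "e' \<le> e"
  have "vp powi (- e') = vp ^ nat (e - e') * vp powi (- e)"
    using le vp_nonzero by (simp flip: power_int_of_nat power_int_add)
  then have "mv_const (vp powi (- e')) * x = mv_const (vp ^ nat (e - e')) * (mv_const (vp powi (- e)) * x)"
    by (simp add: mv_const_mult mult.assoc)
  then show ?thesis
    using d V0_scale[of "vp ^ nat (e - e')"] C.integers_power[OF vp_integral] unfolding dv_def by simp
qed

lemma dv_rho: "\<kappa> \<in> KZ \<Longrightarrow> dv k e x \<Longrightarrow> dv k e (rho k \<kappa> x)"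
  unfolding dv_def by (simp add: rho_V0 flip: rho_scale)

lemma dv_rho_iff:
  assumes "\<kappa> \<in> KZ" "x \<in> V k"
  shows "dv k e (rho k \<kappa> x) \<longleftrightarrow> dv k e x"
proof
  assume "dv k e (rho k \<kappa> x)"
  then have "dv k e (rho k (matrix_inv \<kappa>) (rho k \<kappa> x))" by (rule dv_rho[OF KZ_matrix_inv[OF assms(1)]])
  moreover have "rho k (matrix_inv \<kappa>) (rho k \<kappa> x) = x"
    using rho_mult[OF G_matrix_inv[OF KZ_G[OF assms(1)]] KZ_G[OF assms(1)] assms(2)] rho_1[OF assms(2)]
      G_inv(2)[OF KZ_G[OF assms(1)]] by metis
  ultimately show "dv k e x" by simp
qed (rule dv_rho[OF assms(1)])

lemma dv_0: "dv k e 0"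
  by (simp add: dv_def V0_0)

lemma mv_const_vp_cancel: "mv_const (vp powi (- e)) * (mv_const (vp powi e) * x) = x"
proof -
  have "vp powi (- e) * vp powi e = 1" using vp_nonzero by (simp flip: power_int_add)
  then show ?thesis by (simp add: mult.assoc[symmetric] mv_const_1 flip: mv_const_mult)
qed

lemma dv_scale: "v \<in> V0 k \<Longrightarrow> dv k e (mv_const (vp powi e) * v)"
  by (simp add: dv_def mv_const_vp_cancel)

text \<open>A value at \<open>g\<close> belongs to the vertex of the inverse of \<open>g\<close>,
  hence the test on \<open>matrix_inv g\<close>. The result is equivariant if \<open>X\<close> is
  stable under \<open>KZ\<close> on the right.\<close>

definition res :: "('f^2^2) set \<Rightarrow> ('f, 'c) ifun \<Rightarrow> ('f, 'c) ifun" where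
  "res X f g = (if g \<in> G \<and> matrix_inv g \<in> X then f g else 0)"

lemma res_ind:
  assumes f: "f \<in> ind k (V k)" and X: "\<And>g \<kappa>. g \<in> X \<Longrightarrow> \<kappa> \<in> KZ \<Longrightarrow> g ** \<kappa> \<in> X"
  shows "res X f \<in> ind k (V k)"
  unfolding ind_V_iff
proof (intro conjI allI impI ballI)
  show "res X f g = 0" if "g \<notin> G" for g using that by (simp add: res_def)
  show "res X f g \<in> V k" for g using ind_V[OF f] V_0 by (simp add: res_def)
  show "res X f (\<kappa> ** g) = rho k \<kappa> (res X f g)" if \<kappa>: "\<kappa> \<in> KZ" and g: "g \<in> G" for \<kappa> g
  proof -
    have eq: "matrix_inv (\<kappa> ** g) = matrix_inv g ** matrix_inv \<kappa>" using matrix_inv_mult[OF KZ_G[OF \<kappa>] g] .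
    have "matrix_inv (\<kappa> ** g) \<in> X \<longleftrightarrow> matrix_inv g \<in> X"
      unfolding eq using X[OF _ KZ_matrix_inv[OF \<kappa>], of "matrix_inv g"]
        X[OF _ \<kappa>, of "matrix_inv g ** matrix_inv \<kappa>"] G_cancel(4)[OF KZ_G[OF \<kappa>], of "matrix_inv g"] by auto
    then show ?thesis
      unfolding res_def using ind_equivariant[OF f \<kappa> g] g G_mult[OF KZ_G[OF \<kappa>] g] by (simp add: rho_0)
  qed
  show "finite_support (res X f)"
    by (rule finite_support_union[OF ind_finite_support[OF f] ind_finite_support[OF f]])
      (auto simp: res_def split: if_splits)
qed

lemma atv_res: "g \<in> G \<Longrightarrow> atv (res X f) g = (if g \<in> X then atv f g else 0)"
  by (simp add: res_def G_matrix_inv matrix_inv_matrix_inv)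

definition ball_set :: "nat \<Rightarrow> ('f^2^2) set" where
  "ball_set N = {vert b n \<mu> ** \<kappa> | b n \<mu> \<kappa>. inside N b n \<and> \<mu> \<in> I n \<and> \<kappa> \<in> KZ}"

lemma ball_set_KZ: "g \<in> ball_set N \<Longrightarrow> \<kappa> \<in> KZ \<Longrightarrow> g ** \<kappa> \<in> ball_set N"
proof -
  assume "g \<in> ball_set N" "\<kappa> \<in> KZ"
  then obtain b n \<mu> l where "inside N b n" "\<mu> \<in> I n" "l \<in> KZ" "g = vert b n \<mu> ** l" unfolding ball_set_def by blast
  moreover have "l ** \<kappa> \<in> KZ" using KZ_mult[OF \<open>l \<in> KZ\<close> \<open>\<kappa> \<in> KZ\<close>] .
  ultimately show ?thesis unfolding ball_set_def by (auto simp flip: matrix_mul_assoc)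
qed

lemma vert_ball_set: "\<mu> \<in> I n \<Longrightarrow> vert b n \<mu> \<in> ball_set N \<longleftrightarrow> inside N b n"
proof
  assume \<mu>: "\<mu> \<in> I n" and "vert b n \<mu> \<in> ball_set N"
  then obtain b' m \<nu> \<kappa> where v: "inside N b' m" "\<nu> \<in> I m" "\<kappa> \<in> KZ" "vert b n \<mu> = vert b' m \<nu> ** \<kappa>"
    unfolding ball_set_def by blast
  have "b' = b \<and> m = n \<and> \<nu> = \<mu>" by (rule vert_unique[OF v(2) \<mu> v(3) v(4)[symmetric]])
  then show "inside N b n" using v(1) by simp
next
  assume "\<mu> \<in> I n" "inside N b n"
  moreover have "vert b n \<mu> = vert b n \<mu> ** mat 1" by simp
  ultimately show "vert b n \<mu> \<in> ball_set N" unfolding ball_set_def using one_KZ by blast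
qed

text \<open>Values inside the ball are unconstrained: the restriction of \<open>f\<close> to the
  ball serves as the part in \<open>B k N\<close>, and the rest vanishes there. Membership is thus a
  divisibility condition outside the ball.\<close>

lemma B_plus_iff:
  assumes F: "f \<in> ind k (V k)"
  shows "f \<in> B_plus k N e \<longleftrightarrow> (\<forall>b n. \<forall>\<mu>\<in>I n. \<not> inside N b n \<longrightarrow> dv k e (atv f (vert b n \<mu>)))"
proof
  assume "f \<in> B_plus k N e"
  then obtain b l where bl: "b \<in> B k N" "l \<in> ind k (V0 k)" "f = (\<lambda>h. b h + mv_const (vp powi e) * l h)"
    unfolding B_plus_def by blast
  show "\<forall>b n. \<forall>\<mu>\<in>I n. \<not> inside N b n \<longrightarrow> dv k e (atv f (vert b n \<mu>))"
  proof (intro allI ballI impI)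
    fix c n \<mu> assume "\<mu> \<in> I n" "\<not> inside N c n"
    then have "atv b (vert c n \<mu>) = 0" using bl(1) unfolding B_iff by blast
    then show "dv k e (atv f (vert c n \<mu>))" unfolding bl(3) using bl(2) by (simp add: dv_scale ind_V0_iff)
  qed
next
  assume d: "\<forall>b n. \<forall>\<mu>\<in>I n. \<not> inside N b n \<longrightarrow> dv k e (atv f (vert b n \<mu>))"
  define b where "b = res (ball_set N) f"
  have b: "b \<in> ind k (V k)" unfolding b_def by (rule res_ind[OF F ball_set_KZ])
  have bB: "b \<in> B k N"
    unfolding B_iff using b vert_ball_set by (auto simp: b_def atv_res vert_G)
  define r where "r = (\<lambda>g. f g - b g)"
  have r: "r \<in> ind k (V k)" unfolding r_def by (rule ind_V_diff[OF F b])
  define l where "l = (\<lambda>g. mv_const (vp powi (- e)) * r g)"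
  have l: "l \<in> ind k (V k)" unfolding l_def by (rule ind_V_scale[OF r])
  have "l g \<in> V0 k" for g
  proof (cases "g \<in> G")
    case True
    then obtain c n \<mu> where v: "\<mu> \<in> I n" "g ** vert c n \<mu> \<in> KZ" by (rule vert_cases)
    have "atv r (vert c n \<mu>) = (if inside N c n then 0 else atv f (vert c n \<mu>))"
      using vert_ball_set[OF v(1)] by (simp add: r_def b_def atv_res vert_G)
    then have "dv k e (atv r (vert c n \<mu>))" using d v(1) by (simp add: dv_0)
    moreover have "r g = rho k (g ** vert c n \<mu>) (atv r (vert c n \<mu>))"
      using bracket_at[OF r vert_G v(2)] v(2) by (simp add: bracket_def)
    ultimately have "dv k e (r g)" using dv_rho[OF v(2)] by simp
    then show ?thesis by (simp add: l_def dv_def)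
  qed (simp add: ind_outside[OF l] V0_0)
  then have lV0: "l \<in> ind k (V0 k)" using l by (simp add: ind_V0_iff)
  have "f = (\<lambda>h. b h + mv_const (vp powi e) * l h)"
    by (intro ext) (simp add: l_def r_def mv_const_vp_cancel[of "- e", simplified])
  then show "f \<in> B_plus k N e" unfolding B_plus_def using bB lV0 by blast
qed

text \<open>The local form of \<open>T - a\<close>: only the vertex and its neighbours enter, which
  is what permits restriction to one half.\<close>

lemma hecke_minus_atv:
  assumes "f \<in> ind k (V k)" "g \<in> G"
  shows "atv (hecke_minus k a f) g = (\<Sum>y\<in>Y. psi k y (atv f (g ** y))) - mv_const a * atv f g"
proof -
  have "matrix_inv y ** matrix_inv g = matrix_inv (g ** y)" if "y \<in> Y" for y
    using matrix_inv_mult[OF assms(2) Y_G[OF that]] by simp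
  then show ?thesis
    unfolding hecke_minus_def hecke_eq[OF assms(1) G_matrix_inv[OF assms(2)]] by simp
qed

lemma res_H0_B0:
  assumes "f \<in> ind k (V k)"
  shows "res H0 f \<in> B0 k"
  unfolding B0_iff
proof (intro conjI allI ballI)
  show "res H0 f \<in> ind k (V k)" by (rule res_ind[OF assms H0_KZ])
  fix n \<mu> assume "\<mu> \<in> I n"
  then have "g1 n \<mu> \<notin> H0" using g1_H1 H0_H1_disjoint by blast
  then show "atv (res H0 f) (g1 n \<mu>) = 0" by (simp add: atv_res g1_G)
qed

lemma res_H0_dv:
  assumes f: "f \<in> ind k (V k)" and d: "res H0 f \<in> B_plus k N e" and \<mu>: "\<mu> \<in> I m" "m > N"
  shows "dv k e (atv f (g0 m \<mu>))"
proof -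
  have r: "res H0 f \<in> ind k (V k)" by (rule res_ind[OF f H0_KZ])
  have "\<not> inside N True m" using \<mu>(2) by (simp add: inside_def)
  then have "dv k e (atv (res H0 f) (vert True m \<mu>))"
    using d \<mu>(1) unfolding B_plus_iff[OF r] by blast
  then show ?thesis using g0_H0[OF \<mu>(1)] by (simp add: vert_def atv_res g0_G)
qed

text \<open>Away from the central edge all neighbours of a vertex lie in the same half of the tree.\<close>

lemma hecke_minus_res_H0:
  assumes f: "f \<in> ind k (V k)" and N: "N > 0" and d: "hecke_minus k a f \<in> B_plus k N e"
  shows "hecke_minus k a (res H0 f) \<in> B_plus k N e"
proof -
  have r: "res H0 f \<in> ind k (V k)" by (rule res_ind[OF f H0_KZ])
  have d': "\<And>b n \<mu>. \<mu> \<in> I n \<Longrightarrow> \<not> inside N b n \<Longrightarrow> dv k e (atv (hecke_minus k a f) (vert b n \<mu>))"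
    using d unfolding B_plus_iff[OF hecke_minus_ind[OF f]] by blast
  show ?thesis
    unfolding B_plus_iff[OF hecke_minus_ind[OF r]]
  proof (intro allI ballI impI)
    fix b n \<mu> assume \<mu>: "\<mu> \<in> I n" and out: "\<not> inside N b n"
    \<comment> \<open>\<open>N > 0\<close> keeps away from the two ends of the central edge, where
      \<open>n = 0\<close> and \<open>T\<close> mixes the halves.\<close>
    have n: "n > 0" using N out by (cases b) (auto simp: inside_def)
    show "dv k e (atv (hecke_minus k a (res H0 f)) (vert b n \<mu>))"
    proof (cases b)
      case True
      have "atv (res H0 f) (g0 n \<mu> ** y) = atv f (g0 n \<mu> ** y)" if "y \<in> Y" for y
        using H0_neighbour[OF n \<mu> that] H0_G by (simp add: atv_res)
      moreover have "atv (res H0 f) (g0 n \<mu>) = atv f (g0 n \<mu>)"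
        using g0_H0[OF \<mu>] by (simp add: atv_res g0_G)
      ultimately have "atv (hecke_minus k a (res H0 f)) (g0 n \<mu>) = atv (hecke_minus k a f) (g0 n \<mu>)"
        by (simp add: hecke_minus_atv[OF r g0_G] hecke_minus_atv[OF f g0_G])
      then show ?thesis using d'[OF \<mu> out] True by (simp add: vert_def)
    next
      case False
      have "atv (res H0 f) (g1 n \<mu> ** y) = 0" if "y \<in> Y" for y
        using H1_neighbour[OF n \<mu> that] H1_G H0_H1_disjoint by (auto simp: atv_res)
      moreover have "atv (res H0 f) (g1 n \<mu>) = 0"
        using g1_H1[OF \<mu>] H0_H1_disjoint by (auto simp: atv_res g1_G)
      ultimately have "atv (hecke_minus k a (res H0 f)) (g1 n \<mu>) = 0"
        by (simp add: hecke_minus_atv[OF r g1_G] psi_0)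
      then show ?thesis using False by (simp add: vert_def dv_0)
    qed
  qed
qed

lemma inv_g0_beta: "matrix_inv (g0 n \<mu>) ** beta = (mat \<pi> ** w) ** matrix_inv (g1 n \<mu>)"
proof -
  have "matrix_inv (g0 n \<mu>) ** (beta ** g1 n \<mu>) ** matrix_inv (g1 n \<mu>) = matrix_inv (g0 n \<mu>) ** beta"
    using G_cancel(3)[OF g1_G, of "matrix_inv (g0 n \<mu>) ** beta" n \<mu>] by (simp add: matrix_mul_assoc)
  then show ?thesis unfolding beta_g1 G_cancel(1)[OF g0_G] by simp
qed

lemma inv_g1_beta: "matrix_inv (g1 n \<mu>) ** beta = w ** matrix_inv (g0 n \<mu>)"
proof -
  have "matrix_inv (g1 n \<mu>) ** (beta ** g0 n \<mu>) ** matrix_inv (g0 n \<mu>) = matrix_inv (g1 n \<mu>) ** beta"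
    using G_cancel(3)[OF g0_G, of "matrix_inv (g1 n \<mu>) ** beta" n \<mu>] by (simp add: matrix_mul_assoc)
  then show ?thesis unfolding beta_g0 G_cancel(1)[OF g1_G] by simp
qed

text \<open>The flip exchanges the vertices with equal parameters up to an element of
  \<open>KZ\<close>, and \<open>KZ\<close> does not affect divisibility.\<close>

lemma dv_translate_beta:
  assumes f: "f \<in> ind k (V k)"
  shows "dv k e (f (matrix_inv (vert b n \<mu>) ** beta)) \<longleftrightarrow> dv k e (atv f (vert (\<not> b) n \<mu>))"
proof (cases b)
  case True
  have \<kappa>: "mat \<pi> ** w \<in> KZ" using KZ_mult[OF mat_KZ[OF pi_nonzero] w_KZ] .
  have "f (matrix_inv (g0 n \<mu>) ** beta) = rho k (mat \<pi> ** w) (atv f (g1 n \<mu>))"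
    unfolding inv_g0_beta by (rule ind_equivariant[OF f \<kappa> G_matrix_inv[OF g1_G]])
  then show ?thesis using True dv_rho_iff[OF \<kappa> ind_V[OF f]] by (simp add: vert_def)
next
  case False
  have "f (matrix_inv (g1 n \<mu>) ** beta) = rho k w (atv f (g0 n \<mu>))"
    unfolding inv_g1_beta by (rule ind_equivariant[OF f w_KZ G_matrix_inv[OF g0_G]])
  then show ?thesis using False dv_rho_iff[OF w_KZ ind_V[OF f]] by (simp add: vert_def)
qed

text \<open>The separation property concerns functions supported on one half of the tree; the other half is
  its image under translation by \<open>beta\<close>.\<close>

lemma separated_pair_full:
  assumes sep: "separated_pair k a"
  shows "\<exists>N\<^sub>0. \<forall>N\<ge>N\<^sub>0. \<exists>E::nat. \<forall>n::nat. \<forall>f\<in>ind k (V k).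
    hecke_minus k a f \<in> B_plus k N (int n) \<longrightarrow> f \<in> B_plus k (Suc N) (int n - int E)"
proof -
  obtain M where M: "\<And>N. N \<ge> M \<Longrightarrow> N > 0 \<Longrightarrow> \<exists>\<epsilon>::nat. \<forall>n::nat. \<forall>f\<in>B0 k.
      hecke_minus k a f \<in> B_plus k N (int n) \<longrightarrow> f \<in> B_plus k (N - 1) (int n - int \<epsilon>)"
    using sep unfolding separated_pair_def by blast
  show ?thesis
  proof (rule exI[of _ "Suc M"], intro allI impI)
    fix N assume N: "Suc M \<le> N"
    obtain \<epsilon> :: nat where \<epsilon>: "\<And>n f. f \<in> B0 k \<Longrightarrow> hecke_minus k a f \<in> B_plus k N (int n) \<Longrightarrow>
        f \<in> B_plus k (N - 1) (int n - int \<epsilon>)"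
      using M[of N] N by auto
    \<comment> \<open>The flip does not preserve the ball of radius \<open>N\<close>; it only
      carries the outside of radius \<open>N + 1\<close> into the outside of radius
      \<open>N\<close>. So the second half uses separation at \<open>N + 1\<close>.\<close>
    obtain \<epsilon>' :: nat where \<epsilon>': "\<And>n f. f \<in> B0 k \<Longrightarrow> hecke_minus k a f \<in> B_plus k (Suc N) (int n) \<Longrightarrow>
        f \<in> B_plus k N (int n - int \<epsilon>')"
      using M[of "Suc N"] N by auto
    show "\<exists>E::nat. \<forall>n::nat. \<forall>f\<in>ind k (V k).
      hecke_minus k a f \<in> B_plus k N (int n) \<longrightarrow> f \<in> B_plus k (Suc N) (int n - int E)"
    \<comment> \<open>One constant for both halves: the sum dominates each of the two
      losses.\<close>
    proof (intro exI[of _ "\<epsilon> + \<epsilon>'"] allI ballI impI)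
      fix n :: nat and f assume f: "f \<in> ind k (V k)" and d: "hecke_minus k a f \<in> B_plus k N (int n)"
      have d': "\<And>b m \<mu>. \<mu> \<in> I m \<Longrightarrow> \<not> inside N b m \<Longrightarrow> dv k (int n) (atv (hecke_minus k a f) (vert b m \<mu>))"
        using d unfolding B_plus_iff[OF hecke_minus_ind[OF f]] by blast
      have "res H0 f \<in> B_plus k (N - 1) (int n - int \<epsilon>)"
        using \<epsilon>[OF res_H0_B0[OF f] hecke_minus_res_H0[OF f _ d]] N by simp
      then have half0: "dv k (int n - int \<epsilon>) (atv f (g0 m \<mu>))" if "\<mu> \<in> I m" "m \<ge> N" for m \<mu>
        using res_H0_dv[OF f _ that(1)] that(2) N by simp
      define fb where "fb = (\<lambda>g. f (g ** beta))"
      have fb: "fb \<in> ind k (V k)" unfolding fb_def by (rule translate_ind[OF f beta_G])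
      have "hecke_minus k a fb \<in> B_plus k (Suc N) (int n)"
        unfolding B_plus_iff[OF hecke_minus_ind[OF fb]]
      proof (intro allI ballI impI)
        fix b m \<mu> assume \<mu>: "\<mu> \<in> I m" and out: "\<not> inside (Suc N) b m"
        have "\<not> inside N (\<not> b) m" using out by (cases b) (auto simp: inside_def)
        then have "dv k (int n) (atv (hecke_minus k a f) (vert (\<not> b) m \<mu>))" by (rule d'[OF \<mu>])
        then show "dv k (int n) (atv (hecke_minus k a fb) (vert b m \<mu>))"
          unfolding fb_def hecke_minus_translate[OF f beta_G] dv_translate_beta[OF hecke_minus_ind[OF f]] .
      qed
      then have "res H0 fb \<in> B_plus k N (int n - int \<epsilon>')"
        using \<epsilon>'[OF res_H0_B0[OF fb] hecke_minus_res_H0[OF fb]] by simp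
      then have "dv k (int n - int \<epsilon>') (atv fb (vert True m \<mu>))" if "\<mu> \<in> I m" "m > N" for m \<mu>
        using res_H0_dv[OF fb _ that] by (simp add: vert_def)
      then have half1: "dv k (int n - int \<epsilon>') (atv f (g1 m \<mu>))" if "\<mu> \<in> I m" "m > N" for m \<mu>
        using that dv_translate_beta[OF f, of "int n - int \<epsilon>'" True m \<mu>] by (simp add: fb_def vert_def)
      show "f \<in> B_plus k (Suc N) (int n - int (\<epsilon> + \<epsilon>'))"
        unfolding B_plus_iff[OF f]
      proof (intro allI ballI impI)
        fix b m \<mu> assume \<mu>: "\<mu> \<in> I m" and out: "\<not> inside (Suc N) b m"
        show "dv k (int n - int (\<epsilon> + \<epsilon>')) (atv f (vert b m \<mu>))"
        proof (cases b)
          case True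
          then have "m \<ge> N" using out by (simp add: inside_def)
          have "dv k (int n - int (\<epsilon> + \<epsilon>')) (atv f (g0 m \<mu>))"
            by (rule dv_mono[OF half0[OF \<mu> \<open>m \<ge> N\<close>]]) simp
          then show ?thesis using True by (simp add: vert_def)
        next
          case False
          then have "m > N" using out by (simp add: inside_def)
          have "dv k (int n - int (\<epsilon> + \<epsilon>')) (atv f (g1 m \<mu>))"
            by (rule dv_mono[OF half1[OF \<mu> \<open>m > N\<close>]]) simp
          then show ?thesis using False by (simp add: vert_def)
        qed
      qed
    qed
  qed
qed

section \<open>A finite spanning family of \<open>B k N\<close> and bounded denominators\<close>

lemma ind_in_B:
  assumes f: "f \<in> ind k (V k)"
  shows "\<exists>M. \<forall>N\<ge>M. f \<in> B k N"
proof -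
  define D where "D = {(n, \<mu>). \<mu> \<in> I n \<and> atv f (vert True n \<mu>) \<noteq> 0} \<union> {(n, \<mu>). \<mu> \<in> I n \<and> atv f (vert False n \<mu>) \<noteq> 0}"
  have "finite (fst ` D)" unfolding D_def using finite_nonzero_vertices[OF f] by simp
  then obtain M where M: "\<forall>n\<in>fst ` D. n < M" unfolding finite_nat_set_iff_bounded by auto
  have "f \<in> B k N" if "N \<ge> M" for N
    unfolding B_iff
  proof (intro conjI f allI ballI impI)
    fix b n \<mu> assume \<mu>: "\<mu> \<in> I n" and out: "\<not> inside N b n"
    show "atv f (vert b n \<mu>) = 0"
    proof (rule ccontr)
      assume "atv f (vert b n \<mu>) \<noteq> 0"
      then have "(n, \<mu>) \<in> D" using \<mu> unfolding D_def by (cases b) auto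
      then have "n < M" using M by force
      then show False using out that by (cases b) (auto simp: inside_def)
    qed
  qed
  then show ?thesis by blast
qed

definition ball_vertices :: "nat \<Rightarrow> (bool \<times> nat \<times> 'f) set" where
  "ball_vertices N = (SIGMA b:UNIV. SIGMA n:{..N}. if inside N b n then I n else {})"

lemma finite_ball_vertices: "finite (ball_vertices N)"
  unfolding ball_vertices_def by (intro finite_SigmaI) (auto simp: finite_I)

lemma mem_ball_vertices: "(b, n, \<mu>) \<in> ball_vertices N \<longleftrightarrow> inside N b n \<and> \<mu> \<in> I n"
  by (cases b) (auto simp: ball_vertices_def inside_def)

lemma V_expansion: "v \<in> V k \<Longrightarrow> v = (\<Sum>i\<in>PiE S (\<lambda>\<sigma>. {..k \<sigma>}). mv_const (lk v (expo k i)) * monom_tensor k i)"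
proof -
  assume v: "v \<in> V k"
  then obtain c where c: "v = (\<Sum>i\<in>PiE S (\<lambda>\<sigma>. {..k \<sigma>}). sg (expo k i) (c i))"
    unfolding V_def V_over_def by (auto simp: mv_const_monom_tensor)
  have "lk v (expo k i) = c i" if i: "i \<in> PiE S (\<lambda>\<sigma>. {..k \<sigma>})" for i
  proof -
    have "lk v (expo k i) = (\<Sum>j\<in>PiE S (\<lambda>\<sigma>. {..k \<sigma>}). if j = i then c i else 0)"
      unfolding c lookup_sum lookup_single when_def by (rule sum.cong) (use i expo_inj in auto)
    then show ?thesis using i finite_weights by simp
  qed
  then have "(\<Sum>i\<in>PiE S (\<lambda>\<sigma>. {..k \<sigma>}). mv_const (lk v (expo k i)) * monom_tensor k i)
      = (\<Sum>i\<in>PiE S (\<lambda>\<sigma>. {..k \<sigma>}). sg (expo k i) (c i))"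
    by (intro sum.cong) (simp_all add: mv_const_monom_tensor)
  then show ?thesis using c by simp
qed

lemma monom_tensor_V: "i \<in> PiE S (\<lambda>\<sigma>. {..k \<sigma>}) \<Longrightarrow> monom_tensor k i \<in> V k"
  unfolding V_eq monom_tensor_eq by (rule homog_single[OF subring_UNIV UNIV_I wt_expo])

abbreviation basis :: "('f, 'c) weight \<Rightarrow> (bool \<times> nat \<times> 'f) \<times> ('f, 'c) weight \<Rightarrow> ('f, 'c) ifun" where
  "basis k j \<equiv> bracket k (vert (fst (fst j)) (fst (snd (fst j))) (snd (snd (fst j)))) (monom_tensor k (snd j))"

text \<open>At a given \<open>h\<close> only the brackets at the vertex of \<open>h\<close>
  contribute, and they recombine to \<open>f h\<close> when the value at that vertex is expanded
  into monomials.\<close>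

lemma B_expansion:
  assumes f: "f \<in> B k N"
  shows "\<exists>c. f = (\<lambda>h. \<Sum>j\<in>ball_vertices N \<times> PiE S (\<lambda>\<sigma>. {..k \<sigma>}). mv_const (c j) * basis k j h)"
proof -
  have fV: "f \<in> ind k (V k)" using f B_iff by blast
  define vx where "vx = (\<lambda>(b, n, \<mu>). vert b n \<mu>)"
  define c where "c j = lk (atv f (vx (fst j))) (expo k (snd j))" for j
  have "f h = (\<Sum>j\<in>ball_vertices N \<times> PiE S (\<lambda>\<sigma>. {..k \<sigma>}). mv_const (c j) * basis k j h)" for h
  proof (cases "h \<in> G")
    case True
    then obtain b n \<mu> where v: "\<mu> \<in> I n" "h ** vert b n \<mu> \<in> KZ" by (rule vert_cases)
    have fh: "f h = rho k (h ** vert b n \<mu>) (atv f (vert b n \<mu>))"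
      using bracket_at[OF fV vert_G v(2)] v(2) by (simp add: bracket_def)
    have inner: "(\<Sum>i\<in>PiE S (\<lambda>\<sigma>. {..k \<sigma>}). mv_const (c (x, i)) * bracket k (vx x) (monom_tensor k i) h)
        = (if x = (b, n, \<mu>) then f h else 0)" if x: "x \<in> ball_vertices N" for x
    proof (cases "x = (b, n, \<mu>)")
      case xeq: True
      have "(\<Sum>i\<in>PiE S (\<lambda>\<sigma>. {..k \<sigma>}). mv_const (c (x, i)) * bracket k (vx x) (monom_tensor k i) h)
          = rho k (h ** vert b n \<mu>) (\<Sum>i\<in>PiE S (\<lambda>\<sigma>. {..k \<sigma>}). mv_const (lk (atv f (vert b n \<mu>)) (expo k i)) * monom_tensor k i)"
        using v(2) by (simp add: rho_sum rho_scale bracket_def c_def vx_def xeq)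
      also have "\<dots> = f h" unfolding fh by (simp flip: V_expansion[OF ind_V[OF fV]])
      finally show ?thesis using xeq by simp
    next
      case False
      obtain b' m \<nu> where xeq: "x = (b', m, \<nu>)" by (cases x)
      have "\<nu> \<in> I m" using x by (simp add: xeq mem_ball_vertices)
      then have "h ** vx x \<notin> KZ"
        using vert_KZ_unique[OF v(2) _ v(1) _ True, of b' m \<nu>] False by (auto simp: xeq vx_def)
      then show ?thesis using False by (simp add: bracket_def)
    qed
    have "(\<Sum>j\<in>ball_vertices N \<times> PiE S (\<lambda>\<sigma>. {..k \<sigma>}). mv_const (c j) * basis k j h)
        = (\<Sum>x\<in>ball_vertices N. \<Sum>i\<in>PiE S (\<lambda>\<sigma>. {..k \<sigma>}). mv_const (c (x, i)) * bracket k (vx x) (monom_tensor k i) h)"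
      unfolding sum.cartesian_product by (rule sum.cong) (auto simp: vx_def)
    also have "\<dots> = (\<Sum>x\<in>ball_vertices N. if x = (b, n, \<mu>) then f h else 0)"
      by (rule sum.cong) (simp_all add: inner)
    also have "\<dots> = (if (b, n, \<mu>) \<in> ball_vertices N then f h else 0)"
      using finite_ball_vertices by simp
    also have "\<dots> = f h"
      using f v(1) fh unfolding B_iff mem_ball_vertices by (auto simp: rho_0)
    finally show ?thesis by simp
  next
    case False
    have "mv_const (c j) * basis k j h = 0" if "j \<in> ball_vertices N \<times> PiE S (\<lambda>\<sigma>. {..k \<sigma>})" for j
      using ind_outside[OF bracket_ind[OF vert_G monom_tensor_V] False] that by auto
    then show ?thesis using ind_outside[OF fV False] by simp
  qed
  then show ?thesis by blast
qed

lemma poly_denominator: "\<exists>t. \<forall>m. vp ^ t * lk P m \<in> OC" for P :: "('f, 'c) tensor"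
proof -
  have "\<exists>t. \<forall>m\<in>A. vp ^ t * lk P m \<in> OC" if "finite A" for A
    using that
  proof induction
    case (insert m A)
    then obtain t where t: "\<forall>m\<in>A. vp ^ t * lk P m \<in> OC" by blast
    obtain s where s: "vp ^ s * lk P m \<in> OC" using vp_denominator by blast
    have "\<forall>x\<in>insert m A. vp ^ (s + t) * lk P x \<in> OC"
      using vp_power_mono[OF s, of "s + t"] t vp_power_mono[of t _ "s + t"] by auto
    then show ?case by blast
  qed simp
  from this[of "ky P"] obtain t where t: "\<forall>m\<in>ky P. vp ^ t * lk P m \<in> OC" by auto
  have "vp ^ t * lk P m \<in> OC" for m
    using t by (cases "m \<in> ky P") (auto simp: in_keys_iff C.integers_0)
  then show ?thesis by blast
qed

text \<open>On a coset of \<open>KZ\<close> one representative controls the denominators, because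
  \<open>KZ\<close> preserves \<open>V0\<close>; the support consists of finitely many cosets, and
  each value has finitely many coefficients.\<close>

lemma ind_bounded:
  assumes f: "f \<in> ind k (V k)"
  shows "bounded_fun (\<lambda>(g, m). lk (f g) m)"
proof -
  obtain A where A: "finite A" "A \<subseteq> G" "\<forall>g\<in>G. f g \<noteq> 0 \<longrightarrow> (\<exists>h\<in>A. \<exists>\<kappa>\<in>KZ. g = \<kappa> ** h)"
    using ind_finite_support[OF f] unfolding finite_support_def by blast
  have "\<exists>t. \<forall>h\<in>A. \<forall>m. vp ^ t * lk (f h) m \<in> OC"
    using A(1)
  proof induction
    case (insert h A)
    then obtain t where t: "\<forall>h\<in>A. \<forall>m. vp ^ t * lk (f h) m \<in> OC" by blast
    obtain s where s: "\<forall>m. vp ^ s * lk (f h) m \<in> OC" using poly_denominator by blast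
    have "\<forall>x\<in>insert h A. \<forall>m. vp ^ (s + t) * lk (f x) m \<in> OC"
      using vp_power_mono[of s _ "s + t"] s t vp_power_mono[of t _ "s + t"] by auto
    then show ?case by blast
  qed simp
  then obtain t where t: "\<forall>h\<in>A. \<forall>m. vp ^ t * lk (f h) m \<in> OC" by blast
  have "vp ^ t * lk (f g) m \<in> OC" for g m
  proof (cases "g \<in> G \<and> f g \<noteq> 0")
    case True
    then obtain h \<kappa> where h: "h \<in> A" "\<kappa> \<in> KZ" "g = \<kappa> ** h" using A(3) by blast
    have "mv_const (vp ^ t) * f h \<in> V0 k"
      using t h(1) V_scale[OF ind_V[OF f]] by (simp add: V0_iff lookup_mv_const_mult)
    then have "rho k \<kappa> (mv_const (vp ^ t) * f h) \<in> V0 k" by (rule rho_V0[OF h(2)])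
    moreover have "rho k \<kappa> (mv_const (vp ^ t) * f h) = mv_const (vp ^ t) * f g"
      using ind_equivariant[OF f h(2)] h A(2) by (auto simp: rho_scale)
    ultimately show ?thesis by (simp add: V0_iff lookup_mv_const_mult)
  next
    case False
    then have "f g = 0" using ind_outside[OF f] by blast
    then show ?thesis by (simp add: C.integers_0)
  qed
  then show ?thesis unfolding bounded_fun_def by auto
qed

end

section \<open>Separation of the lattice\<close>

context gl2_setup
begin

lemma hecke_range_0: "(\<lambda>_. 0) \<in> hecke_range k a"
  unfolding hecke_range_def using ind_V_0 hecke_minus_0 by (metis (no_types, lifting) ext image_eqI)

lemma hecke_range_add:
  assumes "r \<in> hecke_range k a" "s \<in> hecke_range k a"
  shows "(\<lambda>g. r g + s g) \<in> hecke_range k a"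
proof -
  obtain f f' where "f \<in> ind k (V k)" "r = hecke_minus k a f" "f' \<in> ind k (V k)" "s = hecke_minus k a f'"
    using assms unfolding hecke_range_def by blast
  then have "(\<lambda>g. r g + s g) = hecke_minus k a (\<lambda>g. f g + f' g)" "(\<lambda>g. f g + f' g) \<in> ind k (V k)"
    using hecke_minus_add ind_V_add by auto
  then show ?thesis unfolding hecke_range_def by blast
qed

lemma hecke_range_scale:
  assumes "r \<in> hecke_range k a"
  shows "(\<lambda>g. mv_const c * r g) \<in> hecke_range k a"
proof -
  obtain f where "f \<in> ind k (V k)" "r = hecke_minus k a f"
    using assms unfolding hecke_range_def by blast
  then have "(\<lambda>g. mv_const c * r g) = hecke_minus k a (\<lambda>g. mv_const c * f g)" "(\<lambda>g. mv_const c * f g) \<in> ind k (V k)"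
    using hecke_minus_scale ind_V_scale by auto
  then show ?thesis unfolding hecke_range_def by blast
qed

lemma proj_self: "f \<in> proj k a f"
  unfolding proj_def using hecke_range_0 by force

lemma proj_shift:
  assumes r: "r \<in> hecke_range k a"
  shows "proj k a (\<lambda>g. f g + r g) = proj k a f"
proof (intro equalityI subsetI)
  fix x assume "x \<in> proj k a (\<lambda>g. f g + r g)"
  then obtain s where s: "s \<in> hecke_range k a" "x = (\<lambda>g. f g + r g + s g)" unfolding proj_def by blast
  then show "x \<in> proj k a f"
    unfolding proj_def using hecke_range_add[OF r s(1)] by (auto simp: add.assoc)
next
  fix x assume "x \<in> proj k a f"
  then obtain s where s: "s \<in> hecke_range k a" "x = (\<lambda>g. f g + s g)" unfolding proj_def by blast
  have "(\<lambda>g. s g + mv_const (- 1) * r g) \<in> hecke_range k a"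
    by (rule hecke_range_add[OF s(1) hecke_range_scale[OF r]])
  then have "(\<lambda>g. s g - r g) \<in> hecke_range k a" by (simp add: mv_const_minus_1)
  moreover have "x = (\<lambda>g. f g + r g + (s g - r g))" unfolding s(2) by simp
  ultimately show "x \<in> proj k a (\<lambda>g. f g + r g)" unfolding proj_def by (intro image_eqI[where x = "\<lambda>g. s g - r g"])
qed

text \<open>Scaling representatives of one class changes them by elements of the range of
  \<open>T - a\<close>, a subspace, so the union in \<open>Pi_scale\<close> collapses to a single
  class.\<close>

lemma Pi_scale_proj: "Pi_scale k a c (proj k a f) = proj k a (\<lambda>g. mv_const c * f g)"
proof -
  have "proj k a (\<lambda>h. mv_const c * x h) = proj k a (\<lambda>g. mv_const c * f g)" if x: "x \<in> proj k a f" for x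
  proof -
    obtain r where r: "r \<in> hecke_range k a" "x = (\<lambda>g. f g + r g)" using x unfolding proj_def by blast
    show ?thesis
      unfolding r(2) distrib_left by (rule proj_shift[OF hecke_range_scale[OF r(1)]])
  qed
  then show ?thesis unfolding Pi_scale_def using proj_self by blast
qed

text \<open>A function with polynomial values is read as a scalar function of pairs
  \<open>(g, m)\<close> with an exponent vector \<open>m\<close>. The image of \<open>B k N\<close>
  is then spanned by finitely many bounded functions, and \<open>span_closed\<close>
  applies.\<close>

lemma hecke_range_closed:
  assumes f: "f \<in> ind k (V k)"
    and approx: "\<And>n. \<exists>b\<in>B k N. \<exists>l\<in>ind k (V0 k). f = (\<lambda>g. hecke_minus k a b g + mv_const (vp ^ n) * l g)"
  shows "f \<in> hecke_range k a"
proof -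
  define J where "J = ball_vertices N \<times> PiE S (\<lambda>\<sigma>. {..k \<sigma>})"
  have fin: "finite J" unfolding J_def using finite_ball_vertices finite_weights by blast
  have basis: "basis k j \<in> ind k (V k)" if "j \<in> J" for j
    using that monom_tensor_V unfolding J_def by (auto intro!: bracket_ind vert_G)
  have hm: "hecke_minus k a (\<lambda>g. \<Sum>j\<in>J. mv_const (c j) * basis k j g) g
      = (\<Sum>j\<in>J. mv_const (c j) * hecke_minus k a (basis k j) g)" for c g
    using hecke_minus_sum[of J "\<lambda>j g. mv_const (c j) * basis k j g" k a g] ind_V_scale[OF basis]
      hecke_minus_scale[OF basis] by simp
  define u where "u j = (\<lambda>(g, m). lk (hecke_minus k a (basis k j) g) m)" for j
  have "\<exists>c. \<forall>x. (\<lambda>(g, m). lk (f g) m) x = (\<Sum>j\<in>J. c j * u j x)"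
  proof (rule span_closed[OF fin])
    show "bounded_fun (u j)" if "j \<in> J" for j
      unfolding u_def by (rule ind_bounded[OF hecke_minus_ind[OF basis[OF that]]])
    fix n
    obtain b l where bl: "b \<in> B k N" "l \<in> ind k (V0 k)" "f = (\<lambda>g. hecke_minus k a b g + mv_const (vp ^ n) * l g)"
      using approx by blast
    obtain c where c: "b = (\<lambda>g. \<Sum>j\<in>J. mv_const (c j) * basis k j g)"
      using B_expansion[OF bl(1)] unfolding J_def by blast
    have "lk (f g) m - (\<Sum>j\<in>J. c j * u j (g, m)) = vp ^ n * lk (l g) m" for g m
    proof -
      have "f g = (\<Sum>j\<in>J. mv_const (c j) * hecke_minus k a (basis k j) g) + mv_const (vp ^ n) * l g"
        unfolding bl(3) c hm ..
      then show ?thesis by (simp add: lookup_add lookup_sum lookup_mv_const_mult u_def)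
    qed
    moreover have "lk (l g) m \<in> OC" for g m using bl(2) by (simp add: ind_V0_iff V0_iff)
    ultimately show "\<exists>c. \<forall>x. C.odvd (vp ^ n) ((\<lambda>(g, m). lk (f g) m) x - (\<Sum>j\<in>J. c j * u j x))"
      by (intro exI[of _ c]) (auto simp: C.odvd_self_mult)
  qed
  then obtain c where c: "\<And>g m. lk (f g) m = (\<Sum>j\<in>J. c j * u j (g, m))" by auto
  have "f = hecke_minus k a (\<lambda>g. \<Sum>j\<in>J. mv_const (c j) * basis k j g)"
  proof
    fix g
    show "f g = hecke_minus k a (\<lambda>g. \<Sum>j\<in>J. mv_const (c j) * basis k j g) g"
      unfolding hm by (rule poly_mapping_eqI) (simp add: lookup_sum lookup_mv_const_mult c u_def)
  qed
  moreover have "(\<lambda>g. \<Sum>j\<in>J. mv_const (c j) * basis k j g) \<in> ind k (V k)"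
    by (intro ind_V_sum ind_V_scale basis)
  ultimately show ?thesis unfolding hecke_range_def by blast
qed

lemma hecke_range_if_infinitely_divisible:
  assumes a: "a \<in> OC" and sep: "separated_pair k a" and f: "f \<in> ind k (V k)"
    and div: "\<And>n. \<exists>l\<in>ind k (V0 k). \<exists>h\<in>ind k (V k). f = (\<lambda>g. mv_const (vp ^ n) * l g + hecke_minus k a h g)"
  shows "f \<in> hecke_range k a"
proof -
  obtain N\<^sub>0 where N0: "\<And>N. N \<ge> N\<^sub>0 \<Longrightarrow> \<exists>E::nat. \<forall>n::nat. \<forall>f\<in>ind k (V k).
      hecke_minus k a f \<in> B_plus k N (int n) \<longrightarrow> f \<in> B_plus k (Suc N) (int n - int E)"
    using separated_pair_full[OF sep] by blast
  obtain M where M: "\<And>N. N \<ge> M \<Longrightarrow> f \<in> B k N" using ind_in_B[OF f] by blast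
  \<comment> \<open>Large enough for the separation estimate and for \<open>f\<close> to lie in the
    ball, and independent of the precision \<open>n\<close>.\<close>
  define N where "N = max N\<^sub>0 M"
  obtain E :: nat where E: "\<And>n h. h \<in> ind k (V k) \<Longrightarrow> hecke_minus k a h \<in> B_plus k N (int n) \<Longrightarrow>
      h \<in> B_plus k (Suc N) (int n - int E)"
    using N0[of N] unfolding N_def by auto
  have fB: "f \<in> B k N" using M unfolding N_def by simp
  show ?thesis
  proof (rule hecke_range_closed[OF f])
    fix n
    \<comment> \<open>The exponent \<open>n + E\<close> anticipates the loss of \<open>E\<close> in
      the separation estimate.\<close>
    obtain l h where lh: "l \<in> ind k (V0 k)" "h \<in> ind k (V k)"
      "f = (\<lambda>g. mv_const (vp ^ (n + E)) * l g + hecke_minus k a h g)"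
      using div by blast
    have "hecke_minus k a h = (\<lambda>g. f g + mv_const (vp powi int (n + E)) * (mv_const (- 1) * l g))"
    proof
      fix g
      show "hecke_minus k a h g = f g + mv_const (vp powi int (n + E)) * (mv_const (- 1) * l g)"
        unfolding power_int_of_nat mv_const_minus_1 by (subst lh(3)) simp
    qed
    moreover have "(\<lambda>g. mv_const (- 1) * l g) \<in> ind k (V0 k)"
      by (rule ind_V0_scale[OF _ lh(1)]) (rule C.integers_uminus[OF C.integers_1])
    ultimately have "hecke_minus k a h \<in> B_plus k N (int (n + E))"
      unfolding B_plus_def
      by (intro CollectI exI[of _ f] exI[of _ "\<lambda>g. mv_const (- 1) * l g"]) (simp add: fB)
    from E[OF lh(2) this] obtain b e where be: "b \<in> B k (Suc N)" "e \<in> ind k (V0 k)"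
      "h = (\<lambda>g. b g + mv_const (vp powi int n) * e g)"
      unfolding B_plus_def by auto
    have b: "b \<in> ind k (V k)" using be(1) B_iff by blast
    have e: "e \<in> ind k (V k)" using ind_V0_V[OF be(2)] .
    \<comment> \<open>The integral part \<open>e\<close> of \<open>h\<close> is moved into the
      error; \<open>T - a\<close> keeps it integral because \<open>a\<close> is integral.\<close>
    define l' where "l' = (\<lambda>g. mv_const (vp ^ E) * l g + hecke_minus k a e g)"
    have "l' \<in> ind k (V0 k)"
      unfolding l'_def
      by (intro ind_V0_add ind_V0_scale C.integers_power vp_integral lh(1) hecke_minus_V0 a be(2))
    moreover have "f = (\<lambda>g. hecke_minus k a b g + mv_const (vp ^ n) * l' g)"
    proof
      fix g
      have "hecke_minus k a h g = hecke_minus k a b g + mv_const (vp ^ n) * hecke_minus k a e g"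
        unfolding be(3) power_int_of_nat
        using hecke_minus_add[OF b ind_V_scale[OF e]] hecke_minus_scale[OF e] by simp
      then show "f g = hecke_minus k a b g + mv_const (vp ^ n) * l' g"
        by (subst lh(3)) (simp add: l'_def power_add mv_const_mult algebra_simps)
    qed
    ultimately show "\<exists>b\<in>B k (Suc N). \<exists>l\<in>ind k (V0 k). f = (\<lambda>g. hecke_minus k a b g + mv_const (vp ^ n) * l g)"
      using be(1) by blast
  qed
qed

text \<open>Equal classes have representatives differing by an element of the range. The power 0
  provides one integral representative \<open>f\<close>, and all other powers then become
  approximations of this fixed \<open>f\<close>.\<close>

lemma Theta_separated:
  assumes a: "a \<in> OC" and sep: "separated_pair k a"
  shows "(\<Inter>n. Pi_scale k a (vp ^ n) ` Theta k a) = {Pi_zero k a}"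
proof (intro equalityI subsetI)
  fix Q assume Q: "Q \<in> (\<Inter>n. Pi_scale k a (vp ^ n) ` Theta k a)"
  have div: "\<exists>l\<in>ind k (V0 k). Q = proj k a (\<lambda>g. mv_const (vp ^ n) * l g)" for n
  proof -
    have "Q \<in> Pi_scale k a (vp ^ n) ` Theta k a" using Q by blast
    then obtain l where "l \<in> ind k (V0 k)" "Q = Pi_scale k a (vp ^ n) (proj k a l)"
      unfolding Theta_def by blast
    then show ?thesis unfolding Pi_scale_proj by blast
  qed
  obtain f where f: "f \<in> ind k (V0 k)" "Q = proj k a f"
    using div[of 0] by (auto simp: mv_const_1)
  have "f \<in> hecke_range k a"
  proof (rule hecke_range_if_infinitely_divisible[OF a sep ind_V0_V[OF f(1)]])
    fix n
    obtain l where l: "l \<in> ind k (V0 k)" "Q = proj k a (\<lambda>g. mv_const (vp ^ n) * l g)" using div by blast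
    have "f \<in> proj k a (\<lambda>g. mv_const (vp ^ n) * l g)" using proj_self f(2) l(2) by metis
    then show "\<exists>l\<in>ind k (V0 k). \<exists>h\<in>ind k (V k). f = (\<lambda>g. mv_const (vp ^ n) * l g + hecke_minus k a h g)"
      unfolding proj_def hecke_range_def using l(1) by blast
  qed
  then have "Q = Pi_zero k a"
    unfolding f(2) Pi_zero_def using proj_shift[of f k a "\<lambda>_. 0"] by simp
  then show "Q \<in> {Pi_zero k a}" by simp
next
  fix Q assume "Q \<in> {Pi_zero k a}"
  moreover have "Pi_zero k a \<in> Pi_scale k a (vp ^ n) ` Theta k a" for n
  proof -
    have "Pi_scale k a (vp ^ n) (Pi_zero k a) = Pi_zero k a"
      unfolding Pi_zero_def Pi_scale_proj by simp
    moreover have "Pi_zero k a \<in> Theta k a"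
      unfolding Theta_def Pi_zero_def using ind_V_0 V0_0 by (auto simp: ind_V0_iff)
    ultimately show ?thesis by (metis imageI)
  qed
  ultimately show "Q \<in> (\<Inter>n. Pi_scale k a (vp ^ n) ` Theta k a)" by blast
qed

end

theorem theorem4p5:
  fixes \<iota>F :: "'p::prime_card padic \<Rightarrow> 'f::field"
    and \<iota>C :: "'p padic \<Rightarrow> 'c::field"
    and \<pi> :: 'f
    and rt :: "('f \<Rightarrow> 'c) \<Rightarrow> 'c"
    and \<sigma>\<^sub>0 :: "'f \<Rightarrow> 'c"
    and k :: "('f \<Rightarrow> 'c) \<Rightarrow> nat"
    and a :: 'c
  assumes "gl2_setup \<iota>F \<iota>C \<pi> rt \<sigma>\<^sub>0"
    and "a \<in> integers \<iota>C"
    and "gl2_setup.separated_pair \<iota>F \<iota>C \<pi> rt \<sigma>\<^sub>0 k a"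
  shows "(\<Inter>n. gl2_setup.Pi_scale \<iota>F \<iota>C \<pi> rt k a (\<sigma>\<^sub>0 \<pi> ^ n) ` gl2_setup.Theta \<iota>F \<iota>C \<pi> rt k a)
    = {gl2_setup.Pi_zero \<iota>F \<iota>C \<pi> rt k a}"
  using assms(2,3) by (rule gl2_setup.Theta_separated[OF assms(1)])

end
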